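(* Let $(\mathcal{B},\mathbb{E},\mathfrak{s})$ be an extriangulated category and let $((\mathcal{S},\mathcal{T}),(\mathcal{U},\mathcal{V}))$ be a twin cotorsion pair on $\mathcal{B}$ with heart $\underline{\mathcal{H}}$. Then $\underline{\mathcal{H}}$ is an abelian category if and only if for every epimorphism $\alpha:B\to C$ in $\underline{\mathcal{H}}$ there is an $\mathbb{E}$-triangle $$B'\xrightarrow{p'}C'\to S\dashrightarrow$$ with $B',C'\in\mathcal{H}$ and $S\in\mathcal{S}$ such that the image $\underline{p'}$ of $p'$ in $\underline{\mathcal{H}}$ equals $\alpha$ up to isomorphism, i.e. there are isomorphisms $\beta:B\to B'$ and $\gamma:C\to C'$ in $\underline{\mathcal{H}}$ with $\underline{p'}\,\beta=\gamma\,\alpha$.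
   Context: Extriangulated categories (Nakaoka–Palu). Let $\mathcal{B}$ be an additive category with an additive bifunctor $\mathbb{E}:\mathcal{B}^{\mathrm{op}}\times\mathcal{B}\to\mathbf{Ab}$. For $\delta\in\mathbb{E}(C,A)$, $a:A\to A'$, $c:C'\to C$ write $a_*\delta=\mathbb{E}(C,a)(\delta)$, $c^*\delta=\mathbb{E}(c,A)(\delta)$. A morphism from $\delta\in\mathbb{E}(C,A)$ to $\delta'\in\mathbb{E}(C',A')$ is a pair $(a:A\to A',c:C\to C')$ with $a_*\delta=c^*\delta'$. Sequences $A\xrightarrow{x}B\xrightarrow{y}C$ and $A\xrightarrow{x'}B'\xrightarrow{y'}C$ are equivalent if there is an isomorphism $b:B\to B'$ with $bx=x'$, $y'b=y$. $\mathfrak{s}$ assigns to each $\delta\in\mathbb{E}(C,A)$ an equivalence class $\mathfrak{s}(\delta)=[A\xrightarrow{x}B\xrightarrow{y}C]$ such that every morphism $(a,c):\delta\to\delta'$ admits $b:B\to B'$ with $bx=x'a$, $y'b=cy$; moreover $\mathfrak{s}(0)=[A\to A\oplus C\to C]$ and $\mathfrak{s}(\delta\oplus\delta')=\mathfrak{s}(\delta)\oplus\mathfrak{s}(\delta')$. $(\mathcal{B},\mathbb{E},\mathfrak{s})$ is extriangulated if also: (ET3) given $\delta,\delta'$ realized by $A\xrightarrow{x}B\xrightarrow{y}C$, $A'\xrightarrow{x'}B'\xrightarrow{y'}C'$ and $a,b$ with $bx=x'a$, there is $c$ with $cy=y'b$ and $a_*\delta=c^*\delta'$; (ET4) if $\delta\in\mathbb{E}(D,A)$,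 $\delta'\in\mathbb{E}(F,B)$ are realized by $A\xrightarrow{f}B\xrightarrow{f'}D$, $B\xrightarrow{g}C\xrightarrow{g'}F$, there are an object $E$, morphisms $d:D\to E$, $e:E\to F$, $h':C\to E$ and $\delta''\in\mathbb{E}(E,A)$ realized by $A\xrightarrow{gf}C\xrightarrow{h'}E$ with $h'g=df'$, $eh'=g'$, $D\xrightarrow{d}E\xrightarrow{e}F$ realizing $f'_*\delta'$, $d^*\delta''=\delta$, $f_*\delta''=e^*\delta'$; and the duals (ET3)$^{\mathrm{op}}$, (ET4)$^{\mathrm{op}}$. If $\mathfrak{s}(\delta)=[A\xrightarrow{x}B\xrightarrow{y}C]$, then $A\xrightarrow{x}B\xrightarrow{y}C\overset{\delta}{\dashrightarrow}$ is called an $\mathbb{E}$-triangle. Twin cotorsion pairs and hearts. Subcategories are full and closed under isomorphisms. A cotorsion pair $(\mathcal{U},\mathcal{V})$ on $\mathcal{B}$ consists of two subcategories closed under direct summands with $\mathbb{E}(\mathcal{U},\mathcal{V})=0$ such that every $B\in\mathcal{B}$ has $\mathbb{E}$-triangles $V_B\to U_B\to B\dashrightarrow$ and $B\to V^B\to U^B\dashrightarrow$ with $U_B,U^B\in\mathcal{U}$, $V_B,V^B\in\mathcal{V}$. A twin cotorsion pair is a pair of cotorsion pairs $((\mathcal{S},\mathcal{T}),(\mathcal{U},\mathcal{V}))$ with $\mathcal{S}\subseteq\mathcal{U}$. Put $\mathcal{W}=\mathcal{T}\cap\mathcal{U}$. For a subcategory $\mathcal{D}\supseteq\mathcal{W}$,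 the ideal quotient $\mathcal{D}/\mathcal{W}$ has the objects of $\mathcal{D}$ and morphisms those of $\mathcal{D}$ modulo morphisms factoring through objects of $\mathcal{W}$; the image of $f$ is denoted $\underline{f}$. Let $\mathcal{B}^+$ be the class of $X\in\mathcal{B}$ having an $\mathbb{E}$-triangle $V\to W\to X\dashrightarrow$ with $V\in\mathcal{V}$, $W\in\mathcal{W}$; $\mathcal{B}^-$ the class of $Y\in\mathcal{B}$ having an $\mathbb{E}$-triangle $Y\to W'\to S\dashrightarrow$ with $S\in\mathcal{S}$, $W'\in\mathcal{W}$; $\mathcal{H}=\mathcal{B}^+\cap\mathcal{B}^-$. The heart of the twin cotorsion pair is $\underline{\mathcal{H}}=\mathcal{H}/\mathcal{W}$. *)

theory Defs
  imports "HOL-Algebra.Group"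
begin

section \<open>Categories\<close>

record ('o, 'm) cat =
  Obj :: "'o set"
  Arr :: "'m set"
  Dom :: "'m \<Rightarrow> 'o"
  Cod :: "'m \<Rightarrow> 'o"
  Ident :: "'o \<Rightarrow> 'm"
  Compose :: "'m \<Rightarrow> 'm \<Rightarrow> 'm" (infixr "\<cdot>\<index>" 70)

text \<open>\<open>g \<cdot> f\<close> is \<open>f\<close> followed by \<open>g\<close>; it is meaningful only if \<open>Cod f = Dom g\<close>.\<close>

definition Hom :: "('o, 'm, 'z) cat_scheme \<Rightarrow> 'o \<Rightarrow> 'o \<Rightarrow> 'm set"
  where "Hom C X Y = {f \<in> Arr C. Dom C f = X \<and> Cod C f = Y}"

locale category =
  fixes C :: "('o, 'm, 'z) cat_scheme" (structure)
  assumes Dom_in: "f \<in> Arr C \<Longrightarrow> Dom C f \<in> Obj C"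
    and Cod_in: "f \<in> Arr C \<Longrightarrow> Cod C f \<in> Obj C"
    and Ident_in: "X \<in> Obj C \<Longrightarrow> Ident C X \<in> Hom C X X"
    and Compose_in: "\<lbrakk>f \<in> Hom C X Y; g \<in> Hom C Y Z\<rbrakk> \<Longrightarrow> g \<cdot> f \<in> Hom C X Z"
    and Compose_assoc:
      "\<lbrakk>f \<in> Hom C X Y; g \<in> Hom C Y Z; h \<in> Hom C Z T\<rbrakk> \<Longrightarrow> (h \<cdot> g) \<cdot> f = h \<cdot> (g \<cdot> f)"
    and Ident_left: "f \<in> Hom C X Y \<Longrightarrow> Ident C Y \<cdot> f = f"
    and Ident_right: "f \<in> Hom C X Y \<Longrightarrow> f \<cdot> Ident C X = f"

definition is_isomorphism :: "('o, 'm, 'z) cat_scheme \<Rightarrow> 'm \<Rightarrow> bool"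
  where "is_isomorphism C f \<longleftrightarrow> f \<in> Arr C \<and>
    (\<exists>g \<in> Hom C (Cod C f) (Dom C f).
       g \<cdot>\<^bsub>C\<^esub> f = Ident C (Dom C f) \<and> f \<cdot>\<^bsub>C\<^esub> g = Ident C (Cod C f))"

definition is_mono :: "('o, 'm, 'z) cat_scheme \<Rightarrow> 'm \<Rightarrow> bool"
  where "is_mono C f \<longleftrightarrow> f \<in> Arr C \<and>
    (\<forall>X \<in> Obj C. \<forall>g \<in> Hom C X (Dom C f). \<forall>h \<in> Hom C X (Dom C f).
       f \<cdot>\<^bsub>C\<^esub> g = f \<cdot>\<^bsub>C\<^esub> h \<longrightarrow> g = h)"

definition is_epi :: "('o, 'm, 'z) cat_scheme \<Rightarrow> 'm \<Rightarrow> bool"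
  where "is_epi C f \<longleftrightarrow> f \<in> Arr C \<and>
    (\<forall>X \<in> Obj C. \<forall>g \<in> Hom C (Cod C f) X. \<forall>h \<in> Hom C (Cod C f) X.
       g \<cdot>\<^bsub>C\<^esub> f = h \<cdot>\<^bsub>C\<^esub> f \<longrightarrow> g = h)"

definition isomorphic :: "('o, 'm, 'z) cat_scheme \<Rightarrow> 'o \<Rightarrow> 'o \<Rightarrow> bool"
  where "isomorphic C X Y \<longleftrightarrow> (\<exists>f \<in> Hom C X Y. is_isomorphism C f)"


section \<open>Additive and abelian categories\<close>

record ('o, 'm) precat = "('o, 'm) cat" +
  Add :: "'m \<Rightarrow> 'm \<Rightarrow> 'm" (infixl "\<boxplus>\<index>" 65)
  Zero :: "'o \<Rightarrow> 'o \<Rightarrow> 'm"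

definition Hom_group :: "('o, 'm, 'z) precat_scheme \<Rightarrow> 'o \<Rightarrow> 'o \<Rightarrow> 'm monoid"
  where "Hom_group C X Y = \<lparr>carrier = Hom C X Y, mult = Add C, one = Zero C X Y\<rparr>"

locale preadditive_category = category C
  for C :: "('o, 'm, 'z) precat_scheme" (structure) +
  assumes Hom_comm_group: "\<lbrakk>X \<in> Obj C; Y \<in> Obj C\<rbrakk> \<Longrightarrow> comm_group (Hom_group C X Y)"
    and Compose_Add_left:
      "\<lbrakk>f \<in> Hom C X Y; g \<in> Hom C Y Z; g' \<in> Hom C Y Z\<rbrakk> \<Longrightarrow> (g \<boxplus> g') \<cdot> f = (g \<cdot> f) \<boxplus> (g' \<cdot> f)"
    and Compose_Add_right:
      "\<lbrakk>f \<in> Hom C X Y; f' \<in> Hom C X Y; g \<in> Hom C Y Z\<rbrakk> \<Longrightarrow> g \<cdot> (f \<boxplus> f') = (g \<cdot> f) \<boxplus> (g \<cdot> f')"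

definition zero_object :: "('o, 'm, 'z) cat_scheme \<Rightarrow> 'o \<Rightarrow> bool"
  where "zero_object C Z \<longleftrightarrow> Z \<in> Obj C \<and>
    (\<forall>X \<in> Obj C. (\<exists>!f. f \<in> Hom C X Z) \<and> (\<exists>!f. f \<in> Hom C Z X))"

definition biproduct ::
  "('o, 'm, 'z) precat_scheme \<Rightarrow> 'o \<Rightarrow> 'o \<Rightarrow> 'o \<Rightarrow> 'm \<Rightarrow> 'm \<Rightarrow> 'm \<Rightarrow> 'm \<Rightarrow> bool"
  where "biproduct C X Y P i j p q \<longleftrightarrow>
    X \<in> Obj C \<and> Y \<in> Obj C \<and> P \<in> Obj C \<and>
    i \<in> Hom C X P \<and> j \<in> Hom C Y P \<and> p \<in> Hom C P X \<and> q \<in> Hom C P Y \<and>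
    p \<cdot>\<^bsub>C\<^esub> i = Ident C X \<and> q \<cdot>\<^bsub>C\<^esub> j = Ident C Y \<and>
    p \<cdot>\<^bsub>C\<^esub> j = Zero C Y X \<and> q \<cdot>\<^bsub>C\<^esub> i = Zero C X Y \<and>
    (i \<cdot>\<^bsub>C\<^esub> p) \<boxplus>\<^bsub>C\<^esub> (j \<cdot>\<^bsub>C\<^esub> q) = Ident C P"

locale additive_category = preadditive_category C
  for C :: "('o, 'm, 'z) precat_scheme" (structure) +
  assumes ex_zero_object: "\<exists>Z. zero_object C Z"
    and ex_biproduct: "\<lbrakk>X \<in> Obj C; Y \<in> Obj C\<rbrakk> \<Longrightarrow> \<exists>P i j p q. biproduct C X Y P i j p q"

definition is_kernel :: "('o, 'm, 'z) precat_scheme \<Rightarrow> 'm \<Rightarrow> 'm \<Rightarrow> bool"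
  where "is_kernel C f k \<longleftrightarrow> f \<in> Arr C \<and> k \<in> Arr C \<and> Cod C k = Dom C f \<and>
    f \<cdot>\<^bsub>C\<^esub> k = Zero C (Dom C k) (Cod C f) \<and>
    (\<forall>X \<in> Obj C. \<forall>g \<in> Hom C X (Dom C f). f \<cdot>\<^bsub>C\<^esub> g = Zero C X (Cod C f) \<longrightarrow>
       (\<exists>!u. u \<in> Hom C X (Dom C k) \<and> k \<cdot>\<^bsub>C\<^esub> u = g))"

definition is_cokernel :: "('o, 'm, 'z) precat_scheme \<Rightarrow> 'm \<Rightarrow> 'm \<Rightarrow> bool"
  where "is_cokernel C f c \<longleftrightarrow> f \<in> Arr C \<and> c \<in> Arr C \<and> Dom C c = Cod C f \<and>
    c \<cdot>\<^bsub>C\<^esub> f = Zero C (Dom C f) (Cod C c) \<and>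
    (\<forall>X \<in> Obj C. \<forall>g \<in> Hom C (Cod C f) X. g \<cdot>\<^bsub>C\<^esub> f = Zero C (Dom C f) X \<longrightarrow>
       (\<exists>!u. u \<in> Hom C (Cod C c) X \<and> u \<cdot>\<^bsub>C\<^esub> c = g))"

locale abelian_category = additive_category C
  for C :: "('o, 'm, 'z) precat_scheme" (structure) +
  assumes ex_kernel: "f \<in> Arr C \<Longrightarrow> \<exists>k. is_kernel C f k"
    and ex_cokernel: "f \<in> Arr C \<Longrightarrow> \<exists>c. is_cokernel C f c"
    and mono_is_kernel: "is_mono C f \<Longrightarrow> \<exists>g. is_kernel C g f"
    and epi_is_cokernel: "is_epi C f \<Longrightarrow> \<exists>g. is_cokernel C g f"


section \<open>Ideal quotients\<close>

definition factors_through :: "('o, 'm, 'z) cat_scheme \<Rightarrow> 'o set \<Rightarrow> 'm \<Rightarrow> bool"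
  where "factors_through C W f \<longleftrightarrow>
    (\<exists>X \<in> W. \<exists>g \<in> Hom C (Dom C f) X. \<exists>h \<in> Hom C X (Cod C f). f = h \<cdot>\<^bsub>C\<^esub> g)"

definition ideal_rel :: "('o, 'm, 'z) precat_scheme \<Rightarrow> 'o set \<Rightarrow> 'o set \<Rightarrow> ('m \<times> 'm) set"
  where "ideal_rel C D W = {(f, f'). \<exists>X \<in> D. \<exists>Y \<in> D. f \<in> Hom C X Y \<and> f' \<in> Hom C X Y \<and>
    (\<exists>h \<in> Hom C X Y. factors_through C W h \<and> f = f' \<boxplus>\<^bsub>C\<^esub> h)}"

definition ideal_class :: "('o, 'm, 'z) precat_scheme \<Rightarrow> 'o set \<Rightarrow> 'o set \<Rightarrow> 'm \<Rightarrow> 'm set"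
  where "ideal_class C D W f = ideal_rel C D W `` {f}"

text \<open>The category \<open>D/W\<close> for full subcategories \<open>D\<close> and \<open>W\<close> given by their sets of objects. Its
  morphisms are equivalence classes. All members of a class have the same domain and codomain, and
  the unions over representatives are unions of equal sets whenever the morphisms factoring
  through \<open>W\<close> form an ideal.\<close>

definition ideal_quotient ::
  "('o, 'm, 'z) precat_scheme \<Rightarrow> 'o set \<Rightarrow> 'o set \<Rightarrow> ('o, 'm set) precat"
  where "ideal_quotient C D W =
    \<lparr>Obj = D,
     Arr = {f \<in> Arr C. Dom C f \<in> D \<and> Cod C f \<in> D} // ideal_rel C D W,
     Dom = (\<lambda>F. the_elem (Dom C ` F)),
     Cod = (\<lambda>F. the_elem (Cod C ` F)),
     Ident = (\<lambda>X. ideal_class C D W (Ident C X)),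
     Compose = (\<lambda>G F. \<Union>g \<in> G. \<Union>f \<in> F. ideal_class C D W (g \<cdot>\<^bsub>C\<^esub> f)),
     Add = (\<lambda>F G. \<Union>f \<in> F. \<Union>g \<in> G. ideal_class C D W (f \<boxplus>\<^bsub>C\<^esub> g)),
     Zero = (\<lambda>X Y. ideal_class C D W (Zero C X Y))\<rparr>"


section \<open>Extriangulated categories\<close>

text \<open>\<open>Ext B C A\<close> is the group \<open>\<E>(C, A)\<close> (written multiplicatively, so its zero is \<open>\<one>\<close>), \<open>Eact B c a\<close>
  is \<open>\<E>(c, a)\<close>, and \<open>Real B C A \<delta>\<close> is the class \<open>\<s>(\<delta>)\<close> for \<open>\<delta> \<in> \<E>(C, A)\<close>. A sequence \<open>A \<rightarrow> M \<rightarrow> C\<close> is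
  the pair of its two morphisms.\<close>

record ('o, 'm, 'e) extri = "('o, 'm) precat" +
  Ext :: "'o \<Rightarrow> 'o \<Rightarrow> 'e monoid"
  Eact :: "'m \<Rightarrow> 'm \<Rightarrow> 'e \<Rightarrow> 'e"
  Real :: "'o \<Rightarrow> 'o \<Rightarrow> 'e \<Rightarrow> ('m \<times> 'm) set"

definition push :: "('o, 'm, 'e, 'z) extri_scheme \<Rightarrow> 'o \<Rightarrow> 'm \<Rightarrow> 'e \<Rightarrow> 'e"
  where "push B C a \<delta> = Eact B (Ident B C) a \<delta>"

definition pull :: "('o, 'm, 'e, 'z) extri_scheme \<Rightarrow> 'o \<Rightarrow> 'm \<Rightarrow> 'e \<Rightarrow> 'e"
  where "pull B A c \<delta> = Eact B c (Ident B A) \<delta>"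

definition seqs :: "('o, 'm, 'z) cat_scheme \<Rightarrow> 'o \<Rightarrow> 'o \<Rightarrow> ('m \<times> 'm) set"
  where "seqs B A C = {(x, y). \<exists>M \<in> Obj B. x \<in> Hom B A M \<and> y \<in> Hom B M C}"

definition seq_equiv ::
  "('o, 'm, 'z) cat_scheme \<Rightarrow> 'o \<Rightarrow> 'o \<Rightarrow> (('m \<times> 'm) \<times> ('m \<times> 'm)) set"
  where "seq_equiv B A C = {((x, y), (x', y')). (x, y) \<in> seqs B A C \<and> (x', y') \<in> seqs B A C \<and>
    (\<exists>b \<in> Hom B (Cod B x) (Cod B x'). is_isomorphism B b \<and> b \<cdot>\<^bsub>B\<^esub> x = x' \<and> y' \<cdot>\<^bsub>B\<^esub> b = y)}"

definition etriangle ::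
  "('o, 'm, 'e, 'z) extri_scheme \<Rightarrow> 'o \<Rightarrow> 'm \<Rightarrow> 'o \<Rightarrow> 'm \<Rightarrow> 'o \<Rightarrow> 'e \<Rightarrow> bool"
  where "etriangle B A x M y C \<delta> \<longleftrightarrow>
    A \<in> Obj B \<and> M \<in> Obj B \<and> C \<in> Obj B \<and> x \<in> Hom B A M \<and> y \<in> Hom B M C \<and>
    \<delta> \<in> carrier (Ext B C A) \<and> (x, y) \<in> Real B C A \<delta>"

locale ext_bifunctor = additive_category B
  for B :: "('o, 'm, 'e, 'z) extri_scheme" (structure) +
  assumes Ext_comm_group: "\<lbrakk>C \<in> Obj B; A \<in> Obj B\<rbrakk> \<Longrightarrow> comm_group (Ext B C A)"
    and Eact_hom:
      "\<lbrakk>c \<in> Hom B C' C; a \<in> Hom B A A'\<rbrakk> \<Longrightarrow> Eact B c a \<in> hom (Ext B C A) (Ext B C' A')"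
    and Eact_Ident:
      "\<lbrakk>C \<in> Obj B; A \<in> Obj B; \<delta> \<in> carrier (Ext B C A)\<rbrakk> \<Longrightarrow>
        Eact B (Ident B C) (Ident B A) \<delta> = \<delta>"
    and Eact_Compose:
      "\<lbrakk>c \<in> Hom B C' C; c' \<in> Hom B C'' C'; a \<in> Hom B A A'; a' \<in> Hom B A' A'';
        \<delta> \<in> carrier (Ext B C A)\<rbrakk> \<Longrightarrow>
        Eact B (c \<cdot> c') (a' \<cdot> a) \<delta> = Eact B c' a' (Eact B c a \<delta>)"
    and Eact_Add_left:
      "\<lbrakk>c \<in> Hom B C' C; c' \<in> Hom B C' C; a \<in> Hom B A A'; \<delta> \<in> carrier (Ext B C A)\<rbrakk> \<Longrightarrow>
        Eact B (c \<boxplus> c') a \<delta> = Eact B c a \<delta> \<otimes>\<^bsub>Ext B C' A'\<^esub> Eact B c' a \<delta>"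
    and Eact_Add_right:
      "\<lbrakk>c \<in> Hom B C' C; a \<in> Hom B A A'; a' \<in> Hom B A A'; \<delta> \<in> carrier (Ext B C A)\<rbrakk> \<Longrightarrow>
        Eact B c (a \<boxplus> a') \<delta> = Eact B c a \<delta> \<otimes>\<^bsub>Ext B C' A'\<^esub> Eact B c a' \<delta>"

text \<open>In \<open>Real_sum\<close>, the extension \<open>\<delta> \<oplus> \<delta>'\<close> is the element of \<open>\<E>(C \<oplus> C', A \<oplus> A')\<close> that corresponds to
  \<open>(\<delta>, 0, 0, \<delta>')\<close> in \<open>\<E>(C, A) \<oplus> \<E>(C, A') \<oplus> \<E>(C', A) \<oplus> \<E>(C', A')\<close>, namely
  \<open>\<E>(p\<^sub>C, i\<^sub>A)(\<delta>) + \<E>(p\<^sub>C\<^sub>', i\<^sub>A\<^sub>')(\<delta>')\<close>; similarly \<open>x \<oplus> x' = i\<^sub>M x p\<^sub>A + i\<^sub>M\<^sub>' x' p\<^sub>A\<^sub>'\<close>.\<close>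

locale additive_realization = ext_bifunctor B
  for B :: "('o, 'm, 'e, 'z) extri_scheme" (structure) +
  assumes Real_class:
      "\<lbrakk>C \<in> Obj B; A \<in> Obj B; \<delta> \<in> carrier (Ext B C A)\<rbrakk> \<Longrightarrow>
        Real B C A \<delta> \<in> seqs B A C // seq_equiv B A C"
    and Real_morphism:
      "\<lbrakk>etriangle B A x M y C \<delta>; etriangle B A' x' M' y' C' \<delta>';
        a \<in> Hom B A A'; c \<in> Hom B C C'; push B C a \<delta> = pull B A' c \<delta>'\<rbrakk> \<Longrightarrow>
        \<exists>b \<in> Hom B M M'. b \<cdot> x = x' \<cdot> a \<and> y' \<cdot> b = c \<cdot> y"
    and Real_zero:
      "biproduct B A C P i j p q \<Longrightarrow> etriangle B A i P q C \<one>\<^bsub>Ext B C A\<^esub>"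
    and Real_sum:
      "\<lbrakk>etriangle B A x M y C \<delta>; etriangle B A' x' M' y' C' \<delta>';
        biproduct B A A' A2 iA iA' pA pA';
        biproduct B M M' M2 iM iM' pM pM';
        biproduct B C C' C2 iC iC' pC pC'\<rbrakk> \<Longrightarrow>
        etriangle B
          A2 (iM \<cdot> x \<cdot> pA \<boxplus> iM' \<cdot> x' \<cdot> pA')
          M2 (iC \<cdot> y \<cdot> pM \<boxplus> iC' \<cdot> y' \<cdot> pM')
          C2 (Eact B pC iA \<delta> \<otimes>\<^bsub>Ext B C2 A2\<^esub> Eact B pC' iA' \<delta>')"

locale extriangulated = additive_realization B
  for B :: "('o, 'm, 'e, 'z) extri_scheme" (structure) +
  assumes ET3:
      "\<lbrakk>etriangle B A x M y C \<delta>; etriangle B A' x' M' y' C' \<delta>';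
        a \<in> Hom B A A'; b \<in> Hom B M M'; b \<cdot> x = x' \<cdot> a\<rbrakk> \<Longrightarrow>
        \<exists>c \<in> Hom B C C'. c \<cdot> y = y' \<cdot> b \<and> push B C a \<delta> = pull B A' c \<delta>'"
    and ET3_op:
      "\<lbrakk>etriangle B A x M y C \<delta>; etriangle B A' x' M' y' C' \<delta>';
        b \<in> Hom B M M'; c \<in> Hom B C C'; c \<cdot> y = y' \<cdot> b\<rbrakk> \<Longrightarrow>
        \<exists>a \<in> Hom B A A'. b \<cdot> x = x' \<cdot> a \<and> push B C a \<delta> = pull B A' c \<delta>'"
    and ET4:
      "\<lbrakk>etriangle B A f M f' D \<delta>; etriangle B M g N g' F \<delta>'\<rbrakk> \<Longrightarrow>
        \<exists>E d e h' \<delta>''. d \<in> Hom B D E \<and> e \<in> Hom B E F \<and> h' \<in> Hom B N E \<and>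
          etriangle B A (g \<cdot> f) N h' E \<delta>'' \<and>
          h' \<cdot> g = d \<cdot> f' \<and> e \<cdot> h' = g' \<and>
          etriangle B D d E e F (push B F f' \<delta>') \<and>
          pull B A d \<delta>'' = \<delta> \<and> push B E f \<delta>'' = pull B M e \<delta>'"
    and ET4_op:
      "\<lbrakk>etriangle B D f' M f A \<delta>; etriangle B F g' N g M \<delta>'\<rbrakk> \<Longrightarrow>
        \<exists>E d e h' \<delta>''. d \<in> Hom B E D \<and> e \<in> Hom B F E \<and> h' \<in> Hom B E N \<and>
          etriangle B E h' N (f \<cdot> g) A \<delta>'' \<and>
          g \<cdot> h' = f' \<cdot> d \<and> h' \<cdot> e = g' \<and>
          etriangle B F e E d D (pull B F f' \<delta>') \<and>
          push B A d \<delta>'' = \<delta> \<and> pull B E f \<delta>'' = push B M e \<delta>'"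


section \<open>Twin cotorsion pairs and their hearts\<close>

definition iso_closed :: "('o, 'm, 'z) cat_scheme \<Rightarrow> 'o set \<Rightarrow> bool"
  where "iso_closed C D \<longleftrightarrow> D \<subseteq> Obj C \<and> (\<forall>X \<in> D. \<forall>Y \<in> Obj C. isomorphic C X Y \<longrightarrow> Y \<in> D)"

definition summand_closed :: "('o, 'm, 'z) precat_scheme \<Rightarrow> 'o set \<Rightarrow> bool"
  where "summand_closed C D \<longleftrightarrow>
    (\<forall>P \<in> D. \<forall>X Y i j p q. biproduct C X Y P i j p q \<longrightarrow> X \<in> D)"

definition cotorsion_pair :: "('o, 'm, 'e, 'z) extri_scheme \<Rightarrow> 'o set \<Rightarrow> 'o set \<Rightarrow> bool"
  where "cotorsion_pair B U V \<longleftrightarrow>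
    iso_closed B U \<and> iso_closed B V \<and> summand_closed B U \<and> summand_closed B V \<and>
    (\<forall>X \<in> U. \<forall>Y \<in> V. carrier (Ext B X Y) = {\<one>\<^bsub>Ext B X Y\<^esub>}) \<and>
    (\<forall>X \<in> Obj B. \<exists>V\<^sub>X \<in> V. \<exists>U\<^sub>X \<in> U. \<exists>x y \<delta>. etriangle B V\<^sub>X x U\<^sub>X y X \<delta>) \<and>
    (\<forall>X \<in> Obj B. \<exists>V\<^sub>X \<in> V. \<exists>U\<^sub>X \<in> U. \<exists>x y \<delta>. etriangle B X x V\<^sub>X y U\<^sub>X \<delta>)"

definition twin_cotorsion_pair ::
  "('o, 'm, 'e, 'z) extri_scheme \<Rightarrow> 'o set \<Rightarrow> 'o set \<Rightarrow> 'o set \<Rightarrow> 'o set \<Rightarrow> bool"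
  where "twin_cotorsion_pair B S T U V \<longleftrightarrow>
    cotorsion_pair B S T \<and> cotorsion_pair B U V \<and> S \<subseteq> U"

definition B_plus ::
  "('o, 'm, 'e, 'z) extri_scheme \<Rightarrow> 'o set \<Rightarrow> 'o set \<Rightarrow> 'o set \<Rightarrow> 'o set \<Rightarrow> 'o set"
  where "B_plus B S T U V =
    {X \<in> Obj B. \<exists>Y \<in> V. \<exists>W \<in> T \<inter> U. \<exists>x y \<delta>. etriangle B Y x W y X \<delta>}"

definition B_minus ::
  "('o, 'm, 'e, 'z) extri_scheme \<Rightarrow> 'o set \<Rightarrow> 'o set \<Rightarrow> 'o set \<Rightarrow> 'o set \<Rightarrow> 'o set"
  where "B_minus B S T U V =
    {X \<in> Obj B. \<exists>W \<in> T \<inter> U. \<exists>Y \<in> S. \<exists>x y \<delta>. etriangle B X x W y Y \<delta>}"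

definition heart_objects ::
  "('o, 'm, 'e, 'z) extri_scheme \<Rightarrow> 'o set \<Rightarrow> 'o set \<Rightarrow> 'o set \<Rightarrow> 'o set \<Rightarrow> 'o set"
  where "heart_objects B S T U V = B_plus B S T U V \<inter> B_minus B S T U V"

definition heart ::
  "('o, 'm, 'e, 'z) extri_scheme \<Rightarrow> 'o set \<Rightarrow> 'o set \<Rightarrow> 'o set \<Rightarrow> 'o set \<Rightarrow> ('o, 'm set) precat"
  where "heart B S T U V = ideal_quotient B (heart_objects B S T U V) (T \<inter> U)"

definition heart_class ::
  "('o, 'm, 'e, 'z) extri_scheme \<Rightarrow> 'o set \<Rightarrow> 'o set \<Rightarrow> 'o set \<Rightarrow> 'o set \<Rightarrow> 'm \<Rightarrow> 'm set"
  where "heart_class B S T U V f = ideal_class B (heart_objects B S T U V) (T \<inter> U) f"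

end

theory Submission
  imports Defs
begin

text \<open>
  Write \<open>W = T \<inter> U\<close> and call the first morphism \<open>X \<rightarrow> Y\<close> of an extriangle \<open>X \<rightarrow> Y \<rightarrow> Z\<close> with
  \<open>X, Y\<close> in the heart objects \<open>H\<close> and \<open>Z \<in> S\<close> an \<open>S\<close>-inflation. The theorem holds because, up to
  isomorphism, \<open>S\<close>-inflations are exactly the cokernels of \<open>H/W\<close>.

  \<^item> Every \<open>f : A \<rightarrow> A'\<close> in \<open>H/W\<close> has a cokernel that is an \<open>S\<close>-inflation
    (\<open>heart_morphism_factorization\<close>). As \<open>A \<in> B\<^sup>-\<close>, there is an extriangle \<open>A \<rightarrow> W\<^sub>A \<rightarrow> S\<^sub>0\<close>; its pushout along
    \<open>f\<close> is an extriangle \<open>A' \<rightarrow> C\<^sub>0 \<rightarrow> S\<^sub>0\<close>, and a morphism on \<open>A'\<close> extends to \<open>C\<^sub>0\<close> as soon as its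
    composite with \<open>f\<close> factors through \<open>W\<close>, because \<open>\<E>(S, T) = 0\<close>. Reflecting \<open>C\<^sub>0\<close> into \<open>H\<close>
    (\<open>reflection_into_heart\<close>) is once more an extension by an object of \<open>S\<close>.

  \<^item> Every \<open>S\<close>-inflation \<open>p : X \<rightarrow> Y\<close> is the cokernel of its kernel (\<open>S_inflation_kernel_cokernel\<close>).
    As \<open>Y \<in> B\<^sup>+\<close>, there is an extriangle \<open>V' \<rightarrow> W\<^sub>Y \<rightarrow> Y\<close>. Its pullback \<open>k : K \<rightarrow> X\<close> along \<open>p\<close> is the
    kernel, and the axiom (ET4)\<open>\<^sup>o\<^sup>p\<close> exhibits \<open>X \<rightarrow> Y \<rightarrow> Z\<close> as the pushout along \<open>k\<close> of an
    extriangle \<open>K \<rightarrow> W\<^sub>Y \<rightarrow> Z\<close>. The latter also shows \<open>K \<in> H\<close>.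

  So the condition of the theorem says that every epimorphism of \<open>H/W\<close> is a cokernel, which holds
  in an abelian category. For the converse, the cokernels are there, and what has to be found are
  kernels of all morphisms, and a proof that monomorphisms are kernels. Both come from a
  factorization \<open>f = k r\<close> in which \<open>k\<close> is the kernel of the cokernel of \<open>f\<close> and \<open>r\<close> is an
  epimorphism. To see the latter, choose an extriangle \<open>V' \<rightarrow> U' \<rightarrow> C\<^sub>0\<close> with \<open>V' \<in> V\<close>, \<open>U' \<in> U\<close> and pull it
  back to \<open>V' \<rightarrow> K \<rightarrow> A'\<close>. There results an extriangle \<open>K \<rightarrow> U' \<rightarrow> S\<^sub>0\<close>, and it is the pushout of
  \<open>A \<rightarrow> W\<^sub>A \<rightarrow> S\<^sub>0\<close> along \<open>r\<close>, since \<open>\<E>(S\<^sub>0, V') = 0\<close>. Hence a morphism from \<open>K\<close> to an object of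
  \<open>H\<close> whose composite with \<open>r\<close> factors through \<open>W\<close> extends to \<open>U'\<close>, and all morphisms from \<open>U\<close> to
  \<open>B\<^sup>+\<close> factor through \<open>W\<close>.
  Under the condition, \<open>r\<close> is an \<open>S\<close>-inflation up to isomorphism, so it has a kernel, which is a
  kernel of \<open>f\<close> because \<open>k\<close> is mono. If \<open>f\<close> itself is mono, then \<open>r\<close> is a cokernel of zero,
  hence invertible, and \<open>f\<close> is a kernel along with \<open>k\<close>.
\<close>

section \<open>Calculus of arrows\<close>

context category
begin

lemma Hom_iff: "f \<in> Hom C X Y \<longleftrightarrow> f \<in> Arr C \<and> Dom C f = X \<and> Cod C f = Y"
  by (simp add: Hom_def)

lemma Dom_Obj [simp]: "f \<in> Arr C \<Longrightarrow> Dom C f \<in> Obj C"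
  by (rule Dom_in)

lemma Cod_Obj [simp]: "f \<in> Arr C \<Longrightarrow> Cod C f \<in> Obj C"
  by (rule Cod_in)

lemma Hom_Obj: "f \<in> Hom C X Y \<Longrightarrow> X \<in> Obj C \<and> Y \<in> Obj C"
  by (auto simp: Hom_iff)

lemma comp_Arr [simp]:
  assumes "f \<in> Arr C" "g \<in> Arr C" "Cod C f = Dom C g"
  shows "g \<cdot> f \<in> Arr C" "Dom C (g \<cdot> f) = Dom C f" "Cod C (g \<cdot> f) = Cod C g"
  using Compose_in[of f "Dom C f" "Cod C f" g "Cod C g"] assms by (auto simp: Hom_iff)

lemma comp_assoc [simp]:
  assumes "f \<in> Arr C" "g \<in> Arr C" "h \<in> Arr C" "Cod C f = Dom C g" "Cod C g = Dom C h"
  shows "(h \<cdot> g) \<cdot> f = h \<cdot> (g \<cdot> f)"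
  using Compose_assoc[of f "Dom C f" "Cod C f" g "Cod C g" h "Cod C h"] assms
  by (auto simp: Hom_iff)

lemma Ident_Arr [simp]:
  assumes "X \<in> Obj C"
  shows "Ident C X \<in> Arr C" "Dom C (Ident C X) = X" "Cod C (Ident C X) = X"
  using Ident_in[OF assms] by (auto simp: Hom_iff)

lemma Ident_comp [simp]: "f \<in> Arr C \<Longrightarrow> Cod C f = X \<Longrightarrow> Ident C X \<cdot> f = f"
  using Ident_left[of f "Dom C f" X] by (simp add: Hom_iff)

lemma comp_Ident [simp]: "f \<in> Arr C \<Longrightarrow> Dom C f = X \<Longrightarrow> f \<cdot> Ident C X = f"
  using Ident_right[of f X "Cod C f"] by (simp add: Hom_iff)

text \<open>Composites are normalized to the right, so an equation \<open>g \<cdot> f = k\<close> is invisible inside \<open>g \<cdot> f \<cdot> h\<close>; this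
  lemma makes it applicable there.\<close>

lemma comp_reassoc:
  assumes "g \<cdot> f = k" "f \<in> Arr C" "g \<in> Arr C" "h \<in> Arr C"
    "Cod C f = Dom C g" "Cod C h = Dom C f"
  shows "g \<cdot> (f \<cdot> h) = k \<cdot> h"
  using assms comp_assoc[of h f g] by simp

end

context preadditive_category
begin

text \<open>The hom-group is read off from the arrow, which spares the notation its object indices.\<close>

definition Neg :: "'m \<Rightarrow> 'm"
  where "Neg f = inv\<^bsub>Hom_group C (Dom C f) (Cod C f)\<^esub> f"

definition Sub :: "'m \<Rightarrow> 'm \<Rightarrow> 'm"
  where "Sub f g = f \<boxplus> Neg g"

lemma Add_Arr [simp]:
  assumes "f \<in> Arr C" "g \<in> Arr C" "Dom C f = Dom C g" "Cod C f = Cod C g"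
  shows "f \<boxplus> g \<in> Arr C" "Dom C (f \<boxplus> g) = Dom C g" "Cod C (f \<boxplus> g) = Cod C g"
proof -
  interpret G: comm_group "Hom_group C (Dom C g) (Cod C g)"
    by (rule Hom_comm_group) (use assms in auto)
  show "f \<boxplus> g \<in> Arr C" "Dom C (f \<boxplus> g) = Dom C g" "Cod C (f \<boxplus> g) = Cod C g"
    using G.m_closed[of f g] assms by (auto simp: Hom_group_def Hom_iff)
qed

lemma Zero_Arr [simp]:
  assumes "X \<in> Obj C" "Y \<in> Obj C"
  shows "Zero C X Y \<in> Arr C" "Dom C (Zero C X Y) = X" "Cod C (Zero C X Y) = Y"
proof -
  interpret G: comm_group "Hom_group C X Y" by (rule Hom_comm_group) (use assms in auto)
  show "Zero C X Y \<in> Arr C" "Dom C (Zero C X Y) = X" "Cod C (Zero C X Y) = Y"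
    using G.one_closed by (auto simp: Hom_group_def Hom_iff)
qed

lemma Neg_Arr [simp]:
  assumes "f \<in> Arr C"
  shows "Neg f \<in> Arr C" "Dom C (Neg f) = Dom C f" "Cod C (Neg f) = Cod C f"
proof -
  interpret G: comm_group "Hom_group C (Dom C f) (Cod C f)"
    by (rule Hom_comm_group) (use assms in auto)
  show "Neg f \<in> Arr C" "Dom C (Neg f) = Dom C f" "Cod C (Neg f) = Cod C f"
    using G.inv_closed[of f] assms by (auto simp: Hom_group_def Hom_iff Neg_def)
qed

lemma Add_assoc:
  assumes "f \<in> Hom C X Y" "g \<in> Hom C X Y" "h \<in> Hom C X Y"
  shows "(f \<boxplus> g) \<boxplus> h = f \<boxplus> (g \<boxplus> h)"
proof -
  interpret G: comm_group "Hom_group C X Y"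
    by (rule Hom_comm_group) (use assms Hom_Obj in auto)
  show ?thesis using G.m_assoc[of f g h] assms by (simp add: Hom_group_def)
qed

lemma Add_comm:
  assumes "f \<in> Hom C X Y" "g \<in> Hom C X Y"
  shows "f \<boxplus> g = g \<boxplus> f"
proof -
  interpret G: comm_group "Hom_group C X Y"
    by (rule Hom_comm_group) (use assms Hom_Obj in auto)
  show ?thesis using G.m_comm[of f g] assms by (simp add: Hom_group_def)
qed

lemma Zero_Add [simp]:
  assumes "f \<in> Arr C" "Dom C f = X" "Cod C f = Y"
  shows "Zero C X Y \<boxplus> f = f" "f \<boxplus> Zero C X Y = f"
proof -
  interpret G: comm_group "Hom_group C X Y"
    by (rule Hom_comm_group) (use assms in auto)
  show "Zero C X Y \<boxplus> f = f" "f \<boxplus> Zero C X Y = f"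
    using G.l_one[of f] G.r_one[of f] assms by (auto simp: Hom_group_def Hom_iff)
qed

lemma Add_Neg [simp]:
  assumes "f \<in> Arr C"
  shows "f \<boxplus> Neg f = Zero C (Dom C f) (Cod C f)" "Neg f \<boxplus> f = Zero C (Dom C f) (Cod C f)"
proof -
  interpret G: comm_group "Hom_group C (Dom C f) (Cod C f)"
    by (rule Hom_comm_group) (use assms in auto)
  show "f \<boxplus> Neg f = Zero C (Dom C f) (Cod C f)" "Neg f \<boxplus> f = Zero C (Dom C f) (Cod C f)"
    using G.r_inv[of f] G.l_inv[of f] assms by (auto simp: Hom_group_def Hom_iff Neg_def)
qed

lemma Add_left_cancel:
  assumes "f \<in> Hom C X Y" "g \<in> Hom C X Y" "h \<in> Hom C X Y" "f \<boxplus> g = f \<boxplus> h"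
  shows "g = h"
proof -
  interpret G: comm_group "Hom_group C X Y"
    by (rule Hom_comm_group) (use assms Hom_Obj in auto)
  show ?thesis using G.right_cancel[of f g h] G.m_comm[of f g] G.m_comm[of f h] assms by (simp add: Hom_group_def)
qed

lemma comp_Add [simp]:
  assumes "f \<in> Arr C" "f' \<in> Arr C" "g \<in> Arr C" "Dom C f = Dom C f'" "Cod C f = Cod C f'"
    "Cod C f' = Dom C g"
  shows "g \<cdot> (f \<boxplus> f') = (g \<cdot> f) \<boxplus> (g \<cdot> f')"
  using assms by (intro Compose_Add_right[of f "Dom C f" "Dom C g" f' g "Cod C g"]) (auto simp: Hom_iff)

lemma Add_comp [simp]:
  assumes "f \<in> Arr C" "g \<in> Arr C" "g' \<in> Arr C" "Dom C g = Dom C g'" "Cod C g = Cod C g'"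
    "Cod C f = Dom C g'"
  shows "(g \<boxplus> g') \<cdot> f = (g \<cdot> f) \<boxplus> (g' \<cdot> f)"
  using assms by (intro Compose_Add_left[of f "Dom C f" "Dom C g" g "Cod C g" g']) (auto simp: Hom_iff)

lemma comp_Zero [simp]:
  assumes "f \<in> Arr C" "X \<in> Obj C" "Dom C f = Y"
  shows "f \<cdot> Zero C X Y = Zero C X (Cod C f)"
proof -
  have Y: "Y \<in> Obj C" using assms by auto
  have "f \<cdot> (Zero C X Y \<boxplus> Zero C X Y) = f \<cdot> Zero C X Y \<boxplus> f \<cdot> Zero C X Y"
    by (rule comp_Add) (use assms Y in auto)
  also have "Zero C X Y \<boxplus> Zero C X Y = Zero C X Y" using assms Y by simp
  finally have "f \<cdot> Zero C X Y \<boxplus> f \<cdot> Zero C X Y = f \<cdot> Zero C X Y \<boxplus> Zero C X (Cod C f)"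
    using assms Y by simp
  then show ?thesis
    by (rule Add_left_cancel[rotated 3]) (use assms Y in \<open>auto simp: Hom_iff\<close>)
qed

lemma Zero_comp [simp]:
  assumes "f \<in> Arr C" "X \<in> Obj C" "Cod C f = Y"
  shows "Zero C Y X \<cdot> f = Zero C (Dom C f) X"
proof -
  have Y: "Y \<in> Obj C" using assms by auto
  have "(Zero C Y X \<boxplus> Zero C Y X) \<cdot> f = Zero C Y X \<cdot> f \<boxplus> Zero C Y X \<cdot> f"
    by (rule Add_comp) (use assms Y in auto)
  also have "Zero C Y X \<boxplus> Zero C Y X = Zero C Y X" using assms Y by simp
  finally have "Zero C Y X \<cdot> f \<boxplus> Zero C Y X \<cdot> f = Zero C Y X \<cdot> f \<boxplus> Zero C (Dom C f) X"
    using assms Y by simp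
  then show ?thesis
    by (rule Add_left_cancel[rotated 3]) (use assms Y in \<open>auto simp: Hom_iff\<close>)
qed

lemma Neg_unique:
  assumes "f \<in> Hom C X Y" "g \<in> Hom C X Y" "f \<boxplus> g = Zero C X Y"
  shows "g = Neg f"
  by (rule Add_left_cancel[of f X Y]) (use assms in \<open>auto simp: Hom_iff\<close>)

lemma comp_Neg [simp]:
  assumes "f \<in> Arr C" "g \<in> Arr C" "Cod C f = Dom C g"
  shows "g \<cdot> Neg f = Neg (g \<cdot> f)"
proof (rule Neg_unique[of _ "Dom C f" "Cod C g"])
  have "g \<cdot> f \<boxplus> g \<cdot> Neg f = g \<cdot> (f \<boxplus> Neg f)"
    by (rule comp_Add[symmetric]) (use assms in auto)
  then show "g \<cdot> f \<boxplus> g \<cdot> Neg f = Zero C (Dom C f) (Cod C g)" using assms by simp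
qed (use assms in \<open>auto simp: Hom_iff\<close>)

lemma Neg_comp [simp]:
  assumes "f \<in> Arr C" "g \<in> Arr C" "Cod C f = Dom C g"
  shows "Neg g \<cdot> f = Neg (g \<cdot> f)"
proof (rule Neg_unique[of _ "Dom C f" "Cod C g"])
  have "g \<cdot> f \<boxplus> Neg g \<cdot> f = (g \<boxplus> Neg g) \<cdot> f"
    by (rule Add_comp[symmetric]) (use assms in auto)
  then show "g \<cdot> f \<boxplus> Neg g \<cdot> f = Zero C (Dom C f) (Cod C g)" using assms by simp
qed (use assms in \<open>auto simp: Hom_iff\<close>)

lemma Sub_Arr [simp]:
  assumes "f \<in> Arr C" "g \<in> Arr C" "Dom C f = Dom C g" "Cod C f = Cod C g"
  shows "Sub f g \<in> Arr C" "Dom C (Sub f g) = Dom C g" "Cod C (Sub f g) = Cod C g"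
  using assms by (simp_all add: Sub_def)

lemma Sub_self [simp]: "f \<in> Arr C \<Longrightarrow> Sub f f = Zero C (Dom C f) (Cod C f)"
  by (simp add: Sub_def)

lemma Add_Sub:
  assumes "f \<in> Arr C" "g \<in> Arr C" "Dom C f = Dom C g" "Cod C f = Cod C g"
  shows "g \<boxplus> Sub f g = f"
proof -
  have "g \<boxplus> Sub f g = Sub f g \<boxplus> g"
    by (rule Add_comm[of _ "Dom C g" "Cod C g"]) (use assms in \<open>auto simp: Hom_iff\<close>)
  also have "\<dots> = f \<boxplus> (Neg g \<boxplus> g)" unfolding Sub_def
    by (rule Add_assoc[of _ "Dom C g" "Cod C g"]) (use assms in \<open>auto simp: Hom_iff\<close>)
  finally show ?thesis using assms by simp
qed

lemma Sub_unique:
  assumes "f \<in> Hom C X Y" "g \<in> Hom C X Y" "h \<in> Hom C X Y" "f = g \<boxplus> h"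
  shows "h = Sub f g"
  by (rule Add_left_cancel[of g X Y]) (use assms Add_Sub[of f g] in \<open>auto simp: Hom_iff\<close>)

lemma Sub_eq_Zero:
  assumes "f \<in> Hom C X Y" "g \<in> Hom C X Y" "Sub f g = Zero C X Y"
  shows "f = g"
  using assms Add_Sub[of f g] by (auto simp: Hom_iff)

lemma comp_Sub [simp]:
  assumes "f \<in> Arr C" "f' \<in> Arr C" "g \<in> Arr C" "Dom C f = Dom C f'" "Cod C f = Cod C f'"
    "Cod C f' = Dom C g"
  shows "g \<cdot> Sub f f' = Sub (g \<cdot> f) (g \<cdot> f')"
  using assms by (simp add: Sub_def)

lemma Sub_comp [simp]:
  assumes "f \<in> Arr C" "g \<in> Arr C" "g' \<in> Arr C" "Dom C g = Dom C g'" "Cod C g = Cod C g'"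
    "Cod C f = Dom C g'"
  shows "Sub g g' \<cdot> f = Sub (g \<cdot> f) (g' \<cdot> f)"
  using assms by (simp add: Sub_def)

lemma Sub_trans:
  assumes "f \<in> Hom C X Y" "g \<in> Hom C X Y" "h \<in> Hom C X Y"
  shows "Sub f g \<boxplus> Sub g h = Sub f h"
proof (rule Sub_unique[of f X Y h])
  have s: "Sub f g \<in> Hom C X Y" "Sub g h \<in> Hom C X Y" using assms by (simp_all add: Hom_iff)
  have "h \<boxplus> (Sub f g \<boxplus> Sub g h) = h \<boxplus> (Sub g h \<boxplus> Sub f g)" using Add_comm[OF s] by simp
  also have "\<dots> = (h \<boxplus> Sub g h) \<boxplus> Sub f g" using Add_assoc[OF assms(3) s(2,1)] by simp
  also have "h \<boxplus> Sub g h = g" by (rule Add_Sub) (use assms in \<open>simp_all add: Hom_iff\<close>)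
  also have "g \<boxplus> Sub f g = f" by (rule Add_Sub) (use assms in \<open>simp_all add: Hom_iff\<close>)
  finally show "f = h \<boxplus> (Sub f g \<boxplus> Sub g h)" by simp
  show "Sub f g \<boxplus> Sub g h \<in> Hom C X Y" using s by (simp_all add: Hom_iff)
qed (use assms in auto)

lemma Neg_Sub:
  assumes "f \<in> Hom C X Y" "g \<in> Hom C X Y"
  shows "Neg (Sub f g) = Sub g f"
proof (rule Neg_unique[symmetric, of _ X Y])
  show "Sub f g \<boxplus> Sub g f = Zero C X Y"
    using Sub_trans[OF assms assms(1)] assms by (simp add: Hom_iff)
qed (use assms in \<open>simp_all add: Hom_iff\<close>)

lemma Add_interchange:
  assumes "a \<in> Hom C X Y" "b \<in> Hom C X Y" "c \<in> Hom C X Y" "d \<in> Hom C X Y"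
  shows "(a \<boxplus> b) \<boxplus> (c \<boxplus> d) = (a \<boxplus> c) \<boxplus> (b \<boxplus> d)"
proof -
  have s: "b \<boxplus> d \<in> Hom C X Y" "c \<boxplus> d \<in> Hom C X Y" using assms by (simp_all add: Hom_iff)
  have "(a \<boxplus> b) \<boxplus> (c \<boxplus> d) = a \<boxplus> (b \<boxplus> (c \<boxplus> d))" by (rule Add_assoc[OF assms(1,2) s(2)])
  also have "b \<boxplus> (c \<boxplus> d) = (b \<boxplus> c) \<boxplus> d" by (rule Add_assoc[OF assms(2,3,4), symmetric])
  also have "b \<boxplus> c = c \<boxplus> b" by (rule Add_comm[OF assms(2,3)])
  also have "(c \<boxplus> b) \<boxplus> d = c \<boxplus> (b \<boxplus> d)" by (rule Add_assoc[OF assms(3,2,4)])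
  also have "a \<boxplus> (c \<boxplus> (b \<boxplus> d)) = (a \<boxplus> c) \<boxplus> (b \<boxplus> d)"
    by (rule Add_assoc[OF assms(1,3) s(1), symmetric])
  finally show ?thesis .
qed

lemma Sub_Add:
  assumes "f \<in> Hom C X Y" "f' \<in> Hom C X Y" "g \<in> Hom C X Y" "g' \<in> Hom C X Y"
  shows "Sub f g \<boxplus> Sub f' g' = Sub (f \<boxplus> f') (g \<boxplus> g')"
proof (rule Sub_unique[of _ X Y])
  have "(g \<boxplus> g') \<boxplus> (Sub f g \<boxplus> Sub f' g') = (g \<boxplus> Sub f g) \<boxplus> (g' \<boxplus> Sub f' g')"
    by (rule Add_interchange) (use assms in \<open>simp_all add: Hom_iff\<close>)
  also have "g \<boxplus> Sub f g = f" by (rule Add_Sub) (use assms in \<open>simp_all add: Hom_iff\<close>)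
  also have "g' \<boxplus> Sub f' g' = f'" by (rule Add_Sub) (use assms in \<open>simp_all add: Hom_iff\<close>)
  finally show "f \<boxplus> f' = (g \<boxplus> g') \<boxplus> (Sub f g \<boxplus> Sub f' g')" by simp
qed (use assms in \<open>simp_all add: Hom_iff\<close>)

lemma Sub_Zero [simp]: "f \<in> Arr C \<Longrightarrow> Dom C f = X \<Longrightarrow> Cod C f = Y \<Longrightarrow> Sub f (Zero C X Y) = f"
  using Sub_unique[of f X Y "Zero C X Y" f] Dom_Obj[of f] Cod_Obj[of f] by (simp add: Hom_iff)

lemma biproduct_swap:
  assumes "biproduct C X Y P i j p q"
  shows "biproduct C Y X P j i q p"
proof -
  have "(j \<cdot> q) \<boxplus> (i \<cdot> p) = (i \<cdot> p) \<boxplus> (j \<cdot> q)"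
    by (rule Add_comm[of _ P P]) (use assms in \<open>auto simp: biproduct_def Hom_iff\<close>)
  then show ?thesis using assms by (auto simp: biproduct_def)
qed

lemma zero_objectD:
  assumes "zero_object C Z" "f \<in> Hom C X Y" "X = Z \<or> Y = Z"
  shows "f = Zero C X Y"
proof -
  have X: "X \<in> Obj C" and Y: "Y \<in> Obj C" using assms Hom_Obj by auto
  then have "Zero C X Y \<in> Hom C X Y" by (simp add: Hom_iff)
  then show ?thesis using assms X Y unfolding zero_object_def by metis
qed

text \<open>The trivial biproducts give the extriangles \<open>X = X \<rightarrow> 0\<close> and \<open>0 \<rightarrow> X = X\<close>. Comparing an
  arbitrary extriangle with them is what turns (ET3) into exactness statements.\<close>

lemma biproduct_zero:
  assumes "zero_object C Z" "X \<in> Obj C"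
  shows "biproduct C X Z X (Ident C X) (Zero C Z X) (Ident C X) (Zero C X Z)"
    "biproduct C Z X X (Zero C Z X) (Ident C X) (Zero C X Z) (Ident C X)"
proof -
  have Z: "Z \<in> Obj C" using assms by (simp add: zero_object_def)
  have "Zero C Z Z = Ident C Z"
    using zero_objectD[OF assms(1) Ident_in[OF Z]] by simp
  then show "biproduct C X Z X (Ident C X) (Zero C Z X) (Ident C X) (Zero C X Z)"
    using assms(2) Z by (simp add: biproduct_def Hom_iff)
  then show "biproduct C Z X X (Zero C Z X) (Ident C X) (Zero C X Z) (Ident C X)"
    by (rule biproduct_swap)
qed

end

section \<open>Kernels, cokernels and isomorphisms\<close>

context category
begin

lemma isoE:
  assumes "is_isomorphism C f" "f \<in> Hom C X Y"
  obtains g where "g \<in> Hom C Y X" "g \<cdot> f = Ident C X" "f \<cdot> g = Ident C Y"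
  using assms unfolding is_isomorphism_def by (auto simp: Hom_iff)

lemma isoI:
  assumes "f \<in> Hom C X Y" "g \<in> Hom C Y X" "g \<cdot> f = Ident C X" "f \<cdot> g = Ident C Y"
  shows "is_isomorphism C f"
  using assms unfolding is_isomorphism_def by (auto simp: Hom_iff)

lemma Ident_iso: "X \<in> Obj C \<Longrightarrow> is_isomorphism C (Ident C X)"
  by (rule isoI[of _ X X "Ident C X"]) (auto simp: Hom_iff)

lemma is_epiD:
  assumes "is_epi C f" "f \<in> Hom C X Y" "g \<in> Hom C Y Z" "h \<in> Hom C Y Z" "g \<cdot> f = h \<cdot> f"
  shows "g = h"
proof -
  have "Dom C f = X" "Cod C f = Y" "Z \<in> Obj C" using assms by (auto simp: Hom_iff)
  then show ?thesis using assms unfolding is_epi_def by blast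
qed

lemma is_monoD:
  assumes "is_mono C f" "f \<in> Hom C X Y" "g \<in> Hom C Z X" "h \<in> Hom C Z X" "f \<cdot> g = f \<cdot> h"
  shows "g = h"
proof -
  have "Dom C f = X" "Cod C f = Y" "Z \<in> Obj C" using assms by (auto simp: Hom_iff)
  then show ?thesis using assms unfolding is_mono_def by blast
qed

end

context preadditive_category
begin

lemma is_epiI:
  assumes "f \<in> Hom C X Y"
    and "\<And>Z g. \<lbrakk>g \<in> Hom C Y Z; g \<cdot> f = Zero C X Z\<rbrakk> \<Longrightarrow> g = Zero C Y Z"
  shows "is_epi C f"
  unfolding is_epi_def
proof (intro conjI ballI impI)
  fix Z g h
  assume gh: "g \<in> Hom C (Cod C f) Z" "h \<in> Hom C (Cod C f) Z" "g \<cdot> f = h \<cdot> f"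
  have "Sub g h \<cdot> f = Zero C X Z" using assms(1) gh by (simp add: Hom_iff)
  then have "Sub g h = Zero C Y Z" using assms(1) gh by (intro assms(2)) (auto simp: Hom_iff)
  then show "g = h" using gh assms(1) by (intro Sub_eq_Zero[of g Y Z]) (auto simp: Hom_iff)
qed (use assms in \<open>simp add: Hom_iff\<close>)

lemma is_cokernelI:
  assumes "f \<in> Hom C X Y" "c \<in> Hom C Y Z" "c \<cdot> f = Zero C X Z" "is_epi C c"
    and "\<And>Q g. \<lbrakk>g \<in> Hom C Y Q; g \<cdot> f = Zero C X Q\<rbrakk> \<Longrightarrow> \<exists>u \<in> Hom C Z Q. u \<cdot> c = g"
  shows "is_cokernel C f c"
  unfolding is_cokernel_def
proof (intro conjI ballI impI)
  fix Q g
  assume "g \<in> Hom C (Cod C f) Q" "g \<cdot> f = Zero C (Dom C f) Q"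
  then obtain u where u: "u \<in> Hom C Z Q" "u \<cdot> c = g" using assms(1) assms(5)[of g Q] by (auto simp: Hom_iff)
  show "\<exists>!u. u \<in> Hom C (Cod C c) Q \<and> u \<cdot> c = g"
  proof (rule ex1I[of _ u])
    fix u' assume "u' \<in> Hom C (Cod C c) Q \<and> u' \<cdot> c = g"
    then show "u' = u" using u assms(2) is_epiD[OF assms(4,2), of u' Q u] by (auto simp: Hom_iff)
  qed (use u assms(2) in \<open>auto simp: Hom_iff\<close>)
qed (use assms(1-3) in \<open>auto simp: Hom_iff\<close>)

lemma is_kernelI:
  assumes "f \<in> Hom C X Y" "k \<in> Hom C Z X" "f \<cdot> k = Zero C Z Y" "is_mono C k"
    and "\<And>Q g. \<lbrakk>g \<in> Hom C Q X; f \<cdot> g = Zero C Q Y\<rbrakk> \<Longrightarrow> \<exists>u \<in> Hom C Q Z. k \<cdot> u = g"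
  shows "is_kernel C f k"
  unfolding is_kernel_def
proof (intro conjI ballI impI)
  fix Q g
  assume "g \<in> Hom C Q (Dom C f)" "f \<cdot> g = Zero C Q (Cod C f)"
  then obtain u where u: "u \<in> Hom C Q Z" "k \<cdot> u = g" using assms(1) assms(5)[of g Q] by (auto simp: Hom_iff)
  show "\<exists>!u. u \<in> Hom C Q (Dom C k) \<and> k \<cdot> u = g"
  proof (rule ex1I[of _ u])
    fix u' assume "u' \<in> Hom C Q (Dom C k) \<and> k \<cdot> u' = g"
    then show "u' = u" using u assms(2) is_monoD[OF assms(4,2), of u' Q u] by (auto simp: Hom_iff)
  qed (use u assms(2) in \<open>auto simp: Hom_iff\<close>)
qed (use assms(1-3) in \<open>auto simp: Hom_iff\<close>)

lemma is_monoI: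
  assumes "f \<in> Hom C X Y"
    and "\<And>Z g. \<lbrakk>g \<in> Hom C Z X; f \<cdot> g = Zero C Z Y\<rbrakk> \<Longrightarrow> g = Zero C Z X"
  shows "is_mono C f"
  unfolding is_mono_def
proof (intro conjI ballI impI)
  fix Z g h
  assume gh: "g \<in> Hom C Z (Dom C f)" "h \<in> Hom C Z (Dom C f)" "f \<cdot> g = f \<cdot> h"
  have "f \<cdot> Sub g h = Zero C Z Y" using assms(1) gh by (auto simp: Hom_iff)
  then have "Sub g h = Zero C Z X" using assms(1) gh by (intro assms(2)) (auto simp: Hom_iff)
  then show "g = h" using gh assms(1) by (intro Sub_eq_Zero[of g Z X]) (auto simp: Hom_iff)
qed (use assms in \<open>simp add: Hom_iff\<close>)

lemma is_cokernelD:
  assumes "is_cokernel C f c" "f \<in> Hom C X Y" "c \<in> Hom C Y Z"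
  shows "c \<cdot> f = Zero C X Z" "is_epi C c"
    "\<lbrakk>g \<in> Hom C Y Q; g \<cdot> f = Zero C X Q\<rbrakk> \<Longrightarrow> \<exists>u \<in> Hom C Z Q. u \<cdot> c = g"
proof -
  have *: "c \<cdot> f = Zero C X Z"
    "\<And>Q g. \<lbrakk>g \<in> Hom C Y Q; g \<cdot> f = Zero C X Q\<rbrakk> \<Longrightarrow> \<exists>!u. u \<in> Hom C Z Q \<and> u \<cdot> c = g"
    using assms unfolding is_cokernel_def by (auto simp: Hom_iff)
  show "c \<cdot> f = Zero C X Z" by (rule *)
  show "\<lbrakk>g \<in> Hom C Y Q; g \<cdot> f = Zero C X Q\<rbrakk> \<Longrightarrow> \<exists>u \<in> Hom C Z Q. u \<cdot> c = g"
    using *(2) by blast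
  show "is_epi C c"
  proof (rule is_epiI[OF assms(3)])
    fix Q g assume g: "g \<in> Hom C Z Q" "g \<cdot> c = Zero C Y Q"
    have "\<exists>!u. u \<in> Hom C Z Q \<and> u \<cdot> c = Zero C Y Q"
      by (rule *(2)) (use assms g in \<open>auto simp: Hom_iff\<close>)
    moreover have "Zero C Z Q \<in> Hom C Z Q \<and> Zero C Z Q \<cdot> c = Zero C Y Q"
      using assms g by (auto simp: Hom_iff)
    ultimately show "g = Zero C Z Q" using g by blast
  qed
qed

text \<open>Being a cokernel is invariant under isomorphism of arrows: the arrow whose cokernel is
  taken is transported along the isomorphism of domains.\<close>

lemma is_cokernel_transport:
  assumes "is_cokernel C g p" "g \<in> Hom C K X'" "p \<in> Hom C X' Y'" "\<alpha> \<in> Hom C X Y"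
    and "\<beta> \<in> Hom C X X'" "\<gamma> \<in> Hom C Y Y'" "is_isomorphism C \<beta>" "is_isomorphism C \<gamma>"
    and sq: "p \<cdot> \<beta> = \<gamma> \<cdot> \<alpha>"
  shows "\<exists>g' \<in> Hom C K X. is_cokernel C g' \<alpha>"
proof -
  obtain b where b: "b \<in> Hom C X' X" "b \<cdot> \<beta> = Ident C X" "\<beta> \<cdot> b = Ident C X'"
    using isoE assms by metis
  obtain c where c: "c \<in> Hom C Y' Y" "c \<cdot> \<gamma> = Ident C Y" "\<gamma> \<cdot> c = Ident C Y'"
    using isoE assms by metis
  note h = is_cokernelD[OF assms(1-3)]
  have \<alpha>: "\<alpha> = c \<cdot> (p \<cdot> \<beta>)"
    unfolding sq using assms(4,6) c comp_assoc[of \<alpha> \<gamma> c] by (simp add: Hom_iff)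
  have "is_cokernel C (b \<cdot> g) \<alpha>"
  proof (rule is_cokernelI[of _ K X _ Y])
    have "\<alpha> \<cdot> (b \<cdot> g) = c \<cdot> (p \<cdot> (\<beta> \<cdot> (b \<cdot> g)))"
      unfolding \<alpha> using assms(2-8) b c by (simp add: Hom_iff)
    also have "\<beta> \<cdot> (b \<cdot> g) = g"
      using comp_reassoc[OF b(3), of g] assms b by (simp add: Hom_iff)
    finally show "\<alpha> \<cdot> (b \<cdot> g) = Zero C K Y" using h(1) assms c by (auto simp: Hom_iff)
    show "is_epi C \<alpha>"
    proof (rule is_epiI[OF assms(4)])
      fix Q u assume u: "u \<in> Hom C Y Q" "u \<cdot> \<alpha> = Zero C X Q"
      have "(u \<cdot> c) \<cdot> p = (u \<cdot> (c \<cdot> (p \<cdot> \<beta>))) \<cdot> b"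
        using assms(2-8) b c u(1) by (simp add: Hom_iff)
      also have "(u \<cdot> (c \<cdot> (p \<cdot> \<beta>))) \<cdot> b = Zero C X' Q"
        using u(2) assms b c u(1) unfolding \<alpha>[symmetric] by (auto simp: Hom_iff)
      finally have "(u \<cdot> c) \<cdot> p = Zero C Y' Q \<cdot> p" using u assms by (auto simp: Hom_iff)
      then have "u \<cdot> c = Zero C Y' Q"
        by (rule is_epiD[OF h(2) assms(3), rotated 2]) (use u c in \<open>auto simp: Hom_iff\<close>)
      then have "u \<cdot> (c \<cdot> \<gamma>) = Zero C Y' Q \<cdot> \<gamma>"
        using comp_reassoc[of u c _ \<gamma>] u c assms by (simp add: Hom_iff)
      then show "u = Zero C Y Q"
        using u(1) c(1,2) assms(6) Hom_Obj[OF u(1)] by (simp add: Hom_iff)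
    qed
  next
    fix Q u assume u: "u \<in> Hom C X Q" "u \<cdot> (b \<cdot> g) = Zero C K Q"
    have "(u \<cdot> b) \<cdot> g = Zero C K Q" using u b assms by (simp add: Hom_iff)
    then obtain v where v: "v \<in> Hom C Y' Q" "v \<cdot> p = u \<cdot> b"
      using h(3)[of "u \<cdot> b" Q] u b by (auto simp: Hom_iff)
    have "(v \<cdot> \<gamma>) \<cdot> \<alpha> = (v \<cdot> p) \<cdot> \<beta>" using v(1) assms by (simp add: Hom_iff)
    also have "\<dots> = u" unfolding v(2) using u b assms by (simp add: Hom_iff)
    finally show "\<exists>v \<in> Hom C Y Q. v \<cdot> \<alpha> = u"
      using v assms by (intro bexI[of _ "v \<cdot> \<gamma>"]) (auto simp: Hom_iff)
  qed (use assms b in \<open>auto simp: Hom_iff\<close>)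
  then show ?thesis using assms b by (intro bexI[of _ "b \<cdot> g"]) (auto simp: Hom_iff)
qed

lemma is_kernelD:
  assumes "is_kernel C f k" "f \<in> Hom C X Y" "k \<in> Hom C Z X"
  shows "f \<cdot> k = Zero C Z Y" "is_mono C k"
    "\<lbrakk>g \<in> Hom C Q X; f \<cdot> g = Zero C Q Y\<rbrakk> \<Longrightarrow> \<exists>u \<in> Hom C Q Z. k \<cdot> u = g"
proof -
  have d: "Dom C f = X" "Cod C f = Y" "Dom C k = Z" using assms(2,3) by (simp_all add: Hom_iff)
  have *: "f \<cdot> k = Zero C Z Y"
    "\<And>Q g. \<lbrakk>g \<in> Hom C Q X; f \<cdot> g = Zero C Q Y\<rbrakk> \<Longrightarrow> \<exists>!u. u \<in> Hom C Q Z \<and> k \<cdot> u = g"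
    using assms(1) Hom_Obj unfolding is_kernel_def d by blast+
  show "f \<cdot> k = Zero C Z Y" by (rule *)
  show "\<lbrakk>g \<in> Hom C Q X; f \<cdot> g = Zero C Q Y\<rbrakk> \<Longrightarrow> \<exists>u \<in> Hom C Q Z. k \<cdot> u = g"
    using *(2) by blast
  show "is_mono C k"
  proof (rule is_monoI[OF assms(3)])
    fix Q g assume g: "g \<in> Hom C Q Z" "k \<cdot> g = Zero C Q X"
    have o: "Q \<in> Obj C" "X \<in> Obj C" "Y \<in> Obj C" "Z \<in> Obj C"
      using g(1) assms(2,3) Hom_Obj by blast+
    have z: "Zero C Q X \<in> Hom C Q X" "f \<cdot> Zero C Q X = Zero C Q Y" "Zero C Q Z \<in> Hom C Q Z"
      "k \<cdot> Zero C Q Z = Zero C Q X"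
      using assms(2,3) o by (simp_all add: Hom_iff)
    show "g = Zero C Q Z" using *(2)[OF z(1,2)] g z(3,4) by blast
  qed
qed

text \<open>The corresponding statement for kernels, where the inverse of \<open>\<beta>\<close> moves the kernel itself.\<close>

lemma is_kernel_transport:
  assumes ker: "is_kernel C p k" and k: "k \<in> Hom C K X'" and p: "p \<in> Hom C X' Y'"
    and \<alpha>: "\<alpha> \<in> Hom C X Y" and \<beta>: "\<beta> \<in> Hom C X X'" and \<gamma>: "\<gamma> \<in> Hom C Y Y'"
    and iso: "is_isomorphism C \<beta>" "is_isomorphism C \<gamma>" and sq: "p \<cdot> \<beta> = \<gamma> \<cdot> \<alpha>"
  shows "\<exists>k' \<in> Hom C K X. is_kernel C \<alpha> k'"
proof -
  obtain b where b: "b \<in> Hom C X' X" "b \<cdot> \<beta> = Ident C X" "\<beta> \<cdot> b = Ident C X'"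
    by (rule isoE[OF iso(1) \<beta>])
  obtain c where c: "c \<in> Hom C Y' Y" "c \<cdot> \<gamma> = Ident C Y" "\<gamma> \<cdot> c = Ident C Y'"
    by (rule isoE[OF iso(2) \<gamma>])
  note h = is_kernelD[OF ker p k]
  have o: "X \<in> Obj C" "Y \<in> Obj C" "X' \<in> Obj C" "Y' \<in> Obj C" "K \<in> Obj C"
    using \<beta> \<gamma> k Hom_Obj by blast+
  have bk: "b \<cdot> k \<in> Hom C K X" by (rule Compose_in[OF k b(1)])
  have \<beta>bk: "\<beta> \<cdot> (b \<cdot> k) = k" using comp_reassoc[OF b(3), of k] k b(1) \<beta> by (simp add: Hom_iff)
  have b\<beta>: "b \<cdot> (\<beta> \<cdot> g) = g" if "g \<in> Hom C Q X" for g Q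
    using comp_reassoc[OF b(2), of g] that b(1) \<beta> by (simp add: Hom_iff)
  have c\<gamma>: "c \<cdot> (\<gamma> \<cdot> g) = g" if "g \<in> Hom C Q Y" for g Q
    using comp_reassoc[OF c(2), of g] that c(1) \<gamma> by (simp add: Hom_iff)
  have sq': "\<gamma> \<cdot> (\<alpha> \<cdot> g) = p \<cdot> (\<beta> \<cdot> g)" if "g \<in> Hom C Q X" for g Q
    using Compose_assoc[OF that \<alpha> \<gamma>] Compose_assoc[OF that \<beta> p] sq by simp
  have "is_kernel C \<alpha> (b \<cdot> k)"
  proof (rule is_kernelI[OF \<alpha> bk])
    have "\<gamma> \<cdot> (\<alpha> \<cdot> (b \<cdot> k)) = Zero C K Y'" using sq'[OF bk] \<beta>bk h(1) by simp
    then have "c \<cdot> (\<gamma> \<cdot> (\<alpha> \<cdot> (b \<cdot> k))) = Zero C K Y" using c(1) o by (simp add: Hom_iff)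
    then show "\<alpha> \<cdot> (b \<cdot> k) = Zero C K Y" using c\<gamma>[OF Compose_in[OF bk \<alpha>]] by simp
    show "is_mono C (b \<cdot> k)"
    proof (rule is_monoI[OF bk])
      fix Q g assume g: "g \<in> Hom C Q K" "(b \<cdot> k) \<cdot> g = Zero C Q X"
      have Q: "Q \<in> Obj C" using g(1) Hom_Obj by blast
      have "k \<cdot> g = (\<beta> \<cdot> (b \<cdot> k)) \<cdot> g" using \<beta>bk by simp
      also have "\<dots> = \<beta> \<cdot> ((b \<cdot> k) \<cdot> g)" by (rule Compose_assoc[OF g(1) bk \<beta>])
      also have "\<dots> = k \<cdot> Zero C Q K" unfolding g(2) using \<beta> k o Q by (simp add: Hom_iff)
      finally show "g = Zero C Q K"
        by (rule is_monoD[OF h(2) k g(1), rotated]) (use o Q in \<open>simp add: Hom_iff\<close>)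
    qed
    fix Q g assume g: "g \<in> Hom C Q X" "\<alpha> \<cdot> g = Zero C Q Y"
    have Q: "Q \<in> Obj C" using g(1) Hom_Obj by blast
    have "p \<cdot> (\<beta> \<cdot> g) = Zero C Q Y'"
      using sq'[OF g(1), symmetric] g(2) \<gamma> o Q by (simp add: Hom_iff)
    then obtain u where u: "u \<in> Hom C Q K" "k \<cdot> u = \<beta> \<cdot> g"
      using h(3)[OF Compose_in[OF g(1) \<beta>]] by blast
    have "(b \<cdot> k) \<cdot> u = g" using Compose_assoc[OF u(1) k b(1)] u(2) b\<beta>[OF g(1)] by simp
    then show "\<exists>u \<in> Hom C Q K. (b \<cdot> k) \<cdot> u = g" using u(1) by blast
  qed
  then show ?thesis using bk by blast
qed

lemma is_cokernel_unique:
  assumes c: "is_cokernel C f c" "c \<in> Hom C Y Z" and c': "is_cokernel C f c'" "c' \<in> Hom C Y Z'"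
    and f: "f \<in> Hom C X Y"
  shows "\<exists>u \<in> Hom C Z Z'. is_isomorphism C u \<and> u \<cdot> c = c'"
proof -
  note h = is_cokernelD[OF c(1) f c(2)] and h' = is_cokernelD[OF c'(1) f c'(2)]
  obtain u where u: "u \<in> Hom C Z Z'" "u \<cdot> c = c'" using h(3)[OF c'(2) h'(1)] by blast
  obtain v where v: "v \<in> Hom C Z' Z" "v \<cdot> c' = c" using h'(3)[OF c(2) h(1)] by blast
  have o: "Z \<in> Obj C" "Z' \<in> Obj C" using u(1) Hom_Obj by blast+
  have "(v \<cdot> u) \<cdot> c = Ident C Z \<cdot> c"
    using Compose_assoc[OF c(2) u(1) v(1)] u(2) v(2) Ident_left[OF c(2)] by simp
  then have vu: "v \<cdot> u = Ident C Z"
    by (rule is_epiD[OF h(2) c(2) Compose_in[OF u(1) v(1)] Ident_in[OF o(1)]])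
  have "(u \<cdot> v) \<cdot> c' = Ident C Z' \<cdot> c'"
    using Compose_assoc[OF c'(2) v(1) u(1)] u(2) v(2) Ident_left[OF c'(2)] by simp
  then have uv: "u \<cdot> v = Ident C Z'"
    by (rule is_epiD[OF h'(2) c'(2) Compose_in[OF v(1) u(1)] Ident_in[OF o(2)]])
  show ?thesis using isoI[OF u(1) v(1) vu uv] u by blast
qed

text \<open>Composing with a mono does not change which arrows are annihilated.\<close>

lemma is_kernel_comp_mono:
  assumes ker: "is_kernel C r j" and j: "j \<in> Hom C J X" and r: "r \<in> Hom C X K"
    and k: "k \<in> Hom C K Y" "is_mono C k"
  shows "is_kernel C (k \<cdot> r) j"
proof (rule is_kernelI[OF Compose_in[OF r k(1)] j])
  note h = is_kernelD[OF ker r j]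
  have o: "J \<in> Obj C" "K \<in> Obj C" "Y \<in> Obj C" using j k(1) Hom_Obj by blast+
  show "(k \<cdot> r) \<cdot> j = Zero C J Y"
    unfolding Compose_assoc[OF j r k(1)] h(1) using k(1) o by (simp add: Hom_iff)
  show "is_mono C j" by (rule h(2))
  fix Q g assume g: "g \<in> Hom C Q X" "(k \<cdot> r) \<cdot> g = Zero C Q Y"
  have Q: "Q \<in> Obj C" using g(1) Hom_Obj by blast
  have "k \<cdot> (r \<cdot> g) = k \<cdot> Zero C Q K"
    using g(2) Compose_assoc[OF g(1) r k(1)] k(1) o Q by (simp add: Hom_iff)
  then have "r \<cdot> g = Zero C Q K"
    by (rule is_monoD[OF k(2,1) Compose_in[OF g(1) r], rotated]) (use o Q in \<open>simp add: Hom_iff\<close>)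
  then show "\<exists>u \<in> Hom C Q J. j \<cdot> u = g" using h(3)[OF g(1)] by blast
qed

text \<open>If \<open>k \<cdot> r\<close> is mono, then \<open>r\<close> can only be a cokernel of a zero arrow, and such a cokernel is
  invertible. So \<open>k \<cdot> r\<close> is the kernel \<open>k\<close> up to isomorphism.\<close>

lemma is_kernel_of_mono_factorization:
  assumes mono: "is_mono C (k \<cdot> r)" and r: "r \<in> Hom C X K" and k: "k \<in> Hom C K Y"
    and ker: "is_kernel C c k" and c: "c \<in> Hom C Y Z"
    and coker: "is_cokernel C g r" and g: "g \<in> Hom C A X"
  shows "is_kernel C c (k \<cdot> r)"
proof -
  note h = is_kernelD[OF ker c k] and h' = is_cokernelD[OF coker g r]
  have o: "A \<in> Obj C" "X \<in> Obj C" "K \<in> Obj C" "Y \<in> Obj C" "Z \<in> Obj C"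
    using g r k c Hom_Obj by blast+
  have kr: "k \<cdot> r \<in> Hom C X Y" by (rule Compose_in[OF r k])
  have "(k \<cdot> r) \<cdot> g = (k \<cdot> r) \<cdot> Zero C A X"
    unfolding Compose_assoc[OF g r k] h'(1) using k r o by (simp add: Hom_iff)
  then have "g = Zero C A X"
    by (rule is_monoD[OF mono kr g, rotated]) (use o in \<open>simp add: Hom_iff\<close>)
  then have "Ident C X \<cdot> g = Zero C A X" using o by simp
  then obtain s where s: "s \<in> Hom C K X" "s \<cdot> r = Ident C X"
    using h'(3)[OF Ident_in[OF o(2)]] by blast
  have "(r \<cdot> s) \<cdot> r = Ident C K \<cdot> r"
    using Compose_assoc[OF r s(1) r] s(2) Ident_left[OF r] Ident_right[OF r] by simp
  then have rs: "r \<cdot> s = Ident C K"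
    by (rule is_epiD[OF h'(2) r Compose_in[OF s(1) r] Ident_in[OF o(3)]])
  show ?thesis
  proof (rule is_kernelI[OF c kr _ mono])
    show "c \<cdot> (k \<cdot> r) = Zero C X Z"
      using Compose_assoc[OF r k c] h(1) r o by (simp add: Hom_iff)
    fix Q u assume u: "u \<in> Hom C Q Y" "c \<cdot> u = Zero C Q Z"
    then obtain t where t: "t \<in> Hom C Q K" "k \<cdot> t = u" using h(3) by blast
    have st: "s \<cdot> t \<in> Hom C Q X" by (rule Compose_in[OF t(1) s(1)])
    have "(k \<cdot> r) \<cdot> (s \<cdot> t) = k \<cdot> (r \<cdot> (s \<cdot> t))" by (rule Compose_assoc[OF st r k])
    also have "r \<cdot> (s \<cdot> t) = t"
      using Compose_assoc[OF t(1) s(1) r] rs Ident_left[OF t(1)] by simp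
    finally show "\<exists>t \<in> Hom C Q X. (k \<cdot> r) \<cdot> t = u" using st t(2) by auto
  qed
qed

end

section \<open>Ideal quotients\<close>

text \<open>Existence of biproducts in \<open>W\<close> makes the sum of two arrows that factor through \<open>W\<close> factor through
  \<open>W\<close> again, so that these arrows form an ideal and the operations of the quotient can be computed on
  representatives.\<close>

locale additive_ideal_quotient = preadditive_category C
  for C :: "('o, 'm, 'z) precat_scheme" (structure) +
  fixes D W :: "'o set"
  assumes D_Obj: "D \<subseteq> Obj C"
    and W_Obj: "W \<subseteq> Obj C"
    and W_nonempty: "W \<noteq> {}"
    and W_biproduct: "\<lbrakk>X \<in> W; Y \<in> W\<rbrakk> \<Longrightarrow> \<exists>P \<in> W. \<exists>i j p q. biproduct C X Y P i j p q"
begin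

abbreviation fac :: "'m \<Rightarrow> bool"
  where "fac \<equiv> factors_through C W"

lemma facI:
  assumes "X \<in> W" "g \<in> Hom C A X" "h \<in> Hom C X B"
  shows "fac (h \<cdot> g)"
proof -
  have "Dom C (h \<cdot> g) = A" "Cod C (h \<cdot> g) = B" using assms by (simp_all add: Hom_iff)
  then show ?thesis using assms unfolding factors_through_def by blast
qed

lemma facE:
  assumes "fac f" "f \<in> Hom C A B"
  obtains X g h where "X \<in> W" "g \<in> Hom C A X" "h \<in> Hom C X B" "f = h \<cdot> g"
proof -
  have "Dom C f = A" "Cod C f = B" using assms(2) by (simp_all add: Hom_iff)
  then show thesis using that assms(1) unfolding factors_through_def by blast
qed

lemma fac_comp_left:
  assumes "fac f" "f \<in> Hom C A B" "k \<in> Hom C B D'"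
  shows "fac (k \<cdot> f)"
proof -
  obtain X g h where f: "X \<in> W" "g \<in> Hom C A X" "h \<in> Hom C X B" "f = h \<cdot> g"
    by (rule facE[OF assms(1,2)])
  have "fac ((k \<cdot> h) \<cdot> g)" by (rule facI[OF f(1,2) Compose_in[OF f(3) assms(3)]])
  moreover have "(k \<cdot> h) \<cdot> g = k \<cdot> f" using Compose_assoc[OF f(2,3) assms(3)] f(4) by simp
  ultimately show ?thesis by simp
qed

lemma fac_comp_right:
  assumes "fac f" "f \<in> Hom C A B" "k \<in> Hom C D' A"
  shows "fac (f \<cdot> k)"
proof -
  obtain X g h where f: "X \<in> W" "g \<in> Hom C A X" "h \<in> Hom C X B" "f = h \<cdot> g"
    by (rule facE[OF assms(1,2)])
  have "fac (h \<cdot> (g \<cdot> k))" by (rule facI[OF f(1) Compose_in[OF assms(3) f(2)] f(3)])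
  moreover have "h \<cdot> (g \<cdot> k) = f \<cdot> k" using Compose_assoc[OF assms(3) f(2,3)] f(4) by simp
  ultimately show ?thesis by simp
qed

lemma fac_Zero: "X \<in> Obj C \<Longrightarrow> Y \<in> Obj C \<Longrightarrow> fac (Zero C X Y)"
proof -
  assume o: "X \<in> Obj C" "Y \<in> Obj C"
  obtain Z where Z: "Z \<in> W" "Z \<in> Obj C" using W_nonempty W_Obj by blast
  have "fac (Zero C Z Y \<cdot> Zero C X Z)" using o Z by (intro facI[of Z _ X _ Y]) (simp_all add: Hom_iff)
  then show ?thesis using o Z by simp
qed

lemma fac_Add:
  assumes "fac f" "fac f'" "f \<in> Hom C A B" "f' \<in> Hom C A B"
  shows "fac (f \<boxplus> f')"
proof -
  obtain X g h where f: "X \<in> W" "g \<in> Hom C A X" "h \<in> Hom C X B" "f = h \<cdot> g"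
    by (rule facE[OF assms(1,3)])
  obtain X' g' h' where f': "X' \<in> W" "g' \<in> Hom C A X'" "h' \<in> Hom C X' B" "f' = h' \<cdot> g'"
    by (rule facE[OF assms(2,4)])
  obtain P i j p q where P: "P \<in> W" "biproduct C X X' P i j p q" using W_biproduct f f' by blast
  note P' = P(2)[unfolded biproduct_def]
  \<comment> \<open>The sum is written as an arrow through the biproduct of the two intermediate objects.\<close>
  have "fac ((h \<cdot> p \<boxplus> h' \<cdot> q) \<cdot> (i \<cdot> g \<boxplus> j \<cdot> g'))"
    by (rule facI[OF P(1), of _ A _ B]) (use f(2,3) f'(2,3) P' in \<open>simp_all add: Hom_iff\<close>)
  moreover have "(h \<cdot> p \<boxplus> h' \<cdot> q) \<cdot> (i \<cdot> g) = h \<cdot> g"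
    using f(2,3) f'(2,3) P' comp_reassoc[of p i _ g] comp_reassoc[of q i _ g]
      Hom_Obj[OF f(2)] Hom_Obj[OF f(3)] by (simp add: Hom_iff)
  moreover have "(h \<cdot> p \<boxplus> h' \<cdot> q) \<cdot> (j \<cdot> g') = h' \<cdot> g'"
    using f(2,3) f'(2,3) P' comp_reassoc[of p j _ g'] comp_reassoc[of q j _ g']
      Hom_Obj[OF f(2)] Hom_Obj[OF f(3)] by (simp add: Hom_iff)
  moreover have "(h \<cdot> p \<boxplus> h' \<cdot> q) \<cdot> (i \<cdot> g \<boxplus> j \<cdot> g')
      = (h \<cdot> p \<boxplus> h' \<cdot> q) \<cdot> (i \<cdot> g) \<boxplus> (h \<cdot> p \<boxplus> h' \<cdot> q) \<cdot> (j \<cdot> g')"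
    by (rule comp_Add) (use f(2,3) f'(2,3) P' in \<open>simp_all add: Hom_iff\<close>)
  ultimately show ?thesis using f(4) f'(4) by simp
qed

lemma fac_Neg:
  assumes "fac f" "f \<in> Hom C A B"
  shows "fac (Neg f)"
  using fac_comp_left[OF assms, of "Neg (Ident C B)" B] assms Hom_Obj[OF assms(2)]
  by (simp add: Hom_iff)

lemma fac_Sub:
  assumes "fac f" "fac f'" "f \<in> Hom C A B" "f' \<in> Hom C A B"
  shows "fac (Sub f f')"
  unfolding Sub_def using assms fac_Neg
  by (intro fac_Add[of _ _ A B]) (simp_all add: Hom_iff)

lemma fac_Sub_sym:
  "fac (Sub f g) \<Longrightarrow> f \<in> Hom C A B \<Longrightarrow> g \<in> Hom C A B \<Longrightarrow> fac (Sub g f)"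
  using fac_Neg[of "Sub f g" A B] by (simp add: Neg_Sub) (simp add: Hom_iff)

lemma fac_Sub_trans:
  "\<lbrakk>fac (Sub f g); fac (Sub g h); f \<in> Hom C A B; g \<in> Hom C A B; h \<in> Hom C A B\<rbrakk>
    \<Longrightarrow> fac (Sub f h)"
  using fac_Add[of "Sub f g" "Sub g h" A B] Sub_trans[of f A B g h] by (simp add: Hom_iff)

lemma fac_iff_of_Sub:
  assumes "fac (Sub f g)" "f \<in> Hom C A B" "g \<in> Hom C A B"
  shows "fac f \<longleftrightarrow> fac g"
proof
  assume "fac f"
  then have "fac (Sub f (Sub f g))" by (rule fac_Sub[of _ _ A B]) (use assms in \<open>simp_all add: Hom_iff\<close>)
  moreover have "g = Sub f (Sub f g)"
    using assms Add_Sub[of f g] Add_comm[of g A B "Sub f g"]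
    by (intro Sub_unique[of _ A B]) (simp_all add: Hom_iff)
  ultimately show "fac g" by simp
next
  assume "fac g"
  then have "fac (g \<boxplus> Sub f g)" by (rule fac_Add[of _ _ A B]) (use assms in \<open>simp_all add: Hom_iff\<close>)
  then show "fac f" using assms Add_Sub[of f g] by (simp add: Hom_iff)
qed

abbreviation cls :: "'m \<Rightarrow> 'm set"
  where "cls \<equiv> ideal_class C D W"

abbreviation Q :: "('o, 'm set) precat"
  where "Q \<equiv> ideal_quotient C D W"

lemma ideal_rel_iff:
  assumes "f \<in> Hom C X Y" "X \<in> D" "Y \<in> D"
  shows "(f, f') \<in> ideal_rel C D W \<longleftrightarrow> f' \<in> Hom C X Y \<and> fac (Sub f f')"
proof
  assume "(f, f') \<in> ideal_rel C D W"
  then obtain X' Y' h where h': "f \<in> Hom C X' Y'" "f' \<in> Hom C X' Y'" "h \<in> Hom C X' Y'"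
    "fac h" "f = f' \<boxplus> h"
    unfolding ideal_rel_def by blast
  have "X' = X" "Y' = Y" using h'(1) assms(1) unfolding Hom_def by blast+
  then have h: "f' \<in> Hom C X Y" "h \<in> Hom C X Y" "fac h" "f = f' \<boxplus> h" using h' by auto
  have "h = Sub f f'" by (rule Sub_unique[OF assms(1) h(1,2,4)])
  then show "f' \<in> Hom C X Y \<and> fac (Sub f f')" using h(1,3) by simp
next
  assume f': "f' \<in> Hom C X Y \<and> fac (Sub f f')"
  then have "f' \<boxplus> Sub f f' = f" "Sub f f' \<in> Hom C X Y"
    using assms Add_Sub[of f f'] by (simp_all add: Hom_iff)
  then show "(f, f') \<in> ideal_rel C D W" using assms f' unfolding ideal_rel_def by force
qed

lemma mem_cls:
  "f \<in> Hom C X Y \<Longrightarrow> X \<in> D \<Longrightarrow> Y \<in> D \<Longrightarrow> f' \<in> cls f \<longleftrightarrow> f' \<in> Hom C X Y \<and> fac (Sub f f')"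
  by (simp add: ideal_class_def ideal_rel_iff)

lemma self_in_cls: "f \<in> Hom C X Y \<Longrightarrow> X \<in> D \<Longrightarrow> Y \<in> D \<Longrightarrow> f \<in> cls f"
  using Hom_Obj[of f X Y] fac_Zero[of X Y] by (simp add: mem_cls) (simp add: Hom_iff)

lemma cls_eq_iff:
  assumes "f \<in> Hom C X Y" "g \<in> Hom C X Y" "X \<in> D" "Y \<in> D"
  shows "cls f = cls g \<longleftrightarrow> fac (Sub f g)"
proof
  assume "cls f = cls g"
  then have "g \<in> cls f" using self_in_cls assms by simp
  then show "fac (Sub f g)" using mem_cls assms by simp
next
  assume fg: "fac (Sub f g)"
  then have gf: "fac (Sub g f)" using fac_Sub_sym assms by blast
  show "cls f = cls g"
  proof (rule Set.set_eqI)
    fix h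
    show "h \<in> cls f \<longleftrightarrow> h \<in> cls g"
      using assms fg gf fac_Sub_trans[of f g h X Y] fac_Sub_trans[of g f h X Y]
      by (auto simp: mem_cls)
  qed
qed

lemma Hom_Q:
  "F \<in> Hom Q X Y \<longleftrightarrow> X \<in> D \<and> Y \<in> D \<and> (\<exists>f \<in> Hom C X Y. F = cls f)"
proof -
  have dc: "the_elem (Dom C ` cls f) = Dom C f" "the_elem (Cod C ` cls f) = Cod C f"
    if f: "f \<in> Hom C X' Y'" "X' \<in> D" "Y' \<in> D" for f X' Y'
  proof -
    have "Dom C ` cls f = {X'}" "Cod C ` cls f = {Y'}"
      using self_in_cls[OF f] mem_cls[OF f] f(1) unfolding Hom_def by blast+
    then show "the_elem (Dom C ` cls f) = Dom C f" "the_elem (Cod C ` cls f) = Cod C f"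
      using f(1) by (simp_all add: Hom_iff)
  qed
  have arr: "F \<in> Arr Q \<longleftrightarrow> (\<exists>f \<in> Arr C. Dom C f \<in> D \<and> Cod C f \<in> D \<and> F = cls f)"
    by (auto simp: ideal_quotient_def quotient_def ideal_class_def)
  show ?thesis
  proof
    assume "F \<in> Hom Q X Y"
    then obtain f where f: "f \<in> Arr C" "Dom C f \<in> D" "Cod C f \<in> D" "F = cls f"
      "Dom Q F = X" "Cod Q F = Y"
      using arr by (auto simp: Hom_def)
    have "f \<in> Hom C (Dom C f) (Cod C f)" using f(1) by (simp add: Hom_iff)
    then have "Dom C f = X" "Cod C f = Y"
      using dc[of f "Dom C f" "Cod C f"] f(2-6) by (simp_all add: ideal_quotient_def)
    then show "X \<in> D \<and> Y \<in> D \<and> (\<exists>f \<in> Hom C X Y. F = cls f)"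
      using f(1-4) unfolding Hom_def by blast
  next
    assume "X \<in> D \<and> Y \<in> D \<and> (\<exists>f \<in> Hom C X Y. F = cls f)"
    then obtain f where f: "X \<in> D" "Y \<in> D" "f \<in> Hom C X Y" "F = cls f" by blast
    then have "F \<in> Arr Q" using arr unfolding Hom_def by blast
    moreover have "Dom Q F = X" "Cod Q F = Y"
      using dc[OF f(3,1,2)] f(3,4) by (simp_all add: ideal_quotient_def Hom_iff)
    ultimately show "F \<in> Hom Q X Y" by (simp add: Hom_def)
  qed
qed

lemma cls_Hom: "f \<in> Hom C X Y \<Longrightarrow> X \<in> D \<Longrightarrow> Y \<in> D \<Longrightarrow> cls f \<in> Hom Q X Y"
  using Hom_Q by blast

lemma Arr_Q: "F \<in> Arr Q \<longleftrightarrow> (\<exists>X Y. F \<in> Hom Q X Y)"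
  by (simp add: Hom_def)

lemma Obj_Q [simp]: "Obj Q = D"
  by (simp add: ideal_quotient_def)

lemma Ident_Q: "Ident Q X = cls (Ident C X)"
  by (simp add: ideal_quotient_def)

lemma Zero_Q: "Zero Q X Y = cls (Zero C X Y)"
  by (simp add: ideal_quotient_def)

lemma comp_Q:
  assumes "f \<in> Hom C X Y" "g \<in> Hom C Y Z" "X \<in> D" "Y \<in> D" "Z \<in> D"
  shows "cls g \<cdot>\<^bsub>Q\<^esub> cls f = cls (g \<cdot> f)"
proof -
  have *: "cls (g' \<cdot> f') = cls (g \<cdot> f)" if "g' \<in> cls g" "f' \<in> cls f" for g' f'
  proof -
    have f': "f' \<in> Hom C X Y" "fac (Sub f f')" and g': "g' \<in> Hom C Y Z" "fac (Sub g g')"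
      using that assms mem_cls by auto
    have "fac (g \<cdot> Sub f f')" "fac (Sub g g' \<cdot> f')"
      using f' g' assms fac_comp_left[of "Sub f f'" X Y g Z] fac_comp_right[of "Sub g g'" Y Z f' X]
      by (simp_all add: Hom_iff)
    then have "fac (Sub (g \<cdot> f) (g \<cdot> f'))" "fac (Sub (g \<cdot> f') (g' \<cdot> f'))"
      using f' g' assms by (simp_all add: Hom_iff)
    then have "fac (Sub (g \<cdot> f) (g' \<cdot> f'))"
      by (rule fac_Sub_trans[of _ "g \<cdot> f'" _ X Z])
        (use f'(1) g'(1) assms in \<open>simp_all add: Hom_iff\<close>)
    then show ?thesis
      using cls_eq_iff[of "g \<cdot> f" X Z "g' \<cdot> f'"] f'(1) g'(1) assms by (simp_all add: Hom_iff)
  qed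
  have "cls g \<cdot>\<^bsub>Q\<^esub> cls f = (\<Union>g' \<in> cls g. \<Union>f' \<in> cls f. cls (g' \<cdot> f'))"
    by (simp add: ideal_quotient_def)
  also have "\<dots> = cls (g \<cdot> f)"
    using * self_in_cls[of f X Y] self_in_cls[of g Y Z] assms by blast
  finally show ?thesis .
qed

lemma Add_Q:
  assumes "f \<in> Hom C X Y" "g \<in> Hom C X Y" "X \<in> D" "Y \<in> D"
  shows "cls f \<boxplus>\<^bsub>Q\<^esub> cls g = cls (f \<boxplus> g)"
proof -
  have *: "cls (f' \<boxplus> g') = cls (f \<boxplus> g)" if "f' \<in> cls f" "g' \<in> cls g" for g' f'
  proof -
    have f': "f' \<in> Hom C X Y" "fac (Sub f f')" and g': "g' \<in> Hom C X Y" "fac (Sub g g')"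
      using that assms mem_cls by auto
    have "fac (Sub f f' \<boxplus> Sub g g')"
      by (rule fac_Add[of _ _ X Y]) (use f' g' assms in \<open>simp_all add: Hom_iff\<close>)
    then have "fac (Sub (f \<boxplus> g) (f' \<boxplus> g'))" using Sub_Add f'(1) g'(1) assms by simp
    then show ?thesis
      using cls_eq_iff[of "f \<boxplus> g" X Y "f' \<boxplus> g'"] f'(1) g'(1) assms by (simp_all add: Hom_iff)
  qed
  have "cls f \<boxplus>\<^bsub>Q\<^esub> cls g = (\<Union>f' \<in> cls f. \<Union>g' \<in> cls g. cls (f' \<boxplus> g'))"
    by (simp add: ideal_quotient_def)
  also have "\<dots> = cls (f \<boxplus> g)"
    using * self_in_cls[of f X Y] self_in_cls[of g X Y] assms by blast
  finally show ?thesis .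
qed

lemma D_ObjD: "X \<in> D \<Longrightarrow> X \<in> Obj C"
  using D_Obj by blast

lemma category_Q: "category Q"
proof
  fix F assume "F \<in> Arr Q"
  then obtain X Y where "F \<in> Hom Q X Y" using Arr_Q by blast
  then have "X \<in> D" "Y \<in> D" "Dom Q F = X" "Cod Q F = Y" using Hom_Q unfolding Hom_def by blast+
  then show "Dom Q F \<in> Obj Q" "Cod Q F \<in> Obj Q" by simp_all
next
  fix X assume "X \<in> Obj Q"
  then show "Ident Q X \<in> Hom Q X X"
    using D_ObjD unfolding Ident_Q by (intro cls_Hom Ident_in) auto
next
  fix F G X Y Z assume "F \<in> Hom Q X Y" "G \<in> Hom Q Y Z"
  then obtain f g where "f \<in> Hom C X Y" "F = cls f" "g \<in> Hom C Y Z" "G = cls g"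
    "X \<in> D" "Y \<in> D" "Z \<in> D" using Hom_Q by auto
  then show "G \<cdot>\<^bsub>Q\<^esub> F \<in> Hom Q X Z" using comp_Q cls_Hom Compose_in by simp
next
  fix F G H X Y Z T assume "F \<in> Hom Q X Y" "G \<in> Hom Q Y Z" "H \<in> Hom Q Z T"
  then obtain f g h where "f \<in> Hom C X Y" "F = cls f" "g \<in> Hom C Y Z" "G = cls g"
    "h \<in> Hom C Z T" "H = cls h" "X \<in> D" "Y \<in> D" "Z \<in> D" "T \<in> D" using Hom_Q by auto
  then show "(H \<cdot>\<^bsub>Q\<^esub> G) \<cdot>\<^bsub>Q\<^esub> F = H \<cdot>\<^bsub>Q\<^esub> (G \<cdot>\<^bsub>Q\<^esub> F)"
    using comp_Q[of g Y Z h T] comp_Q[of f X Y g Z] comp_Q[of f X Y "h \<cdot> g" T]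
      comp_Q[of "g \<cdot> f" X Z h T] Compose_in[of f X Y g Z] Compose_in[of g Y Z h T]
      Compose_assoc[of f X Y g Z h T] by simp
next
  fix F X Y assume "F \<in> Hom Q X Y"
  then obtain f where "f \<in> Hom C X Y" "F = cls f" "X \<in> D" "Y \<in> D" using Hom_Q by auto
  then show "Ident Q Y \<cdot>\<^bsub>Q\<^esub> F = F" "F \<cdot>\<^bsub>Q\<^esub> Ident Q X = F"
    unfolding Ident_Q
    using comp_Q[of f X Y "Ident C Y" Y] comp_Q[of "Ident C X" X X f Y] D_ObjD Ident_in
      Ident_left Ident_right by auto
qed

lemma preadditive_category_Q: "preadditive_category Q"
proof (intro preadditive_category.intro preadditive_category_axioms.intro)
  show "category Q" by (rule category_Q)
next
  fix X Y assume "X \<in> Obj Q" "Y \<in> Obj Q"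
  then have X: "X \<in> D" "Y \<in> D" "X \<in> Obj C" "Y \<in> Obj C" using D_ObjD by auto
  have hom: "F \<in> carrier (Hom_group Q X Y) \<longleftrightarrow> (\<exists>f \<in> Hom C X Y. F = cls f)" for F
    using X Hom_Q by (simp add: Hom_group_def)
  have A: "f \<boxplus> g \<in> Hom C X Y" if "f \<in> Hom C X Y" "g \<in> Hom C X Y" for f g
    using that by (simp_all add: Hom_iff)
  show "comm_group (Hom_group Q X Y)"
  proof (rule comm_groupI)
    fix F G assume "F \<in> carrier (Hom_group Q X Y)" "G \<in> carrier (Hom_group Q X Y)"
    then obtain f g where f: "f \<in> Hom C X Y" "F = cls f" "g \<in> Hom C X Y" "G = cls g"
      using hom by auto
    have e: "F \<otimes>\<^bsub>Hom_group Q X Y\<^esub> G = cls (f \<boxplus> g)" "G \<otimes>\<^bsub>Hom_group Q X Y\<^esub> F = cls (g \<boxplus> f)"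
      using f X Add_Q by (auto simp: Hom_group_def)
    show "F \<otimes>\<^bsub>Hom_group Q X Y\<^esub> G \<in> carrier (Hom_group Q X Y)"
      using e hom A f by auto
    show "F \<otimes>\<^bsub>Hom_group Q X Y\<^esub> G = G \<otimes>\<^bsub>Hom_group Q X Y\<^esub> F"
      using e Add_comm[OF f(1,3)] by simp
  next
    have "\<one>\<^bsub>Hom_group Q X Y\<^esub> = cls (Zero C X Y)" by (simp add: Hom_group_def Zero_Q)
    moreover have "Zero C X Y \<in> Hom C X Y" using X by (simp add: Hom_iff)
    ultimately show "\<one>\<^bsub>Hom_group Q X Y\<^esub> \<in> carrier (Hom_group Q X Y)" using hom by auto
  next
    fix F G H
    assume "F \<in> carrier (Hom_group Q X Y)" "G \<in> carrier (Hom_group Q X Y)"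
      "H \<in> carrier (Hom_group Q X Y)"
    then obtain f g h where f: "f \<in> Hom C X Y" "F = cls f" "g \<in> Hom C X Y" "G = cls g"
      "h \<in> Hom C X Y" "H = cls h"
      using hom by auto
    then show "F \<otimes>\<^bsub>Hom_group Q X Y\<^esub> G \<otimes>\<^bsub>Hom_group Q X Y\<^esub> H
        = F \<otimes>\<^bsub>Hom_group Q X Y\<^esub> (G \<otimes>\<^bsub>Hom_group Q X Y\<^esub> H)"
      using X Add_Q[OF f(1,3)] Add_Q[OF f(3,5)] Add_Q[OF A[OF f(1,3)] f(5)]
        Add_Q[OF f(1) A[OF f(3,5)]] Add_assoc[of f X Y g h] by (simp add: Hom_group_def)
  next
    fix F assume "F \<in> carrier (Hom_group Q X Y)"
    then obtain f where f: "f \<in> Hom C X Y" "F = cls f" using hom by auto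
    have z: "Zero C X Y \<in> Hom C X Y" "Neg f \<in> Hom C X Y" using X f by (simp_all add: Hom_iff)
    show "\<one>\<^bsub>Hom_group Q X Y\<^esub> \<otimes>\<^bsub>Hom_group Q X Y\<^esub> F = F"
      using Add_Q[OF z(1) f(1)] f X by (simp add: Hom_group_def Zero_Q) (simp add: Hom_iff)
    have "cls (Neg f) \<otimes>\<^bsub>Hom_group Q X Y\<^esub> F = \<one>\<^bsub>Hom_group Q X Y\<^esub>"
      using Add_Q[OF z(2) f(1)] f X by (simp add: Hom_group_def Zero_Q) (simp add: Hom_iff)
    then show "\<exists>G \<in> carrier (Hom_group Q X Y). G \<otimes>\<^bsub>Hom_group Q X Y\<^esub> F = \<one>\<^bsub>Hom_group Q X Y\<^esub>"
      using hom z by blast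
  qed
next
  fix F G G' X Y Z assume "F \<in> Hom Q X Y" "G \<in> Hom Q Y Z" "G' \<in> Hom Q Y Z"
  then obtain f g g' where h: "f \<in> Hom C X Y" "F = cls f" "g \<in> Hom C Y Z" "G = cls g"
    "g' \<in> Hom C Y Z" "G' = cls g'" "X \<in> D" "Y \<in> D" "Z \<in> D" using Hom_Q by auto
  have "g \<boxplus> g' \<in> Hom C Y Z" "g \<cdot> f \<in> Hom C X Z" "g' \<cdot> f \<in> Hom C X Z"
    using h by (simp_all add: Hom_iff)
  then show "(G \<boxplus>\<^bsub>Q\<^esub> G') \<cdot>\<^bsub>Q\<^esub> F = (G \<cdot>\<^bsub>Q\<^esub> F) \<boxplus>\<^bsub>Q\<^esub> (G' \<cdot>\<^bsub>Q\<^esub> F)"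
    using h Add_Q comp_Q Compose_Add_left[OF h(1,3,5)] by simp
next
  fix F F' G X Y Z assume "F \<in> Hom Q X Y" "F' \<in> Hom Q X Y" "G \<in> Hom Q Y Z"
  then obtain f f' g where h: "f \<in> Hom C X Y" "F = cls f" "f' \<in> Hom C X Y" "F' = cls f'"
    "g \<in> Hom C Y Z" "G = cls g" "X \<in> D" "Y \<in> D" "Z \<in> D" using Hom_Q by auto
  have "f \<boxplus> f' \<in> Hom C X Y" "g \<cdot> f \<in> Hom C X Z" "g \<cdot> f' \<in> Hom C X Z"
    using h by (simp_all add: Hom_iff)
  then show "G \<cdot>\<^bsub>Q\<^esub> (F \<boxplus>\<^bsub>Q\<^esub> F') = (G \<cdot>\<^bsub>Q\<^esub> F) \<boxplus>\<^bsub>Q\<^esub> (G \<cdot>\<^bsub>Q\<^esub> F')"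
    using h Add_Q comp_Q Compose_Add_right[OF h(1,3,5)] by simp
qed

lemma cls_eq_Zero:
  assumes "f \<in> Hom C X Y" "X \<in> D" "Y \<in> D"
  shows "cls f = Zero Q X Y \<longleftrightarrow> fac f"
  unfolding Zero_Q using cls_eq_iff[of f X Y "Zero C X Y"] assms D_ObjD by (simp add: Hom_iff)

lemma comp_Q_eq_Zero:
  assumes "f \<in> Hom C X Y" "g \<in> Hom C Y Z" "X \<in> D" "Y \<in> D" "Z \<in> D"
  shows "cls g \<cdot>\<^bsub>Q\<^esub> cls f = Zero Q X Z \<longleftrightarrow> fac (g \<cdot> f)"
  unfolding comp_Q[OF assms] by (rule cls_eq_Zero[OF Compose_in[OF assms(1,2)] assms(3,5)])

lemma zero_object_Q:
  assumes "zero_object C Z" "Z \<in> D"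
  shows "zero_object Q Z"
  unfolding zero_object_def
proof (intro conjI ballI)
  fix X assume "X \<in> Obj Q"
  then have X: "X \<in> D" "X \<in> Obj C" using D_ObjD by auto
  have e: "\<exists>!f. f \<in> Hom C X Z" "\<exists>!f. f \<in> Hom C Z X"
    using assms(1) X(2) by (simp_all add: zero_object_def)
  obtain f where f: "f \<in> Hom C X Z" "\<And>f'. f' \<in> Hom C X Z \<Longrightarrow> f' = f" using e(1) by metis
  obtain g where g: "g \<in> Hom C Z X" "\<And>f'. f' \<in> Hom C Z X \<Longrightarrow> f' = g" using e(2) by metis
  have "F \<in> Hom Q X Z \<longleftrightarrow> F = cls f" "F \<in> Hom Q Z X \<longleftrightarrow> F = cls g" for F
    unfolding Hom_Q using f g X(1) assms(2) by blast+
  then show "\<exists>!f. f \<in> Hom Q X Z" "\<exists>!f. f \<in> Hom Q Z X" by auto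
qed (use assms in simp)

lemma biproduct_Q:
  assumes "biproduct C X Y P i j p q" "X \<in> D" "Y \<in> D" "P \<in> D"
  shows "biproduct Q X Y P (cls i) (cls j) (cls p) (cls q)"
proof -
  note b = assms(1)[unfolded biproduct_def]
  have "i \<cdot> p \<in> Hom C P P" "j \<cdot> q \<in> Hom C P P" using b by (simp_all add: Hom_iff)
  then show ?thesis
    using b assms(2-4) comp_Q[of i X P p X] comp_Q[of j Y P q Y] comp_Q[of j Y P p X]
      comp_Q[of i X P q Y] comp_Q[of p P X i P] comp_Q[of q P Y j P]
      Add_Q[of "i \<cdot> p" P P "j \<cdot> q"]
    by (simp add: biproduct_def Ident_Q Zero_Q cls_Hom)
qed

lemma additive_category_Q:
  assumes "\<exists>Z \<in> D. zero_object C Z"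
    and "\<And>X Y. \<lbrakk>X \<in> D; Y \<in> D\<rbrakk> \<Longrightarrow> \<exists>P \<in> D. \<exists>i j p q. biproduct C X Y P i j p q"
  shows "additive_category Q"
proof (intro additive_category.intro additive_category_axioms.intro)
  show "preadditive_category Q" by (rule preadditive_category_Q)
  show "\<exists>Z. zero_object Q Z" using assms(1) zero_object_Q by blast
  fix X Y assume "X \<in> Obj Q" "Y \<in> Obj Q"
  then have X: "X \<in> D" "Y \<in> D" by auto
  then obtain P i j p q where "P \<in> D" "biproduct C X Y P i j p q" using assms(2) by blast
  then show "\<exists>P i j p q. biproduct Q X Y P i j p q" using biproduct_Q X by blast
qed

lemma is_epi_cls:
  assumes "f \<in> Hom C X Y" "X \<in> D" "Y \<in> D"
    and "\<And>Z g. \<lbrakk>Z \<in> D; g \<in> Hom C Y Z; fac (g \<cdot> f)\<rbrakk> \<Longrightarrow> fac g"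
  shows "is_epi Q (cls f)"
proof (rule preadditive_category.is_epiI[OF preadditive_category_Q cls_Hom[OF assms(1-3)]])
  fix Z G assume G: "G \<in> Hom Q Y Z" and z: "G \<cdot>\<^bsub>Q\<^esub> cls f = Zero Q X Z"
  obtain g where g: "Z \<in> D" "g \<in> Hom C Y Z" "G = cls g" using G unfolding Hom_Q by blast
  have "fac (g \<cdot> f)"
    using z g(3) comp_Q_eq_Zero[OF assms(1) g(2) assms(2,3) g(1)] by simp
  then show "G = Zero Q Y Z" using assms(4)[OF g(1,2)] cls_eq_Zero[OF g(2) assms(3) g(1)] g(3) by simp
qed

lemma is_mono_cls:
  assumes "f \<in> Hom C X Y" "X \<in> D" "Y \<in> D"
    and "\<And>Z g. \<lbrakk>Z \<in> D; g \<in> Hom C Z X; fac (f \<cdot> g)\<rbrakk> \<Longrightarrow> fac g"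
  shows "is_mono Q (cls f)"
proof (rule preadditive_category.is_monoI[OF preadditive_category_Q cls_Hom[OF assms(1-3)]])
  fix Z G assume G: "G \<in> Hom Q Z X" and z: "cls f \<cdot>\<^bsub>Q\<^esub> G = Zero Q Z Y"
  obtain g where g: "Z \<in> D" "g \<in> Hom C Z X" "G = cls g" using G unfolding Hom_Q by blast
  have "fac (f \<cdot> g)"
    using z g(3) comp_Q_eq_Zero[OF g(2) assms(1) g(1) assms(2,3)] by simp
  then show "G = Zero Q Z X" using assms(4)[OF g(1,2)] cls_eq_Zero[OF g(2) g(1) assms(2)] g(3) by simp
qed

text \<open>In the heart, the universal properties hold in a strong form: factorizations exist on the nose,
  not just modulo \<open>W\<close>. The criteria below are adapted to this.\<close>

lemma is_cokernel_cls:
  assumes "f \<in> Hom C X Y" "c \<in> Hom C Y Z" "X \<in> D" "Y \<in> D" "Z \<in> D" "fac (c \<cdot> f)"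
    and "is_epi Q (cls c)"
    and ex: "\<And>Q' g. \<lbrakk>Q' \<in> D; g \<in> Hom C Y Q'; fac (g \<cdot> f)\<rbrakk> \<Longrightarrow> \<exists>t \<in> Hom C Z Q'. t \<cdot> c = g"
  shows "is_cokernel Q (cls f) (cls c)"
proof (rule preadditive_category.is_cokernelI[OF preadditive_category_Q])
  show "cls f \<in> Hom Q X Y" "cls c \<in> Hom Q Y Z" using assms(1-5) cls_Hom by auto
  show "cls c \<cdot>\<^bsub>Q\<^esub> cls f = Zero Q X Z"
    using comp_Q_eq_Zero[OF assms(1-5)] assms(6) by simp
  show "is_epi Q (cls c)" by fact
  fix Q' G assume G: "G \<in> Hom Q Y Q'" and z: "G \<cdot>\<^bsub>Q\<^esub> cls f = Zero Q X Q'"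
  obtain g where g: "Q' \<in> D" "g \<in> Hom C Y Q'" "G = cls g" using G unfolding Hom_Q by blast
  have "fac (g \<cdot> f)"
    using z g(3) comp_Q_eq_Zero[OF assms(1) g(2) assms(3,4) g(1)] by simp
  then obtain t where t: "t \<in> Hom C Z Q'" "t \<cdot> c = g" using ex g by blast
  then have "cls t \<in> Hom Q Z Q'" "cls t \<cdot>\<^bsub>Q\<^esub> cls c = G"
    using cls_Hom[OF t(1) assms(5) g(1)] comp_Q[OF assms(2) t(1) assms(4,5) g(1)] t(2) g(3) by simp_all
  then show "\<exists>u \<in> Hom Q Z Q'. u \<cdot>\<^bsub>Q\<^esub> cls c = G" by blast
qed

lemma is_kernel_cls:
  assumes "f \<in> Hom C X Y" "k \<in> Hom C Z X" "X \<in> D" "Y \<in> D" "Z \<in> D" "fac (f \<cdot> k)"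
    and "is_mono Q (cls k)"
    and ex: "\<And>Q' g. \<lbrakk>Q' \<in> D; g \<in> Hom C Q' X; fac (f \<cdot> g)\<rbrakk> \<Longrightarrow> \<exists>t \<in> Hom C Q' Z. k \<cdot> t = g"
  shows "is_kernel Q (cls f) (cls k)"
proof (rule preadditive_category.is_kernelI[OF preadditive_category_Q])
  show "cls f \<in> Hom Q X Y" "cls k \<in> Hom Q Z X" using assms(1-5) cls_Hom by auto
  show "cls f \<cdot>\<^bsub>Q\<^esub> cls k = Zero Q Z Y"
    using comp_Q_eq_Zero[OF assms(2,1,5,3,4)] assms(6) by simp
  show "is_mono Q (cls k)" by fact
  fix Q' G assume G: "G \<in> Hom Q Q' X" and z: "cls f \<cdot>\<^bsub>Q\<^esub> G = Zero Q Q' Y"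
  obtain g where g: "Q' \<in> D" "g \<in> Hom C Q' X" "G = cls g" using G unfolding Hom_Q by blast
  have "fac (f \<cdot> g)"
    using z g(3) comp_Q_eq_Zero[OF g(2) assms(1) g(1) assms(3,4)] by simp
  then obtain t where t: "t \<in> Hom C Q' Z" "k \<cdot> t = g" using ex g by blast
  then have "cls t \<in> Hom Q Q' Z" "cls k \<cdot>\<^bsub>Q\<^esub> cls t = G"
    using cls_Hom[OF t(1) g(1) assms(5)] comp_Q[OF t(1) assms(2) g(1) assms(5,3)] t(2) g(3) by simp_all
  then show "\<exists>u \<in> Hom Q Q' Z. cls k \<cdot>\<^bsub>Q\<^esub> u = G" by blast
qed

end

section \<open>Exact sequences of an extriangle\<close>

context ext_bifunctor
begin

lemma push_closed [simp]:
  assumes "\<delta> \<in> carrier (Ext B C A)" "a \<in> Hom B A A'" "C \<in> Obj B"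
  shows "push B C a \<delta> \<in> carrier (Ext B C A')"
  using hom_in_carrier[OF Eact_hom[OF Ident_in[OF assms(3)] assms(2)] assms(1)]
  by (simp add: push_def)

lemma pull_closed [simp]:
  assumes "\<delta> \<in> carrier (Ext B C A)" "c \<in> Hom B C' C" "A \<in> Obj B"
  shows "pull B A c \<delta> \<in> carrier (Ext B C' A)"
  using hom_in_carrier[OF Eact_hom[OF assms(2) Ident_in[OF assms(3)]] assms(1)]
  by (simp add: pull_def)

lemma push_hom:
  assumes "a \<in> Hom B A A'" "C \<in> Obj B"
  shows "group_hom (Ext B C A) (Ext B C A') (push B C a)"
proof (intro group_hom.intro group_hom_axioms.intro)
  show "group (Ext B C A)" "group (Ext B C A')"
    using Ext_comm_group assms Hom_Obj by (auto simp: comm_group_def)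
  have "push B C a = Eact B (Ident B C) a" by (rule ext) (simp add: push_def)
  then show "push B C a \<in> hom (Ext B C A) (Ext B C A')"
    using Eact_hom[OF Ident_in[OF assms(2)] assms(1)] by simp
qed

lemma pull_hom:
  assumes "c \<in> Hom B C' C" "A \<in> Obj B"
  shows "group_hom (Ext B C A) (Ext B C' A) (pull B A c)"
proof (intro group_hom.intro group_hom_axioms.intro)
  show "group (Ext B C A)" "group (Ext B C' A)"
    using Ext_comm_group assms Hom_Obj by (auto simp: comm_group_def)
  have "pull B A c = Eact B c (Ident B A)" by (rule ext) (simp add: pull_def)
  then show "pull B A c \<in> hom (Ext B C A) (Ext B C' A)"
    using Eact_hom[OF assms(1) Ident_in[OF assms(2)]] by simp
qed

lemma push_one [simp]:
  "a \<in> Hom B A A' \<Longrightarrow> C \<in> Obj B \<Longrightarrow> push B C a \<one>\<^bsub>Ext B C A\<^esub> = \<one>\<^bsub>Ext B C A'\<^esub>"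
  by (rule group_hom.hom_one[OF push_hom])

lemma pull_one [simp]:
  "c \<in> Hom B C' C \<Longrightarrow> A \<in> Obj B \<Longrightarrow> pull B A c \<one>\<^bsub>Ext B C A\<^esub> = \<one>\<^bsub>Ext B C' A\<^esub>"
  by (rule group_hom.hom_one[OF pull_hom])

lemma one_Ext [simp]: "C \<in> Obj B \<Longrightarrow> A \<in> Obj B \<Longrightarrow> \<one>\<^bsub>Ext B C A\<^esub> \<in> carrier (Ext B C A)"
  using Ext_comm_group[of C A] by (simp add: comm_group_def group_def monoid.one_closed)

lemma push_comp:
  assumes "\<delta> \<in> carrier (Ext B C A)" "a \<in> Hom B A A'" "a' \<in> Hom B A' A''" "C \<in> Obj B"
  shows "push B C a' (push B C a \<delta>) = push B C (a' \<cdot> a) \<delta>"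
  using Eact_Compose[OF Ident_in Ident_in assms(2,3,1)] assms(4) by (simp add: push_def)

lemma pull_comp:
  assumes "\<delta> \<in> carrier (Ext B C A)" "c \<in> Hom B C' C" "c' \<in> Hom B C'' C'" "A \<in> Obj B"
  shows "pull B A c' (pull B A c \<delta>) = pull B A (c \<cdot> c') \<delta>"
  using Eact_Compose[OF assms(2,3) Ident_in Ident_in assms(1)] assms(4) by (simp add: pull_def)

lemma push_pull:
  assumes "\<delta> \<in> carrier (Ext B C A)" "a \<in> Hom B A A'" "c \<in> Hom B C' C"
  shows "push B C' a (pull B A c \<delta>) = pull B A' c (push B C a \<delta>)"
proof -
  have o: "A \<in> Obj B" "A' \<in> Obj B" "C \<in> Obj B" "C' \<in> Obj B" using assms Hom_Obj by auto
  have "push B C' a (pull B A c \<delta>) = Eact B (c \<cdot> Ident B C') (a \<cdot> Ident B A) \<delta>"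
    unfolding push_def pull_def
    by (rule Eact_Compose[OF assms(3) Ident_in Ident_in assms(2,1), symmetric]) (use o in auto)
  also have "\<dots> = Eact B (Ident B C \<cdot> c) (Ident B A' \<cdot> a) \<delta>"
    using assms by (simp add: Hom_iff)
  also have "\<dots> = pull B A' c (push B C a \<delta>)"
    unfolding push_def pull_def
    by (rule Eact_Compose[OF Ident_in assms(3) assms(2) Ident_in assms(1)]) (use o in auto)
  finally show ?thesis .
qed

lemma push_Ident [simp]:
  "\<delta> \<in> carrier (Ext B C A) \<Longrightarrow> C \<in> Obj B \<Longrightarrow> A \<in> Obj B \<Longrightarrow> push B C (Ident B A) \<delta> = \<delta>"
  by (simp add: push_def Eact_Ident)

lemma pull_Ident [simp]:
  "\<delta> \<in> carrier (Ext B C A) \<Longrightarrow> C \<in> Obj B \<Longrightarrow> A \<in> Obj B \<Longrightarrow> pull B A (Ident B C) \<delta> = \<delta>"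
  by (simp add: pull_def Eact_Ident)

end

context additive_realization
begin

lemma etriangle_Hom:
  assumes "etriangle B A x M y C \<delta>"
  shows "x \<in> Hom B A M" "y \<in> Hom B M C" "\<delta> \<in> carrier (Ext B C A)"
    "A \<in> Obj B" "M \<in> Obj B" "C \<in> Obj B"
    "x \<in> Arr B" "Dom B x = A" "Cod B x = M" "y \<in> Arr B" "Dom B y = M" "Cod B y = C"
  using assms by (auto simp: etriangle_def Hom_iff)

lemma ex_etriangle:
  assumes "C \<in> Obj B" "A \<in> Obj B" "\<delta> \<in> carrier (Ext B C A)"
  shows "\<exists>x M y. etriangle B A x M y C \<delta>"
proof -
  obtain s where s: "s \<in> seqs B A C" "Real B C A \<delta> = seq_equiv B A C `` {s}"
    using Real_class[OF assms] by (auto elim!: quotientE)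
  obtain x y M where xy: "s = (x, y)" "M \<in> Obj B" "x \<in> Hom B A M" "y \<in> Hom B M C"
    using s(1) by (auto simp: seqs_def)
  have "(s, s) \<in> seq_equiv B A C"
    using s(1) xy Ident_iso[OF xy(2)] unfolding seq_equiv_def
    by (auto intro!: bexI[of _ "Ident B M"] simp: Hom_iff)
  then have "(x, y) \<in> Real B C A \<delta>" using s(2) xy(1) by auto
  then show ?thesis using assms xy by (auto simp: etriangle_def)
qed

lemma ex_split_etriangle:
  assumes "C \<in> Obj B" "A \<in> Obj B"
  obtains P i j p q where "biproduct B A C P i j p q" "etriangle B A i P q C \<one>\<^bsub>Ext B C A\<^esub>"
  using ex_biproduct[OF assms(2,1)] Real_zero by blast

lemma etriangle_Ident_zero:
  assumes "zero_object B Z" "X \<in> Obj B"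
  shows "etriangle B X (Ident B X) X (Zero B X Z) Z \<one>\<^bsub>Ext B Z X\<^esub>"
    "etriangle B Z (Zero B Z X) X (Ident B X) X \<one>\<^bsub>Ext B X Z\<^esub>"
  using biproduct_zero[OF assms] Real_zero by blast+

text \<open>If the class of the extriangle dies on \<open>X\<close>, then the split extriangle \<open>A \<rightarrow> A \<oplus> X \<rightarrow> X\<close> maps to it
  over \<open>h\<close>; the component on \<open>X\<close> of its middle morphism is the lift.\<close>

lemma lift_along_deflation:
  assumes tri: "etriangle B A x M y C \<delta>" and h: "h \<in> Hom B X C"
    and "pull B A h \<delta> = \<one>\<^bsub>Ext B X A\<^esub>"
  shows "\<exists>l \<in> Hom B X M. y \<cdot> l = h"
proof -
  note t = etriangle_Hom[OF tri]
  have X: "X \<in> Obj B" using h Hom_Obj by blast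
  obtain P i j p q where P: "biproduct B A X P i j p q"
    and P': "etriangle B A i P q X \<one>\<^bsub>Ext B X A\<^esub>"
    using ex_split_etriangle[OF X t(4)] .
  obtain b where b: "b \<in> Hom B P M" "y \<cdot> b = h \<cdot> q"
    using Real_morphism[OF P' tri Ident_in[OF t(4)] h] assms(3) X t by auto
  have "y \<cdot> (b \<cdot> j) = (h \<cdot> q) \<cdot> j"
    using comp_reassoc[OF b(2), of j] b t P by (auto simp: Hom_iff biproduct_def)
  also have "\<dots> = h" using P h by (auto simp: biproduct_def Hom_iff)
  finally show ?thesis using b P by (intro bexI[of _ "b \<cdot> j"]) (auto simp: biproduct_def Hom_iff)
qed

lemma extend_along_inflation:
  assumes tri: "etriangle B A x M y C \<delta>" and h: "h \<in> Hom B A X"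
    and "push B C h \<delta> = \<one>\<^bsub>Ext B C X\<^esub>"
  shows "\<exists>l \<in> Hom B M X. l \<cdot> x = h"
proof -
  note t = etriangle_Hom[OF tri]
  have X: "X \<in> Obj B" using h Hom_Obj by blast
  obtain P i j p q where P: "biproduct B X C P i j p q"
    and P': "etriangle B X i P q C \<one>\<^bsub>Ext B C X\<^esub>"
    using ex_split_etriangle[OF t(6) X] .
  obtain b where b: "b \<in> Hom B M P" "b \<cdot> x = i \<cdot> h"
    using Real_morphism[OF tri P' h Ident_in[OF t(6)]] assms(3) X t by auto
  have "(p \<cdot> b) \<cdot> x = p \<cdot> (i \<cdot> h)"
    using b t P by (auto simp: Hom_iff biproduct_def)
  also have "\<dots> = h" using P h comp_reassoc[of p i "Ident B X" h] by (auto simp: biproduct_def Hom_iff)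
  finally show ?thesis using b P by (intro bexI[of _ "p \<cdot> b"]) (auto simp: biproduct_def Hom_iff)
qed

end

context extriangulated
begin

text \<open>By (ET3), the trivial extriangle \<open>A = A \<rightarrow> 0\<close> maps to the given one over \<open>x\<close>, so \<open>y \<cdot> x\<close> factors
  through zero. The next lemmas use the same comparison with trivial extriangles.\<close>

lemma etriangle_comp_zero:
  assumes tri: "etriangle B A x M y C \<delta>"
  shows "y \<cdot> x = Zero B A C"
proof -
  note t = etriangle_Hom[OF tri]
  obtain Z where Z: "zero_object B Z" using ex_zero_object by blast
  then have ZO: "Z \<in> Obj B" by (simp add: zero_object_def)
  obtain c where c: "c \<in> Hom B Z C" "c \<cdot> Zero B A Z = y \<cdot> x"
    using ET3[OF etriangle_Ident_zero(1)[OF Z t(4)] tri Ident_in[OF t(4)] t(1)] t by auto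
  then show ?thesis using t ZO by (auto simp: Hom_iff)
qed

lemma factor_through_inflation:
  assumes tri: "etriangle B A x M y C \<delta>" and h: "h \<in> Hom B X M" "y \<cdot> h = Zero B X C"
  shows "\<exists>l \<in> Hom B X A. x \<cdot> l = h"
proof -
  note t = etriangle_Hom[OF tri]
  have X: "X \<in> Obj B" using h Hom_Obj by blast
  obtain Z where Z: "zero_object B Z" using ex_zero_object by blast
  then have ZO: "Z \<in> Obj B" by (simp add: zero_object_def)
  have z: "Zero B Z C \<in> Hom B Z C" using ZO t by (simp add: Hom_iff)
  have "Zero B Z C \<cdot> Zero B X Z = y \<cdot> h" using h(2) t X ZO by simp
  then obtain a where a: "a \<in> Hom B X A" "h \<cdot> Ident B X = x \<cdot> a"
    using ET3_op[OF etriangle_Ident_zero(1)[OF Z X] tri h(1) z] by blast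
  have "h \<cdot> Ident B X = h" using h(1) by (simp add: Hom_iff)
  then show ?thesis using a by auto
qed

lemma factor_through_deflation:
  assumes tri: "etriangle B A x M y C \<delta>" and h: "h \<in> Hom B M X" "h \<cdot> x = Zero B A X"
  shows "\<exists>l \<in> Hom B C X. l \<cdot> y = h"
proof -
  note t = etriangle_Hom[OF tri]
  have X: "X \<in> Obj B" using h Hom_Obj by blast
  obtain Z where Z: "zero_object B Z" using ex_zero_object by blast
  then have ZO: "Z \<in> Obj B" by (simp add: zero_object_def)
  have z: "Zero B A Z \<in> Hom B A Z" using ZO t by (simp add: Hom_iff)
  have "h \<cdot> x = Zero B Z X \<cdot> Zero B A Z" using h(2) t X ZO by simp
  then obtain c where c: "c \<in> Hom B C X" "c \<cdot> y = Ident B X \<cdot> h"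
    using ET3[OF tri etriangle_Ident_zero(2)[OF Z X] z h(1)] by blast
  have "Ident B X \<cdot> h = h" using h(1) by (simp add: Hom_iff)
  then show ?thesis using c by auto
qed

text \<open>Realize \<open>\<eta>\<close> by \<open>X \<rightarrow> N \<rightarrow> M\<close> and apply (ET4)\<open>\<^sup>o\<^sup>p\<close> to \<open>N \<rightarrow> M \<rightarrow> C\<close>. This yields an extriangle with class
  \<open>x\<^sup>*\<eta> = 0\<close>, whose splitting moves the class of the composite extriangle to a preimage of \<open>\<eta>\<close>.\<close>

lemma Ext_exact_middle_left:
  assumes tri: "etriangle B A x M y C \<delta>" and X: "X \<in> Obj B"
    and \<eta>: "\<eta> \<in> carrier (Ext B M X)" "pull B X x \<eta> = \<one>\<^bsub>Ext B A X\<^esub>"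
  shows "\<exists>\<theta> \<in> carrier (Ext B C X). \<eta> = pull B X y \<theta>"
proof -
  note t = etriangle_Hom[OF tri]
  obtain g' N g where N: "etriangle B X g' N g M \<eta>" using ex_etriangle[OF t(5) X \<eta>(1)] by blast
  note n = etriangle_Hom[OF N]
  obtain E d e h' \<delta>'' where E: "d \<in> Hom B E A" "e \<in> Hom B X E"
    "etriangle B E h' N (y \<cdot> g) C \<delta>''" "etriangle B X e E d A (pull B X x \<eta>)"
    "pull B E y \<delta>'' = push B M e \<eta>"
    using ET4_op[OF tri N] by blast
  note e = etriangle_Hom[OF E(3)]
  have "push B A (Ident B X) (pull B X x \<eta>) = \<one>\<^bsub>Ext B A X\<^esub>" using \<eta>(2) X t by simp
  then obtain \<rho> where \<rho>: "\<rho> \<in> Hom B E X" "\<rho> \<cdot> e = Ident B X"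
    using extend_along_inflation[OF E(4) Ident_in[OF X]] by blast
  have "\<eta> = push B M \<rho> (push B M e \<eta>)"
    using push_comp[OF \<eta>(1) E(2) \<rho>(1) t(5)] \<rho>(2) \<eta>(1) X t by simp
  also have "\<dots> = pull B X y (push B C \<rho> \<delta>'')"
    using push_pull[OF e(3) \<rho>(1) t(2)] E(5) by simp
  finally show ?thesis using e \<rho> t by (intro bexI[of _ "push B C \<rho> \<delta>''"]) auto
qed

lemma Ext_exact_middle_right:
  assumes tri: "etriangle B A x M y C \<delta>" and X: "X \<in> Obj B"
    and \<eta>: "\<eta> \<in> carrier (Ext B X M)" "push B X y \<eta> = \<one>\<^bsub>Ext B X C\<^esub>"
  shows "\<exists>\<theta> \<in> carrier (Ext B X A). \<eta> = push B X x \<theta>"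
proof -
  note t = etriangle_Hom[OF tri]
  obtain g' N g where N: "etriangle B M g N g' X \<eta>" using ex_etriangle[OF X t(5) \<eta>(1)] by blast
  note n = etriangle_Hom[OF N]
  obtain E d e h' \<delta>'' where E: "d \<in> Hom B C E" "e \<in> Hom B E X"
    "etriangle B A (g \<cdot> x) N h' E \<delta>''" "etriangle B C d E e X (push B X y \<eta>)"
    "push B E x \<delta>'' = pull B M e \<eta>"
    using ET4[OF tri N] by blast
  note e = etriangle_Hom[OF E(3)]
  have "pull B C (Ident B X) (push B X y \<eta>) = \<one>\<^bsub>Ext B X C\<^esub>" using \<eta>(2) X t by simp
  then obtain \<sigma> where \<sigma>: "\<sigma> \<in> Hom B X E" "e \<cdot> \<sigma> = Ident B X"
    using lift_along_deflation[OF E(4) Ident_in[OF X]] by blast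
  have "\<eta> = pull B M \<sigma> (pull B M e \<eta>)"
    using pull_comp[OF \<eta>(1) E(2) \<sigma>(1) t(5)] \<sigma>(2) \<eta>(1) X t by simp
  also have "\<dots> = push B X x (pull B A \<sigma> \<delta>'')"
    using push_pull[OF e(3) t(1) \<sigma>(1)] E(5) by simp
  finally show ?thesis using e \<sigma> t by (intro bexI[of _ "pull B A \<sigma> \<delta>''"]) auto
qed

lemma push_deflation_inj:
  assumes tri: "etriangle B A x M y C \<delta>" and X: "X \<in> Obj B"
    and triv: "carrier (Ext B X A) = {\<one>\<^bsub>Ext B X A\<^esub>}"
    and \<eta>: "\<eta> \<in> carrier (Ext B X M)" "\<eta>' \<in> carrier (Ext B X M)"
      "push B X y \<eta> = push B X y \<eta>'"
  shows "\<eta> = \<eta>'"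
proof -
  note t = etriangle_Hom[OF tri]
  interpret f: group_hom "Ext B X M" "Ext B X C" "push B X y" by (rule push_hom[OF t(2) X])
  let ?d = "\<eta> \<otimes>\<^bsub>Ext B X M\<^esub> inv\<^bsub>Ext B X M\<^esub> \<eta>'"
  have "push B X y ?d = \<one>\<^bsub>Ext B X C\<^esub>" using \<eta> by simp
  then obtain \<theta> where \<theta>: "\<theta> \<in> carrier (Ext B X A)" "?d = push B X x \<theta>"
    using Ext_exact_middle_right[OF tri X, of ?d] \<eta> by auto
  then have "?d = \<one>\<^bsub>Ext B X M\<^esub>" using triv X t(1) by simp
  moreover have "\<eta> = ?d \<otimes>\<^bsub>Ext B X M\<^esub> \<eta>'" using \<eta>(1,2) by (simp add: f.G.m_assoc)
  ultimately show ?thesis using \<eta>(2) by simp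
qed

text \<open>The class being zero gives a section \<open>\<sigma>\<close> of \<open>y\<close> and some retraction \<open>\<rho>'\<close> of \<open>x\<close>, but these two need
  not be complementary. The retraction that fits \<open>\<sigma>\<close> comes from \<open>1 - \<sigma> y\<close>, which \<open>y\<close> annihilates;
  \<open>\<rho>'\<close> only serves to cancel \<open>x\<close>.\<close>

lemma split_etriangle_biproduct:
  assumes tri: "etriangle B A x M y C \<one>\<^bsub>Ext B C A\<^esub>"
  shows "\<exists>\<sigma> \<rho>. biproduct B A C M x \<sigma> \<rho> y"
proof -
  note t = etriangle_Hom[OF tri]
  obtain \<sigma> where \<sigma>: "\<sigma> \<in> Hom B C M" "y \<cdot> \<sigma> = Ident B C"
    using lift_along_deflation[OF tri Ident_in[OF t(6)]] t by auto
  obtain \<rho>' where \<rho>': "\<rho>' \<in> Hom B M A" "\<rho>' \<cdot> x = Ident B A"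
    using extend_along_inflation[OF tri Ident_in[OF t(4)]] t by auto
  let ?e = "Sub (Ident B M) (\<sigma> \<cdot> y)"
  have e: "?e \<in> Hom B M M" using \<sigma> t by (auto simp: Hom_iff)
  have "y \<cdot> (\<sigma> \<cdot> y) = y" using comp_reassoc[OF \<sigma>(2), of y] \<sigma>(1) t by (simp add: Hom_iff)
  then have "y \<cdot> ?e = Zero B M C" using \<sigma> t by (simp add: Hom_iff)
  then obtain \<rho> where \<rho>: "\<rho> \<in> Hom B M A" "x \<cdot> \<rho> = ?e"
    using factor_through_inflation[OF tri e] by blast
  have x_cancel: "u = v" if "u \<in> Hom B X A" "v \<in> Hom B X A" "x \<cdot> u = x \<cdot> v" for X u v
  proof -
    have *: "\<rho>' \<cdot> (x \<cdot> w) = w" if "w \<in> Hom B X A" for w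
      using comp_reassoc[OF \<rho>'(2), of w] that \<rho>'(1) t(7-9) by (simp add: Hom_iff)
    show ?thesis using *[OF that(1), symmetric, unfolded that(3)] *[OF that(2)] by (rule trans)
  qed
  have "x \<cdot> (\<rho> \<cdot> x) = ?e \<cdot> x" by (rule comp_reassoc[OF \<rho>(2)]) (use \<rho> t in \<open>auto simp: Hom_iff\<close>)
  also have "\<dots> = Sub x (Zero B A M)"
    using \<sigma>(1) t etriangle_comp_zero[OF tri] by (simp add: Hom_iff)
  also have "\<dots> = x"
    using Sub_unique[of x A M "Zero B A M" x] t by (simp add: Hom_iff)
  finally have "x \<cdot> (\<rho> \<cdot> x) = x \<cdot> Ident B A" using t by simp
  then have \<rho>x: "\<rho> \<cdot> x = Ident B A" by (rule x_cancel[rotated 2]) (use \<rho> t in \<open>auto simp: Hom_iff\<close>)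
  have "x \<cdot> (\<rho> \<cdot> \<sigma>) = ?e \<cdot> \<sigma>"
    by (rule comp_reassoc[OF \<rho>(2)]) (use \<rho> \<sigma> t in \<open>auto simp: Hom_iff\<close>)
  also have "\<dots> = Zero B C M" using \<sigma> t by (simp add: Hom_iff)
  finally have "x \<cdot> (\<rho> \<cdot> \<sigma>) = x \<cdot> Zero B C A" using t by simp
  then have \<rho>\<sigma>: "\<rho> \<cdot> \<sigma> = Zero B C A"
    by (rule x_cancel[rotated 2]) (use \<rho> \<sigma> t in \<open>auto simp: Hom_iff\<close>)
  have "\<sigma> \<cdot> y \<boxplus> x \<cdot> \<rho> = Ident B M"
    unfolding \<rho>(2) by (rule Add_Sub) (use \<sigma> t in \<open>auto simp: Hom_iff\<close>)
  moreover have "\<sigma> \<cdot> y \<boxplus> x \<cdot> \<rho> = x \<cdot> \<rho> \<boxplus> \<sigma> \<cdot> y"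
    by (rule Add_comm[of _ M M]) (use \<sigma> \<rho> t in \<open>auto simp: Hom_iff\<close>)
  ultimately have "biproduct B A C M x \<sigma> \<rho> y"
    using t \<sigma> \<rho>(1) \<rho>x \<rho>\<sigma> etriangle_comp_zero[OF tri] by (simp add: biproduct_def)
  then show ?thesis by blast
qed

end

section \<open>Cotorsion pairs\<close>

context extriangulated
begin

lemma cotorsion_pairD:
  assumes "cotorsion_pair B U V"
  shows "U \<subseteq> Obj B" "V \<subseteq> Obj B" "summand_closed B U" "summand_closed B V"
    "\<And>X Y. \<lbrakk>X \<in> U; Y \<in> V\<rbrakk> \<Longrightarrow> carrier (Ext B X Y) = {\<one>\<^bsub>Ext B X Y\<^esub>}"
    "\<And>X. X \<in> Obj B \<Longrightarrow> \<exists>Y \<in> V. \<exists>X' \<in> U. \<exists>x y \<delta>. etriangle B Y x X' y X \<delta>"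
    "\<And>X. X \<in> Obj B \<Longrightarrow> \<exists>Y \<in> V. \<exists>X' \<in> U. \<exists>x y \<delta>. etriangle B X x Y y X' \<delta>"
  using assms unfolding cotorsion_pair_def iso_closed_def by blast+

text \<open>In a cotorsion pair, each class is determined by the other as its \<open>\<E>\<close>-orthogonal: the approximation
  of an orthogonal object splits, and the classes are closed under summands.\<close>

lemma cotorsion_left_memI:
  assumes UV: "cotorsion_pair B U V" and X: "X \<in> Obj B"
    and triv: "\<And>Y \<eta>. \<lbrakk>Y \<in> V; \<eta> \<in> carrier (Ext B X Y)\<rbrakk> \<Longrightarrow> \<eta> = \<one>\<^bsub>Ext B X Y\<^esub>"
  shows "X \<in> U"
proof -
  note c = cotorsion_pairD[OF UV]
  obtain Y X' x y \<delta> where t: "Y \<in> V" "X' \<in> U" "etriangle B Y x X' y X \<delta>" using c(6)[OF X] by blast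
  have "\<delta> = \<one>\<^bsub>Ext B X Y\<^esub>" using triv[OF t(1)] etriangle_Hom(3)[OF t(3)] by simp
  then obtain \<sigma> \<rho> where "biproduct B Y X X' x \<sigma> \<rho> y" using split_etriangle_biproduct t(3) by blast
  then have "biproduct B X Y X' \<sigma> x y \<rho>" by (rule biproduct_swap)
  then show ?thesis using c(3) t(2) unfolding summand_closed_def by blast
qed

lemma cotorsion_right_memI:
  assumes UV: "cotorsion_pair B U V" and Y: "Y \<in> Obj B"
    and triv: "\<And>X \<eta>. \<lbrakk>X \<in> U; \<eta> \<in> carrier (Ext B X Y)\<rbrakk> \<Longrightarrow> \<eta> = \<one>\<^bsub>Ext B X Y\<^esub>"
  shows "Y \<in> V"
proof -
  note c = cotorsion_pairD[OF UV]
  obtain Y' X x y \<delta> where t: "Y' \<in> V" "X \<in> U" "etriangle B Y x Y' y X \<delta>" using c(7)[OF Y] by blast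
  have "\<delta> = \<one>\<^bsub>Ext B X Y\<^esub>" using triv[OF t(2)] etriangle_Hom(3)[OF t(3)] by simp
  then obtain \<sigma> \<rho> where "biproduct B Y X Y' x \<sigma> \<rho> y" using split_etriangle_biproduct t(3) by blast
  then show ?thesis using c(4) t(1) unfolding summand_closed_def by blast
qed

lemma cotorsion_left_extension_closed:
  assumes UV: "cotorsion_pair B U V" and tri: "etriangle B A x M y C \<delta>" and "A \<in> U" "C \<in> U"
  shows "M \<in> U"
proof (rule cotorsion_left_memI[OF UV etriangle_Hom(5)[OF tri]])
  note c = cotorsion_pairD[OF UV] and t = etriangle_Hom[OF tri]
  fix Y \<eta> assume Y: "Y \<in> V" and \<eta>: "\<eta> \<in> carrier (Ext B M Y)"
  have YO: "Y \<in> Obj B" using Y c(2) by blast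
  have "pull B Y x \<eta> = \<one>\<^bsub>Ext B A Y\<^esub>" using pull_closed[OF \<eta> t(1) YO] c(5)[OF \<open>A \<in> U\<close> Y] by simp
  then obtain \<theta> where \<theta>: "\<theta> \<in> carrier (Ext B C Y)" "\<eta> = pull B Y y \<theta>"
    using Ext_exact_middle_left[OF tri YO \<eta>] by blast
  then show "\<eta> = \<one>\<^bsub>Ext B M Y\<^esub>" using c(5)[OF \<open>C \<in> U\<close> Y] pull_one[OF t(2) YO] by simp
qed

lemma cotorsion_right_extension_closed:
  assumes UV: "cotorsion_pair B U V" and tri: "etriangle B A x M y C \<delta>" and "A \<in> V" "C \<in> V"
  shows "M \<in> V"
proof (rule cotorsion_right_memI[OF UV etriangle_Hom(5)[OF tri]])
  note c = cotorsion_pairD[OF UV] and t = etriangle_Hom[OF tri]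
  fix X \<eta> assume X: "X \<in> U" and \<eta>: "\<eta> \<in> carrier (Ext B X M)"
  have XO: "X \<in> Obj B" using X c(1) by blast
  have "push B X y \<eta> = \<one>\<^bsub>Ext B X C\<^esub>" using push_closed[OF \<eta> t(2) XO] c(5)[OF X \<open>C \<in> V\<close>] by simp
  then obtain \<theta> where \<theta>: "\<theta> \<in> carrier (Ext B X A)" "\<eta> = push B X x \<theta>"
    using Ext_exact_middle_right[OF tri XO \<eta>] by blast
  then show "\<eta> = \<one>\<^bsub>Ext B X M\<^esub>" using c(5)[OF X \<open>A \<in> V\<close>] push_one[OF t(1) XO] by simp
qed

lemma cotorsion_biproduct_closed:
  assumes UV: "cotorsion_pair B U V" and P: "biproduct B X Y P i j p q"
  shows "\<lbrakk>X \<in> U; Y \<in> U\<rbrakk> \<Longrightarrow> P \<in> U" "\<lbrakk>X \<in> V; Y \<in> V\<rbrakk> \<Longrightarrow> P \<in> V"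
  using cotorsion_left_extension_closed[OF UV Real_zero[OF P]]
    cotorsion_right_extension_closed[OF UV Real_zero[OF P]] by blast+

lemma cotorsion_zero_object:
  assumes UV: "cotorsion_pair B U V" and Z: "zero_object B Z"
  shows "Z \<in> U" "Z \<in> V"
proof -
  note c = cotorsion_pairD[OF UV]
  have "Z \<in> Obj B" using Z by (simp add: zero_object_def)
  then obtain X Y where XY: "X \<in> U" "Y \<in> V" using c(6) by blast
  then have "X \<in> Obj B" "Y \<in> Obj B" using c(1,2) by blast+
  then show "Z \<in> U" "Z \<in> V"
    using biproduct_zero(2)[OF Z] c(3,4) XY unfolding summand_closed_def by blast+
qed

end

section \<open>Twin cotorsion pairs\<close>

locale twin_cotorsion = extriangulated B
  for B :: "('o, 'm, 'e, 'z) extri_scheme" (structure) +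
  fixes S T U V :: "'o set"
  assumes twin: "twin_cotorsion_pair B S T U V"
begin

lemma ST: "cotorsion_pair B S T" and UV: "cotorsion_pair B U V" and S_sub_U: "S \<subseteq> U"
  using twin by (auto simp: twin_cotorsion_pair_def)

lemmas ST_facts = cotorsion_pairD[OF ST]
lemmas UV_facts = cotorsion_pairD[OF UV]

lemma V_sub_T: "V \<subseteq> T"
proof
  fix Y assume Y: "Y \<in> V"
  show "Y \<in> T"
  proof (rule cotorsion_right_memI[OF ST])
    show "Y \<in> Obj B" using Y UV_facts(2) by blast
    fix X \<eta> assume "X \<in> S" "\<eta> \<in> carrier (Ext B X Y)"
    then show "\<eta> = \<one>\<^bsub>Ext B X Y\<^esub>" using UV_facts(5)[of X Y] S_sub_U Y by blast
  qed
qed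

abbreviation H :: "'o set"
  where "H \<equiv> heart_objects B S T U V"

abbreviation Bplus :: "'o set"
  where "Bplus \<equiv> B_plus B S T U V"

abbreviation Bminus :: "'o set"
  where "Bminus \<equiv> B_minus B S T U V"

lemma H_iff: "X \<in> H \<longleftrightarrow> X \<in> Bplus \<and> X \<in> Bminus"
  by (simp add: heart_objects_def)

lemma BplusE:
  assumes "X \<in> Bplus"
  obtains Y W x y \<delta> where "Y \<in> V" "W \<in> T" "W \<in> U" "etriangle B Y x W y X \<delta>"
  using assms unfolding B_plus_def by blast

lemma BminusE:
  assumes "X \<in> Bminus"
  obtains W Z x y \<delta> where "W \<in> T" "W \<in> U" "Z \<in> S" "etriangle B X x W y Z \<delta>"
  using assms unfolding B_minus_def by blast

lemma BplusI: "\<lbrakk>etriangle B Y x W y X \<delta>; Y \<in> V; W \<in> T; W \<in> U\<rbrakk> \<Longrightarrow> X \<in> Bplus"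
  unfolding B_plus_def using etriangle_Hom(6) by blast

lemma BminusI: "\<lbrakk>etriangle B X x W y Z \<delta>; Z \<in> S; W \<in> T; W \<in> U\<rbrakk> \<Longrightarrow> X \<in> Bminus"
  unfolding B_minus_def using etriangle_Hom(4) by blast

text \<open>The approximating extriangles are the trivial ones, since zero objects lie in all four classes.\<close>

lemma W_sub_H: "T \<inter> U \<subseteq> H"
proof
  fix X assume X: "X \<in> T \<inter> U"
  then have XO: "X \<in> Obj B" using UV_facts(1) by blast
  obtain Z where Z: "zero_object B Z" using ex_zero_object by blast
  note z = cotorsion_zero_object[OF ST Z] cotorsion_zero_object[OF UV Z]
  show "X \<in> H" unfolding H_iff
    using BplusI[OF etriangle_Ident_zero(2)[OF Z XO]] BminusI[OF etriangle_Ident_zero(1)[OF Z XO]]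
      X z by blast
qed

lemma H_biproduct:
  assumes "X \<in> H" "Y \<in> H" and P: "biproduct B X Y P i j p q"
  shows "P \<in> H"
  unfolding H_iff
proof
  obtain A W x w \<delta> where X: "A \<in> V" "W \<in> T" "W \<in> U" "etriangle B A x W w X \<delta>"
    using BplusE assms(1) H_iff by metis
  obtain A' W' x' w' \<delta>' where Y: "A' \<in> V" "W' \<in> T" "W' \<in> U" "etriangle B A' x' W' w' Y \<delta>'"
    using BplusE assms(2) H_iff by metis
  obtain A2 iA iA' pA pA' where A: "biproduct B A A' A2 iA iA' pA pA'"
    using ex_biproduct etriangle_Hom(4)[OF X(4)] etriangle_Hom(4)[OF Y(4)] by blast
  obtain W2 iW iW' pW pW' where W: "biproduct B W W' W2 iW iW' pW pW'"
    using ex_biproduct etriangle_Hom(5)[OF X(4)] etriangle_Hom(5)[OF Y(4)] by blast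
  show "P \<in> Bplus"
    using BplusI[OF Real_sum[OF X(4) Y(4) A W P]] X(1-3) Y(1-3)
      cotorsion_biproduct_closed[OF ST W] cotorsion_biproduct_closed[OF UV W]
      cotorsion_biproduct_closed[OF UV A] by blast
next
  obtain A W x w \<delta> where X: "W \<in> T" "W \<in> U" "A \<in> S" "etriangle B X x W w A \<delta>"
    using BminusE assms(1) H_iff by metis
  obtain A' W' x' w' \<delta>' where Y: "W' \<in> T" "W' \<in> U" "A' \<in> S" "etriangle B Y x' W' w' A' \<delta>'"
    using BminusE assms(2) H_iff by metis
  obtain A2 iA iA' pA pA' where A: "biproduct B A A' A2 iA iA' pA pA'"
    using ex_biproduct etriangle_Hom(6)[OF X(4)] etriangle_Hom(6)[OF Y(4)] by blast
  obtain W2 iW iW' pW pW' where W: "biproduct B W W' W2 iW iW' pW pW'"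
    using ex_biproduct etriangle_Hom(5)[OF X(4)] etriangle_Hom(5)[OF Y(4)] by blast
  show "P \<in> Bminus"
    using BminusI[OF Real_sum[OF X(4) Y(4) P W A]] X(1-3) Y(1-3)
      cotorsion_biproduct_closed[OF ST W] cotorsion_biproduct_closed[OF UV W]
      cotorsion_biproduct_closed[OF ST A] by blast
qed

sublocale additive_ideal_quotient B H "T \<inter> U"
proof unfold_locales
  show "H \<subseteq> Obj B" by (auto simp: heart_objects_def B_plus_def)
  show "T \<inter> U \<subseteq> Obj B" using UV_facts(1) by blast
  obtain Z where Z: "zero_object B Z" using ex_zero_object by blast
  show "T \<inter> U \<noteq> {}" using cotorsion_zero_object[OF ST Z] cotorsion_zero_object[OF UV Z] by blast
  fix X Y assume XY: "X \<in> T \<inter> U" "Y \<in> T \<inter> U"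
  then obtain P i j p q where P: "biproduct B X Y P i j p q" using ex_biproduct UV_facts(1) by blast
  then show "\<exists>P \<in> T \<inter> U. \<exists>i j p q. biproduct B X Y P i j p q"
    using cotorsion_biproduct_closed[OF ST P] cotorsion_biproduct_closed[OF UV P] XY by blast
qed

lemma additive_category_heart: "additive_category Q"
proof (rule additive_category_Q)
  obtain Z where Z: "zero_object B Z" using ex_zero_object by blast
  then show "\<exists>Z \<in> H. zero_object B Z"
    using cotorsion_zero_object[OF ST Z] cotorsion_zero_object[OF UV Z] W_sub_H by blast
  fix X Y assume XY: "X \<in> H" "Y \<in> H"
  then obtain P i j p q where P: "biproduct B X Y P i j p q" using ex_biproduct D_ObjD by blast
  then show "\<exists>P \<in> H. \<exists>i j p q. biproduct B X Y P i j p q" using H_biproduct[OF XY P] by blast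
qed

section \<open>Arrows factoring through the intersection class\<close>

text \<open>Pushing along an arrow through \<open>X \<in> W\<close> passes through \<open>\<E>(Z, X) = 0\<close>. This is how factoring through
  \<open>W\<close> is converted into the vanishing of extension classes.\<close>

lemma push_fac_trivial:
  assumes "\<delta> \<in> carrier (Ext B Z A)" "Z \<in> S" "fac h" and h: "h \<in> Hom B A Q'"
  shows "push B Z h \<delta> = \<one>\<^bsub>Ext B Z Q'\<^esub>"
proof -
  obtain X a b where x: "X \<in> T \<inter> U" "a \<in> Hom B A X" "b \<in> Hom B X Q'" "h = b \<cdot> a"
    by (rule facE[OF assms(3) h])
  have Z: "Z \<in> Obj B" using assms(2) ST_facts(1) by blast
  have "push B Z a \<delta> = \<one>\<^bsub>Ext B Z X\<^esub>"
    using push_closed[OF assms(1) x(2) Z] ST_facts(5)[OF assms(2), of X] x(1) by simp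
  then show ?thesis
    using push_comp[OF assms(1) x(2,3) Z] push_one[OF x(3) Z] x(4) by simp
qed

lemma pull_fac_trivial:
  assumes "\<delta> \<in> carrier (Ext B C Y)" "Y \<in> V" "fac h" and h: "h \<in> Hom B Q' C"
  shows "pull B Y h \<delta> = \<one>\<^bsub>Ext B Q' Y\<^esub>"
proof -
  obtain X a b where x: "X \<in> T \<inter> U" "a \<in> Hom B Q' X" "b \<in> Hom B X C" "h = b \<cdot> a"
    by (rule facE[OF assms(3) h])
  have Y: "Y \<in> Obj B" using assms(2) UV_facts(2) by blast
  have "pull B Y b \<delta> = \<one>\<^bsub>Ext B X Y\<^esub>"
    using pull_closed[OF assms(1) x(3) Y] UV_facts(5)[OF _ assms(2), of X] x(1) by simp
  then show ?thesis
    using pull_comp[OF assms(1) x(3,2) Y] pull_one[OF x(2) Y] x(4) by simp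
qed

lemma extends_to_T:
  assumes tri: "etriangle B A x M y Z \<delta>" and "Z \<in> S" "X \<in> T" "g \<in> Hom B A X"
  shows "\<exists>l \<in> Hom B M X. l \<cdot> x = g"
proof (rule extend_along_inflation[OF tri assms(4)])
  note t = etriangle_Hom[OF tri]
  show "push B Z g \<delta> = \<one>\<^bsub>Ext B Z X\<^esub>"
    using push_closed[OF t(3) assms(4) t(6)] ST_facts(5)[OF assms(2,3)] by simp
qed

lemma lifts_from_U:
  assumes tri: "etriangle B Y x M y C \<delta>" and "Y \<in> V" "X \<in> U" "g \<in> Hom B X C"
  shows "\<exists>l \<in> Hom B X M. y \<cdot> l = g"
proof (rule lift_along_deflation[OF tri assms(4)])
  note t = etriangle_Hom[OF tri]
  show "pull B Y g \<delta> = \<one>\<^bsub>Ext B X Y\<^esub>"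
    using pull_closed[OF t(3) assms(4) t(4)] UV_facts(5)[OF assms(3,2)] by simp
qed

text \<open>Lift along \<open>Y \<rightarrow> W \<rightarrow> Q'\<close>, using \<open>\<E>(U, V) = 0\<close>.\<close>

lemma fac_from_U:
  assumes "X \<in> U" "Q' \<in> Bplus" "g \<in> Hom B X Q'"
  shows "fac g"
proof -
  obtain Y W x y \<delta> where t: "Y \<in> V" "W \<in> T" "W \<in> U" "etriangle B Y x W y Q' \<delta>"
    by (rule BplusE[OF assms(2)])
  obtain l where l: "l \<in> Hom B X W" "y \<cdot> l = g" using lifts_from_U[OF t(4,1) assms(1,3)] by blast
  have "fac (y \<cdot> l)" by (rule facI[OF _ l(1) etriangle_Hom(2)[OF t(4)]]) (use t in simp)
  then show ?thesis using l(2) by simp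
qed

lemma fac_to_T:
  assumes "X \<in> T" "Q' \<in> Bminus" "g \<in> Hom B Q' X"
  shows "fac g"
proof -
  obtain W Z x y \<delta> where t: "W \<in> T" "W \<in> U" "Z \<in> S" "etriangle B Q' x W y Z \<delta>"
    by (rule BminusE[OF assms(2)])
  obtain l where l: "l \<in> Hom B W X" "l \<cdot> x = g" using extends_to_T[OF t(4,3) assms(1,3)] by blast
  have "fac (l \<cdot> x)" by (rule facI[OF _ etriangle_Hom(1)[OF t(4)] l(1)]) (use t in simp)
  then show ?thesis using l(2) by simp
qed

text \<open>If \<open>g \<cdot> p\<close> factors through \<open>X \<in> W\<close>, its first half extends along \<open>p\<close>, and the extension
  differs from \<open>g\<close> by an arrow that vanishes on \<open>p\<close>. That arrow factors through \<open>Z \<in> S \<subseteq> U\<close>, and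
  arrows from \<open>U\<close> to \<open>Q' \<in> B\<^sup>+\<close> factor through \<open>W\<close>.\<close>

lemma S_inflation_epi:
  assumes tri: "etriangle B A p C q Z \<delta>" and "Z \<in> S" "Q' \<in> Bplus"
    and g: "g \<in> Hom B C Q'" "fac (g \<cdot> p)"
  shows "fac g"
proof -
  note t = etriangle_Hom[OF tri]
  obtain X a b where x: "X \<in> T \<inter> U" "a \<in> Hom B A X" "b \<in> Hom B X Q'" "g \<cdot> p = b \<cdot> a"
    by (rule facE[OF g(2) Compose_in[OF t(1) g(1)]])
  obtain l where l: "l \<in> Hom B C X" "l \<cdot> p = a"
    using extends_to_T[OF tri assms(2) _ x(2)] x(1) by blast
  have bl: "b \<cdot> l \<in> Hom B C Q'" by (rule Compose_in[OF l(1) x(3)])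
  have d: "Sub g (b \<cdot> l) \<in> Hom B C Q'" using g(1) bl by (simp add: Hom_iff)
  have "(b \<cdot> l) \<cdot> p = g \<cdot> p" using Compose_assoc[OF t(1) l(1) x(3)] l(2) x(4) by simp
  moreover have "Sub g (b \<cdot> l) \<cdot> p = Sub (g \<cdot> p) ((b \<cdot> l) \<cdot> p)"
    by (rule Sub_comp) (use g(1) bl t(1) in \<open>simp_all add: Hom_iff\<close>)
  ultimately have "Sub g (b \<cdot> l) \<cdot> p = Zero B A Q'"
    using Compose_in[OF t(1) g(1)] by (simp add: Hom_iff)
  then obtain s where s: "s \<in> Hom B Z Q'" "s \<cdot> q = Sub g (b \<cdot> l)"
    using factor_through_deflation[OF tri d] by blast
  have "fac s" using fac_from_U[OF _ assms(3) s(1)] assms(2) S_sub_U by blast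
  then have "fac (s \<cdot> q)" by (rule fac_comp_right[OF _ s(1) t(2)])
  then have "fac (Sub g (b \<cdot> l))" using s(2) by simp
  then show ?thesis
    using fac_iff_of_Sub[OF _ g(1) bl] facI[OF x(1) l(1) x(3)] by blast
qed

text \<open>Dual to the preceding argument, with \<open>V \<subseteq> T\<close> in place of \<open>S \<subseteq> U\<close>.\<close>

lemma V_deflation_mono:
  assumes tri: "etriangle B Y v K k A \<delta>" and "Y \<in> V" "Q' \<in> Bminus"
    and g: "g \<in> Hom B Q' K" "fac (k \<cdot> g)"
  shows "fac g"
proof -
  note t = etriangle_Hom[OF tri]
  obtain X a b where x: "X \<in> T \<inter> U" "a \<in> Hom B Q' X" "b \<in> Hom B X A" "k \<cdot> g = b \<cdot> a"
    by (rule facE[OF g(2) Compose_in[OF g(1) t(2)]])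
  obtain l where l: "l \<in> Hom B X K" "k \<cdot> l = b"
    using lifts_from_U[OF tri assms(2) _ x(3)] x(1) by blast
  have la: "l \<cdot> a \<in> Hom B Q' K" by (rule Compose_in[OF x(2) l(1)])
  have d: "Sub g (l \<cdot> a) \<in> Hom B Q' K" using g(1) la by (simp add: Hom_iff)
  have "k \<cdot> (l \<cdot> a) = k \<cdot> g" using Compose_assoc[OF x(2) l(1) t(2)] l(2) x(4) by simp
  moreover have "k \<cdot> Sub g (l \<cdot> a) = Sub (k \<cdot> g) (k \<cdot> (l \<cdot> a))"
    by (rule comp_Sub) (use g(1) la t(2) in \<open>simp_all add: Hom_iff\<close>)
  ultimately have "k \<cdot> Sub g (l \<cdot> a) = Zero B Q' A"
    using Compose_in[OF g(1) t(2)] by (simp add: Hom_iff)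
  then obtain s where s: "s \<in> Hom B Q' Y" "v \<cdot> s = Sub g (l \<cdot> a)"
    using factor_through_inflation[OF tri d] by blast
  have "fac s" using fac_to_T[OF _ assms(3) s(1)] assms(2) V_sub_T by blast
  then have "fac (v \<cdot> s)" by (rule fac_comp_left[OF _ s(1) t(1)])
  then have "fac (Sub g (l \<cdot> a))" using s(2) by simp
  then show ?thesis
    using fac_iff_of_Sub[OF _ g(1) la] facI[OF x(1,2) l(1)] by blast
qed

section \<open>Extensions, reflections and pullbacks in the heart\<close>

text \<open>Take the \<open>(S, T)\<close>-approximation \<open>C \<rightarrow> T\<^sub>1 \<rightarrow> S\<^sub>1\<close>. Composing inflations gives \<open>A \<rightarrow> T\<^sub>1 \<rightarrow> E\<close> with \<open>E \<in> S\<close>, and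
  the point is that \<open>T\<^sub>1 \<in> U\<close>: an extension of \<open>T\<^sub>1\<close> by \<open>V\<close> vanishes on \<open>A\<close>, because \<open>A \<rightarrow> T\<^sub>1\<close> factors
  through \<open>W\<close>, and so it comes from \<open>\<E>(E, V) = 0\<close>.\<close>

lemma Bminus_S_extension:
  assumes tri: "etriangle B A p C q Z \<delta>" and "Z \<in> S" "A \<in> Bminus"
  shows "C \<in> Bminus"
proof -
  note t = etriangle_Hom[OF tri]
  obtain T1 S1 x y \<epsilon> where 1: "T1 \<in> T" "S1 \<in> S" "etriangle B C x T1 y S1 \<epsilon>"
    using ST_facts(7)[OF t(5)] by blast
  note t1 = etriangle_Hom[OF 1(3)]
  obtain E d e h' \<delta>'' where E: "etriangle B A (x \<cdot> p) T1 h' E \<delta>''"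
    "etriangle B Z d E e S1 (push B S1 q \<epsilon>)"
    using ET4[OF tri 1(3)] by blast
  have ES: "E \<in> S" by (rule cotorsion_left_extension_closed[OF ST E(2) assms(2) 1(2)])
  have fac: "fac (x \<cdot> p)" by (rule fac_to_T[OF 1(1) assms(3) Compose_in[OF t(1) t1(1)]])
  have "T1 \<in> U"
  proof (rule cotorsion_left_memI[OF UV t1(5)])
    fix Y \<eta> assume Y: "Y \<in> V" and \<eta>: "\<eta> \<in> carrier (Ext B T1 Y)"
    have YO: "Y \<in> Obj B" using Y UV_facts(2) by blast
    have "pull B Y (x \<cdot> p) \<eta> = \<one>\<^bsub>Ext B A Y\<^esub>"
      by (rule pull_fac_trivial[OF \<eta> Y fac Compose_in[OF t(1) t1(1)]])
    then obtain \<theta> where \<theta>: "\<theta> \<in> carrier (Ext B E Y)" "\<eta> = pull B Y h' \<theta>"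
      using Ext_exact_middle_left[OF E(1) YO \<eta>] by blast
    then show "\<eta> = \<one>\<^bsub>Ext B T1 Y\<^esub>"
      using UV_facts(5)[of E Y] ES S_sub_U Y pull_one[OF etriangle_Hom(2)[OF E(1)] YO] by auto
  qed
  then show ?thesis using BminusI[OF 1(3) 1(2) 1(1)] by blast
qed

text \<open>Dual to the preceding argument: here the \<open>(U, V)\<close>-approximation of \<open>K\<close> turns out to lie in \<open>T\<close>.\<close>

lemma Bplus_V_extension:
  assumes tri: "etriangle B Y v K k A \<delta>" and "Y \<in> V" "A \<in> Bplus"
  shows "K \<in> Bplus"
proof -
  note t = etriangle_Hom[OF tri]
  obtain V1 U1 x y \<epsilon> where 1: "V1 \<in> V" "U1 \<in> U" "etriangle B V1 x U1 y K \<epsilon>"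
    using UV_facts(6)[OF t(5)] by blast
  note t1 = etriangle_Hom[OF 1(3)]
  obtain E d e h' \<delta>'' where E: "etriangle B E h' U1 (k \<cdot> y) A \<delta>''"
    "etriangle B V1 e E d Y (pull B V1 v \<epsilon>)"
    using ET4_op[OF tri 1(3)] by blast
  have EV: "E \<in> V" by (rule cotorsion_right_extension_closed[OF UV E(2) 1(1) assms(2)])
  have fac: "fac (k \<cdot> y)" by (rule fac_from_U[OF 1(2) assms(3) Compose_in[OF t1(2) t(2)]])
  have "U1 \<in> T"
  proof (rule cotorsion_right_memI[OF ST t1(5)])
    fix X \<eta> assume X: "X \<in> S" and \<eta>: "\<eta> \<in> carrier (Ext B X U1)"
    have XO: "X \<in> Obj B" using X ST_facts(1) by blast
    have "push B X (k \<cdot> y) \<eta> = \<one>\<^bsub>Ext B X A\<^esub>"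
      by (rule push_fac_trivial[OF \<eta> X fac Compose_in[OF t1(2) t(2)]])
    then obtain \<theta> where \<theta>: "\<theta> \<in> carrier (Ext B X E)" "\<eta> = push B X h' \<theta>"
      using Ext_exact_middle_right[OF E(1) XO \<eta>] by blast
    then show "\<eta> = \<one>\<^bsub>Ext B X U1\<^esub>"
      using UV_facts(5)[of X E] EV S_sub_U X push_one[OF etriangle_Hom(1)[OF E(1)] XO] by auto
  qed
  then show ?thesis using BplusI[OF 1(3) 1(1)] 1(2) by blast
qed

lemma U_in_T_extension:
  assumes "X \<in> U"
  obtains W Z x y \<delta> where "W \<in> T" "W \<in> U" "Z \<in> S" "etriangle B X x W y Z \<delta>"
proof -
  have "X \<in> Obj B" using assms UV_facts(1) by blast
  then obtain W Z x y \<delta> where 1: "W \<in> T" "Z \<in> S" "etriangle B X x W y Z \<delta>"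
    using ST_facts(7) by blast
  have "W \<in> U"
    using cotorsion_left_extension_closed[OF UV 1(3) assms] 1(2) S_sub_U by blast
  then show thesis using that 1 by blast
qed

text \<open>Enlarging the middle term of \<open>Y \<rightarrow> U\<^sub>1 \<rightarrow> C\<^sub>0\<close> to an object of \<open>W\<close> replaces \<open>C\<^sub>0\<close> by an object of \<open>B\<^sup>+\<close>. The
  class \<open>\<delta>C\<close> of the enlarged extriangle is kept, because kernels of arrows into \<open>C\<close> are detected by
  it.\<close>

lemma reflection_into_heart:
  assumes C0: "C0 \<in> Bminus" and tri: "etriangle B Y v U1 \<pi> C0 \<delta>" and Y: "Y \<in> V" and U1: "U1 \<in> U"
  obtains C Z \<rho> e \<epsilon> \<delta>C where "C \<in> H" "Z \<in> S" "etriangle B C0 \<rho> C e Z \<epsilon>"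
    "\<delta>C \<in> carrier (Ext B C Y)" "pull B Y \<rho> \<delta>C = \<delta>"
    "\<forall>Q' \<in> Bplus. \<forall>g \<in> Hom B C0 Q'. \<exists>t \<in> Hom B C Q'. t \<cdot> \<rho> = g"
proof -
  note t = etriangle_Hom[OF tri]
  obtain W Z x y \<epsilon> where W: "W \<in> T" "W \<in> U" "Z \<in> S" "etriangle B U1 x W y Z \<epsilon>"
    by (rule U_in_T_extension[OF U1])
  note w = etriangle_Hom[OF W(4)]
  obtain C \<rho> e h' \<delta>C where E: "etriangle B Y (x \<cdot> v) W h' C \<delta>C"
    "etriangle B C0 \<rho> C e Z (push B Z \<pi> \<epsilon>)" "pull B Y \<rho> \<delta>C = \<delta>"
    using ET4[OF tri W(4)] by blast
  have C: "C \<in> H"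
    unfolding H_iff using BplusI[OF E(1) Y W(1,2)] Bminus_S_extension[OF E(2) W(3) C0] by blast
  have ext: "\<exists>t \<in> Hom B C Q'. t \<cdot> \<rho> = g" if Q': "Q' \<in> Bplus" and g: "g \<in> Hom B C0 Q'" for Q' g
  proof (rule extend_along_inflation[OF E(2) g])
    have gp: "g \<cdot> \<pi> \<in> Hom B U1 Q'" by (rule Compose_in[OF t(2) g])
    have "push B Z (g \<cdot> \<pi>) \<epsilon> = \<one>\<^bsub>Ext B Z Q'\<^esub>"
      by (rule push_fac_trivial[OF w(3) W(3) fac_from_U[OF U1 Q' gp] gp])
    then show "push B Z g (push B Z \<pi> \<epsilon>) = \<one>\<^bsub>Ext B Z Q'\<^esub>"
      using push_comp[OF w(3) t(2) g w(6)] by simp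
  qed
  show thesis
    by (rule that[OF C W(3) E(2) etriangle_Hom(3)[OF E(1)] E(3)]) (use ext in blast)
qed

text \<open>The object \<open>K\<close> is a weak pullback of \<open>c\<close> and \<open>\<pi>\<close>: (ET4)\<open>\<^sup>o\<^sup>p\<close> provides extriangles along both projections
  \<open>k\<close> and \<open>u\<close>. The first puts \<open>K\<close> into \<open>B\<^sup>+\<close>; the second, continued from \<open>U\<^sub>1\<close> to an object of \<open>W\<close>, puts it
  into \<open>B\<^sup>-\<close>.\<close>

lemma pullback_in_heart:
  assumes tri: "etriangle B A c C0 s Z \<epsilon>" and Z: "Z \<in> S" and A: "A \<in> Bplus"
    and tri': "etriangle B Y v U1 \<pi> C0 \<delta>" and Y: "Y \<in> V" and U1: "U1 \<in> U"
  obtains K v' k u q \<theta> where "K \<in> H" "etriangle B Y v' K k A (pull B Y c \<delta>)"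
    "etriangle B K u U1 q Z \<theta>" "\<pi> \<cdot> u = c \<cdot> k" "push B Z k \<theta> = \<epsilon>"
proof -
  obtain K k v' u \<theta> where E: "etriangle B K u U1 (s \<cdot> \<pi>) Z \<theta>" "\<pi> \<cdot> u = c \<cdot> k"
    "etriangle B Y v' K k A (pull B Y c \<delta>)" "push B Z k \<theta> = \<epsilon>"
    using ET4_op[OF tri tri'] by blast
  obtain W Z' x y \<epsilon>' where W: "W \<in> T" "W \<in> U" "Z' \<in> S" "etriangle B U1 x W y Z' \<epsilon>'"
    by (rule U_in_T_extension[OF U1])
  obtain E' d e h' \<delta>'' where E': "etriangle B K (x \<cdot> u) W h' E' \<delta>''"
    "etriangle B Z d E' e Z' (push B Z' (s \<cdot> \<pi>) \<epsilon>')"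
    using ET4[OF E(1) W(4)] by blast
  have "E' \<in> S" by (rule cotorsion_left_extension_closed[OF ST E'(2) Z W(3)])
  then have "K \<in> H"
    unfolding H_iff using BminusI[OF E'(1) _ W(1,2)] Bplus_V_extension[OF E(3) Y A] by blast
  then show thesis using that E by blast
qed

text \<open>For \<open>f\<close> in the heart, \<open>c\<close> represents its cokernel, \<open>k\<close> the kernel of \<open>c\<close>, and \<open>r\<close> the comparison
  between \<open>f\<close> and its image \<open>k\<close>. That \<open>r\<close> is epi modulo \<open>W\<close> rests on using one and the same extriangle
  \<open>Y \<rightarrow> U\<^sub>1 \<rightarrow> C\<^sub>0\<close> both for the reflection of \<open>C\<^sub>0\<close> into \<open>H\<close> and for the construction of \<open>K\<close>.\<close>

lemma heart_factorization:
  assumes f: "f \<in> Hom B A A'" and A: "A \<in> H" and A': "A' \<in> H"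
  obtains C Z c q \<delta> K k r where
    "C \<in> H" "Z \<in> S" "etriangle B A' c C q Z \<delta>" "fac (c \<cdot> f)"
    "\<forall>Q' \<in> H. \<forall>g \<in> Hom B A' Q'. fac (g \<cdot> f) \<longrightarrow> (\<exists>t \<in> Hom B C Q'. t \<cdot> c = g)"
    "K \<in> H" "k \<in> Hom B K A'" "r \<in> Hom B A K" "k \<cdot> r = f" "fac (c \<cdot> k)"
    "\<forall>Q' \<in> H. \<forall>g \<in> Hom B Q' A'. fac (c \<cdot> g) \<longrightarrow> (\<exists>t \<in> Hom B Q' K. k \<cdot> t = g)"
    "\<forall>Q' \<in> H. \<forall>g \<in> Hom B Q' K. fac (k \<cdot> g) \<longrightarrow> fac g"
    "\<forall>Q' \<in> H. \<forall>g \<in> Hom B K Q'. fac (g \<cdot> r) \<longrightarrow> fac g"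
proof -
  have Am: "A \<in> Bminus" and Ap': "A' \<in> Bplus" and Am': "A' \<in> Bminus"
    using A A' H_iff by blast+
  obtain W S0 w s \<delta>0 where W: "W \<in> T" "W \<in> U" "S0 \<in> S" "etriangle B A w W s S0 \<delta>0"
    by (rule BminusE[OF Am])
  note tw = etriangle_Hom[OF W(4)]
  \<comment> \<open>Pushout of \<open>A \<rightarrow> W \<rightarrow> S\<^sub>0\<close> along \<open>f\<close>.\<close>
  define \<epsilon> where "\<epsilon> = push B S0 f \<delta>0"
  have \<epsilon>: "\<epsilon> \<in> carrier (Ext B S0 A')" unfolding \<epsilon>_def by (rule push_closed[OF tw(3) f tw(6)])
  have A'O: "A' \<in> Obj B" by (rule D_ObjD[OF A'])
  obtain c0 C0 s0 where c0: "etriangle B A' c0 C0 s0 S0 \<epsilon>"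
    using ex_etriangle[OF tw(6) A'O \<epsilon>] by blast
  note t0 = etriangle_Hom[OF c0]
  have C0: "C0 \<in> Bminus" by (rule Bminus_S_extension[OF c0 W(3) Am'])
  obtain m where m: "m \<in> Hom B W C0" "m \<cdot> w = c0 \<cdot> f"
    using Real_morphism[OF W(4) c0 f Ident_in[OF tw(6)]] pull_Ident[OF \<epsilon> tw(6) A'O] \<epsilon>_def by auto
  have c0f: "c0 \<cdot> f \<in> Hom B A C0" by (rule Compose_in[OF f t0(1)])
  have fac_c0f: "fac (c0 \<cdot> f)" using facI[OF _ tw(1) m(1)] W(1,2) m(2) by simp
  obtain Y U1 v \<pi> \<delta>' where U1: "Y \<in> V" "U1 \<in> U" "etriangle B Y v U1 \<pi> C0 \<delta>'"
    using UV_facts(6)[OF t0(5)] by blast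
  note tu = etriangle_Hom[OF U1(3)]
  obtain C \<rho> Z e \<epsilon>\<rho> \<delta>C where C: "C \<in> H" "Z \<in> S" "etriangle B C0 \<rho> C e Z \<epsilon>\<rho>"
    "\<delta>C \<in> carrier (Ext B C Y)" "pull B Y \<rho> \<delta>C = \<delta>'"
    and \<rho>ext: "\<forall>Q' \<in> Bplus. \<forall>g \<in> Hom B C0 Q'. \<exists>t \<in> Hom B C Q'. t \<cdot> \<rho> = g"
    by (rule reflection_into_heart[OF C0 U1(3,1,2)])
  note t\<rho> = etriangle_Hom[OF C(3)]
  obtain K k u v' q' \<theta> where K: "K \<in> H" "etriangle B Y v' K k A' (pull B Y c0 \<delta>')"
    "etriangle B K u U1 q' S0 \<theta>" "\<pi> \<cdot> u = c0 \<cdot> k" "push B S0 k \<theta> = \<epsilon>"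
    by (rule pullback_in_heart[OF c0 W(3) Ap' U1(3,1,2)])
  note tk = etriangle_Hom[OF K(2)] and tku = etriangle_Hom[OF K(3)]
  obtain E h q d e' where E: "etriangle B A' (\<rho> \<cdot> c0) C q E h"
    "etriangle B S0 d E e' Z (push B Z s0 \<epsilon>\<rho>)"
    using ET4[OF c0 C(3)] by blast
  have ES: "E \<in> S" by (rule cotorsion_left_extension_closed[OF ST E(2) W(3) C(2)])
  have c: "\<rho> \<cdot> c0 \<in> Hom B A' C" by (rule Compose_in[OF t0(1) t\<rho>(1)])
  have cf: "fac ((\<rho> \<cdot> c0) \<cdot> f)"
    using fac_comp_left[OF fac_c0f c0f t\<rho>(1)] Compose_assoc[OF f t0(1) t\<rho>(1)] by simp
  have coker: "\<exists>t \<in> Hom B C Q'. t \<cdot> (\<rho> \<cdot> c0) = g"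
    if Q': "Q' \<in> H" and g: "g \<in> Hom B A' Q'" and gf: "fac (g \<cdot> f)" for Q' g
  proof -
    have "push B S0 g \<epsilon> = \<one>\<^bsub>Ext B S0 Q'\<^esub>"
      unfolding \<epsilon>_def push_comp[OF tw(3) f g tw(6)]
      by (rule push_fac_trivial[OF tw(3) W(3) gf Compose_in[OF f g]])
    then obtain g0 where g0: "g0 \<in> Hom B C0 Q'" "g0 \<cdot> c0 = g"
      using extend_along_inflation[OF c0 g] by blast
    obtain t where t: "t \<in> Hom B C Q'" "t \<cdot> \<rho> = g0" using \<rho>ext g0(1) Q' H_iff by blast
    have "t \<cdot> (\<rho> \<cdot> c0) = g" using Compose_assoc[OF t0(1) t\<rho>(1) t(1)] t(2) g0(2) by simp
    then show ?thesis using t(1) by blast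
  qed
  have \<rho>\<pi>: "\<rho> \<cdot> \<pi> \<in> Hom B U1 C" by (rule Compose_in[OF tu(2) t\<rho>(1)])
  have "fac (\<rho> \<cdot> \<pi>)" using fac_from_U[OF U1(2) _ \<rho>\<pi>] C(1) H_iff by blast
  then have "fac ((\<rho> \<cdot> \<pi>) \<cdot> u)" by (rule fac_comp_right[OF _ \<rho>\<pi> tku(1)])
  moreover have "(\<rho> \<cdot> \<pi>) \<cdot> u = (\<rho> \<cdot> c0) \<cdot> k"
    using Compose_assoc[OF tku(1) tu(2) t\<rho>(1)] Compose_assoc[OF tk(2) t0(1) t\<rho>(1)] K(4) by simp
  ultimately have ck: "fac ((\<rho> \<cdot> c0) \<cdot> k)" by simp
  have ker: "\<exists>t \<in> Hom B Q' K. k \<cdot> t = g"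
    if g: "g \<in> Hom B Q' A'" and cg: "fac ((\<rho> \<cdot> c0) \<cdot> g)" for Q' g
  proof (rule lift_along_deflation[OF K(2) g])
    have c0g: "c0 \<cdot> g \<in> Hom B Q' C0" by (rule Compose_in[OF g t0(1)])
    have "pull B Y g (pull B Y c0 \<delta>') = pull B Y (c0 \<cdot> g) (pull B Y \<rho> \<delta>C)"
      using pull_comp[OF tu(3) t0(1) g tu(4)] C(5) by simp
    also have "\<dots> = pull B Y (\<rho> \<cdot> (c0 \<cdot> g)) \<delta>C" by (rule pull_comp[OF C(4) t\<rho>(1) c0g tu(4)])
    also have "\<dots> = \<one>\<^bsub>Ext B Q' Y\<^esub>"
      using pull_fac_trivial[OF C(4) U1(1) cg Compose_in[OF g c]]
        Compose_assoc[OF g t0(1) t\<rho>(1)] by simp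
    finally show "pull B Y g (pull B Y c0 \<delta>') = \<one>\<^bsub>Ext B Q' Y\<^esub>" .
  qed
  have mono: "fac g" if "Q' \<in> H" "g \<in> Hom B Q' K" "fac (k \<cdot> g)" for Q' g
    using V_deflation_mono[OF K(2) U1(1) _ that(2,3)] that(1) H_iff by blast
  obtain r where r: "r \<in> Hom B A K" "k \<cdot> r = f" using ker[OF f cf] by blast
  \<comment> \<open>The class of \<open>K \<rightarrow> U\<^sub>1 \<rightarrow> S\<^sub>0\<close> is the pushout of \<open>\<delta>0\<close> along \<open>r\<close>: both become \<open>\<epsilon>\<close> after pushing along \<open>k\<close>,
    which is injective on extensions of \<open>S\<^sub>0\<close> because \<open>\<E>(S\<^sub>0, Y) = 0\<close>.\<close>
  have "push B S0 k (push B S0 r \<delta>0) = push B S0 k \<theta>"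
    using push_comp[OF tw(3) r(1) tk(2) tw(6)] r(2) K(5) \<epsilon>_def by simp
  moreover have "carrier (Ext B S0 Y) = {\<one>\<^bsub>Ext B S0 Y\<^esub>}"
    using UV_facts(5) W(3) U1(1) S_sub_U by blast
  ultimately have r\<delta>: "push B S0 r \<delta>0 = \<theta>"
    using push_deflation_inj[OF K(2) tw(6) _ push_closed[OF tw(3) r(1) tw(6)] tku(3)] by blast
  have epi: "fac g" if Q': "Q' \<in> H" and g: "g \<in> Hom B K Q'" and gr: "fac (g \<cdot> r)" for Q' g
  proof -
    \<comment> \<open>So \<open>g\<close> extends to \<open>U\<^sub>1\<close>, from where every arrow into \<open>Q'\<close> factors through \<open>T \<inter> U\<close>.\<close>
    have "push B S0 g \<theta> = push B S0 (g \<cdot> r) \<delta>0"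
      using push_comp[OF tw(3) r(1) g tw(6)] r\<delta> by simp
    also have "\<dots> = \<one>\<^bsub>Ext B S0 Q'\<^esub>"
      by (rule push_fac_trivial[OF tw(3) W(3) gr Compose_in[OF r(1) g]])
    finally obtain t where t: "t \<in> Hom B U1 Q'" "t \<cdot> u = g"
      using extend_along_inflation[OF K(3) g] by blast
    have "fac t" using fac_from_U[OF U1(2) _ t(1)] Q' H_iff by blast
    then have "fac (t \<cdot> u)" by (rule fac_comp_right[OF _ t(1) tku(1)])
    then show ?thesis using t(2) by simp
  qed
  show thesis
    by (rule that[OF C(1) ES E(1) cf _ K(1) tk(2) r ck])
      (use coker ker mono epi in blast)+
qed

text \<open>Here the pullback is taken along an extriangle \<open>V\<^sub>1 \<rightarrow> W \<rightarrow> Y\<close> with \<open>W \<in> T \<inter> U\<close>, which exists as \<open>Y \<in> B\<^sup>+\<close>.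
  The class \<open>\<delta>\<close> is then the pushout of a class on \<open>K\<close> along \<open>k\<close>, whence \<open>p\<close> is a cokernel of \<open>k\<close>.\<close>

lemma S_inflation_kernel:
  assumes tri: "etriangle B X p Y q Z \<delta>" and X: "X \<in> H" and Y: "Y \<in> H" and Z: "Z \<in> S"
  obtains K k where "K \<in> H" "k \<in> Hom B K X" "fac (p \<cdot> k)"
    "\<forall>Q' \<in> H. \<forall>g \<in> Hom B Q' X. fac (p \<cdot> g) \<longrightarrow> (\<exists>t \<in> Hom B Q' K. k \<cdot> t = g)"
    "\<forall>Q' \<in> H. \<forall>g \<in> Hom B Q' K. fac (k \<cdot> g) \<longrightarrow> fac g"
    "\<forall>Q' \<in> H. \<forall>g \<in> Hom B X Q'. fac (g \<cdot> k) \<longrightarrow> (\<exists>t \<in> Hom B Y Q'. t \<cdot> p = g)"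
proof -
  note t = etriangle_Hom[OF tri]
  have Xp: "X \<in> Bplus" and Yp: "Y \<in> Bplus" using X Y H_iff by blast+
  obtain V1 W v \<pi> \<delta>' where W: "V1 \<in> V" "W \<in> T" "W \<in> U" "etriangle B V1 v W \<pi> Y \<delta>'"
    by (rule BplusE[OF Yp])
  note tw = etriangle_Hom[OF W(4)]
  obtain K k u v' q' \<theta> where K: "K \<in> H" "etriangle B V1 v' K k X (pull B V1 p \<delta>')"
    "etriangle B K u W q' Z \<theta>" "\<pi> \<cdot> u = p \<cdot> k" "push B Z k \<theta> = \<delta>"
    by (rule pullback_in_heart[OF tri Z Xp W(4,1,3)])
  note tk = etriangle_Hom[OF K(2)] and tku = etriangle_Hom[OF K(3)]
  have pk: "fac (p \<cdot> k)" using facI[OF _ tku(1) tw(2)] W(2,3) K(4) by simp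
  have ker: "\<exists>t \<in> Hom B Q' K. k \<cdot> t = g"
    if g: "g \<in> Hom B Q' X" and pg: "fac (p \<cdot> g)" for Q' g
  proof (rule lift_along_deflation[OF K(2) g])
    show "pull B V1 g (pull B V1 p \<delta>') = \<one>\<^bsub>Ext B Q' V1\<^esub>"
      unfolding pull_comp[OF tw(3) t(1) g tw(4)]
      by (rule pull_fac_trivial[OF tw(3) W(1) pg Compose_in[OF g t(1)]])
  qed
  have mono: "fac g" if "Q' \<in> H" "g \<in> Hom B Q' K" "fac (k \<cdot> g)" for Q' g
    using V_deflation_mono[OF K(2) W(1) _ that(2,3)] that(1) H_iff by blast
  have coker: "\<exists>t \<in> Hom B Y Q'. t \<cdot> p = g"
    if g: "g \<in> Hom B X Q'" and gk: "fac (g \<cdot> k)" for Q' g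
  proof (rule extend_along_inflation[OF tri g])
    show "push B Z g \<delta> = \<one>\<^bsub>Ext B Z Q'\<^esub>"
      unfolding K(5)[symmetric] push_comp[OF tku(3) tk(2) g t(6)]
      by (rule push_fac_trivial[OF tku(3) Z gk Compose_in[OF tk(2) g]])
  qed
  show thesis by (rule that[OF K(1) tk(2) pk]) (use ker mono coker in blast)+
qed

end

section \<open>Kernels and cokernels in the heart\<close>

context twin_cotorsion
begin

lemma S_inflation_is_epi:
  assumes tri: "etriangle B X p Y q Z \<delta>" and "X \<in> H" "Y \<in> H" "Z \<in> S"
  shows "is_epi Q (cls p)"
  using S_inflation_epi[OF tri assms(4)] H_iff
  by (intro is_epi_cls[OF etriangle_Hom(1)[OF tri] assms(2,3)]) blast

lemma S_inflation_kernel_cokernel: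
  assumes tri: "etriangle B X p Y q Z \<delta>" and X: "X \<in> H" and Y: "Y \<in> H" and Z: "Z \<in> S"
  shows "\<exists>K. \<exists>k \<in> Hom Q K X. is_kernel Q (cls p) k \<and> is_cokernel Q k (cls p)"
proof -
  note t = etriangle_Hom[OF tri]
  obtain K k where K: "K \<in> H" "k \<in> Hom B K X" "fac (p \<cdot> k)"
    "\<forall>Q' \<in> H. \<forall>g \<in> Hom B Q' X. fac (p \<cdot> g) \<longrightarrow> (\<exists>t \<in> Hom B Q' K. k \<cdot> t = g)"
    "\<forall>Q' \<in> H. \<forall>g \<in> Hom B Q' K. fac (k \<cdot> g) \<longrightarrow> fac g"
    "\<forall>Q' \<in> H. \<forall>g \<in> Hom B X Q'. fac (g \<cdot> k) \<longrightarrow> (\<exists>t \<in> Hom B Y Q'. t \<cdot> p = g)"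
    by (rule S_inflation_kernel[OF assms])
  have "is_mono Q (cls k)" by (rule is_mono_cls[OF K(2,1) X]) (use K(5) in blast)
  then have ker: "is_kernel Q (cls p) (cls k)"
    by (rule is_kernel_cls[OF t(1) K(2) X Y K(1,3)]) (use K(4) in blast)
  have "is_cokernel Q (cls k) (cls p)"
    by (rule is_cokernel_cls[OF K(2) t(1) K(1) X Y K(3) S_inflation_is_epi[OF assms]])
      (use K(6) in blast)
  then show ?thesis using ker cls_Hom[OF K(2,1) X] by blast
qed

lemma heart_morphism_factorization:
  assumes F: "F \<in> Hom Q X Y"
  obtains C Z c q \<delta> k K r where
    "C \<in> H" "Z \<in> S" "etriangle B Y c C q Z \<delta>" "is_cokernel Q F (cls c)"
    "k \<in> Hom Q K Y" "r \<in> Hom Q X K" "k \<cdot>\<^bsub>Q\<^esub> r = F" "is_kernel Q (cls c) k" "is_epi Q r"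
proof -
  obtain f where f: "f \<in> Hom B X Y" "X \<in> H" "Y \<in> H" "F = cls f" using F unfolding Hom_Q by blast
  obtain C Z c q \<delta> K k r where C: "C \<in> H" "Z \<in> S" "etriangle B Y c C q Z \<delta>" "fac (c \<cdot> f)"
    and coker: "\<forall>Q' \<in> H. \<forall>g \<in> Hom B Y Q'. fac (g \<cdot> f) \<longrightarrow> (\<exists>t \<in> Hom B C Q'. t \<cdot> c = g)"
    and K: "K \<in> H" "k \<in> Hom B K Y" "r \<in> Hom B X K" "k \<cdot> r = f" "fac (c \<cdot> k)"
    and ker: "\<forall>Q' \<in> H. \<forall>g \<in> Hom B Q' Y. fac (c \<cdot> g) \<longrightarrow> (\<exists>t \<in> Hom B Q' K. k \<cdot> t = g)"
    and mono: "\<forall>Q' \<in> H. \<forall>g \<in> Hom B Q' K. fac (k \<cdot> g) \<longrightarrow> fac g"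
    and epi: "\<forall>Q' \<in> H. \<forall>g \<in> Hom B K Q'. fac (g \<cdot> r) \<longrightarrow> fac g"
    by (rule heart_factorization[OF f(1-3)])
  note t = etriangle_Hom[OF C(3)]
  have 1: "is_cokernel Q F (cls c)" unfolding f(4)
    by (rule is_cokernel_cls[OF f(1) t(1) f(2,3) C(1,4) S_inflation_is_epi[OF C(3) f(3) C(1,2)]])
      (use coker in blast)
  have "is_mono Q (cls k)" by (rule is_mono_cls[OF K(2,1) f(3)]) (use mono in blast)
  then have 2: "is_kernel Q (cls c) (cls k)"
    by (rule is_kernel_cls[OF t(1) K(2) f(3) C(1) K(1,5)]) (use ker in blast)
  have 3: "is_epi Q (cls r)" by (rule is_epi_cls[OF K(3) f(2) K(1)]) (use epi in blast)
  have 4: "cls k \<cdot>\<^bsub>Q\<^esub> cls r = F" using comp_Q[OF K(3,2) f(2) K(1) f(3)] K(4) f(4) by simp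
  show thesis
    by (rule that[OF C(1-3) 1 cls_Hom[OF K(2,1) f(3)] cls_Hom[OF K(3) f(2) K(1)] 4 2 3])
qed

definition S_inflation_up_to_iso :: "'m set \<Rightarrow> 'o \<Rightarrow> 'o \<Rightarrow> bool"
  where "S_inflation_up_to_iso \<alpha> X Y \<longleftrightarrow> (\<exists>X' \<in> H. \<exists>Y' \<in> H. \<exists>Z \<in> S. \<exists>p q \<delta>. etriangle B X' p Y' q Z \<delta> \<and>
    (\<exists>\<beta> \<in> Hom Q X X'. \<exists>\<gamma> \<in> Hom Q Y Y'. is_isomorphism Q \<beta> \<and> is_isomorphism Q \<gamma> \<and>
      cls p \<cdot>\<^bsub>Q\<^esub> \<beta> = \<gamma> \<cdot>\<^bsub>Q\<^esub> \<alpha>))"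

text \<open>The factorization provides a cokernel that is an \<open>S\<close>-inflation, and cokernels are unique.\<close>

lemma cokernel_S_inflation_up_to_iso:
  assumes coker: "is_cokernel Q g \<alpha>" and g: "g \<in> Hom Q A X" and \<alpha>: "\<alpha> \<in> Hom Q X Y"
  shows "S_inflation_up_to_iso \<alpha> X Y"
proof -
  have X: "X \<in> H" using \<alpha> Hom_Q by blast
  obtain C Z c q \<delta> k K r where C: "C \<in> H" "Z \<in> S" "etriangle B X c C q Z \<delta>"
    "is_cokernel Q g (cls c)" "k \<in> Hom Q K X" "r \<in> Hom Q A K" "k \<cdot>\<^bsub>Q\<^esub> r = g"
    "is_kernel Q (cls c) k" "is_epi Q r"
    by (rule heart_morphism_factorization[OF g])
  have c: "cls c \<in> Hom Q X C" by (rule cls_Hom[OF etriangle_Hom(1)[OF C(3)] X C(1)])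
  obtain u where u: "u \<in> Hom Q Y C" "is_isomorphism Q u" "u \<cdot>\<^bsub>Q\<^esub> \<alpha> = cls c"
    using preadditive_category.is_cokernel_unique[OF preadditive_category_Q coker \<alpha> C(4) c g] by blast
  have i: "Ident Q X \<in> Hom Q X X" "is_isomorphism Q (Ident Q X)"
    using category.Ident_in[OF category_Q, of X] category.Ident_iso[OF category_Q, of X] X by simp_all
  have "cls c \<cdot>\<^bsub>Q\<^esub> Ident Q X = u \<cdot>\<^bsub>Q\<^esub> \<alpha>" using category.Ident_right[OF category_Q c] u(3) by simp
  then show ?thesis unfolding S_inflation_up_to_iso_def using X C(1-3) i u(1,2) by blast
qed

lemma S_inflation_up_to_iso_kernel_cokernel:
  assumes "S_inflation_up_to_iso \<alpha> X Y" and \<alpha>: "\<alpha> \<in> Hom Q X Y"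
  shows "\<exists>K. \<exists>g \<in> Hom Q K X. is_cokernel Q g \<alpha>" "\<exists>K. \<exists>k \<in> Hom Q K X. is_kernel Q \<alpha> k"
proof -
  obtain X' Y' Z p q \<delta> \<beta> \<gamma> where h: "X' \<in> H" "Y' \<in> H" "Z \<in> S" "etriangle B X' p Y' q Z \<delta>"
    "\<beta> \<in> Hom Q X X'" "\<gamma> \<in> Hom Q Y Y'" "is_isomorphism Q \<beta>" "is_isomorphism Q \<gamma>"
    "cls p \<cdot>\<^bsub>Q\<^esub> \<beta> = \<gamma> \<cdot>\<^bsub>Q\<^esub> \<alpha>"
    using assms(1) unfolding S_inflation_up_to_iso_def by blast
  have p: "cls p \<in> Hom Q X' Y'" by (rule cls_Hom[OF etriangle_Hom(1)[OF h(4)] h(1,2)])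
  obtain K k where k: "k \<in> Hom Q K X'" "is_kernel Q (cls p) k" "is_cokernel Q k (cls p)"
    using S_inflation_kernel_cokernel[OF h(4,1,2,3)] by blast
  show "\<exists>K. \<exists>g \<in> Hom Q K X. is_cokernel Q g \<alpha>"
    using preadditive_category.is_cokernel_transport[OF preadditive_category_Q k(3,1) p \<alpha> h(5-9)] by blast
  show "\<exists>K. \<exists>k \<in> Hom Q K X. is_kernel Q \<alpha> k"
    using preadditive_category.is_kernel_transport[OF preadditive_category_Q k(2,1) p \<alpha> h(5-9)] by blast
qed

lemma abelian_heart_iff:
  "abelian_category Q \<longleftrightarrow> (\<forall>X Y \<alpha>. \<alpha> \<in> Hom Q X Y \<and> is_epi Q \<alpha> \<longrightarrow> S_inflation_up_to_iso \<alpha> X Y)"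
proof
  assume "abelian_category Q"
  then have ab: "\<exists>g. is_cokernel Q g \<alpha>" if "is_epi Q \<alpha>" for \<alpha>
    using that by (rule abelian_category.epi_is_cokernel)
  show "\<forall>X Y \<alpha>. \<alpha> \<in> Hom Q X Y \<and> is_epi Q \<alpha> \<longrightarrow> S_inflation_up_to_iso \<alpha> X Y"
  proof (intro allI impI)
    fix X Y \<alpha> assume \<alpha>: "\<alpha> \<in> Hom Q X Y \<and> is_epi Q \<alpha>"
    then obtain g where g: "is_cokernel Q g \<alpha>" using ab by blast
    then have "g \<in> Hom Q (Dom Q g) X" using \<alpha> unfolding is_cokernel_def Hom_def by simp
    then show "S_inflation_up_to_iso \<alpha> X Y" using cokernel_S_inflation_up_to_iso g \<alpha> by blast
  qed
next
  assume pres: "\<forall>X Y \<alpha>. \<alpha> \<in> Hom Q X Y \<and> is_epi Q \<alpha> \<longrightarrow> S_inflation_up_to_iso \<alpha> X Y"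
  show "abelian_category Q"
  proof (intro abelian_category.intro abelian_category_axioms.intro)
    show "additive_category Q" by (rule additive_category_heart)
  next
    fix F assume "F \<in> Arr Q"
    then obtain X Y where F: "F \<in> Hom Q X Y" using Arr_Q by blast
    then have o: "X \<in> H" "Y \<in> H" using Hom_Q by blast+
    obtain C Z c q \<delta> K k r where C: "C \<in> H" "Z \<in> S" "etriangle B Y c C q Z \<delta>"
      "is_cokernel Q F (cls c)" "k \<in> Hom Q K Y" "r \<in> Hom Q X K" "k \<cdot>\<^bsub>Q\<^esub> r = F"
      "is_kernel Q (cls c) k" "is_epi Q r"
      by (rule heart_morphism_factorization[OF F])
    have c: "cls c \<in> Hom Q Y C" by (rule cls_Hom[OF etriangle_Hom(1)[OF C(3)] o(2) C(1)])
    show "\<exists>c. is_cokernel Q F c" using C(4) by blast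
    obtain J j where j: "j \<in> Hom Q J X" "is_kernel Q r j"
      using S_inflation_up_to_iso_kernel_cokernel(2)[OF _ C(6)] pres C(6,9) by blast
    have "is_mono Q k" by (rule preadditive_category.is_kernelD(2)[OF preadditive_category_Q C(8) c C(5)])
    then show "\<exists>k. is_kernel Q F k"
      using preadditive_category.is_kernel_comp_mono[OF preadditive_category_Q j(2,1) C(6,5)] C(7) by auto
  next
    fix F assume mono: "is_mono Q F"
    then have "F \<in> Arr Q" unfolding is_mono_def by blast
    then obtain X Y where F: "F \<in> Hom Q X Y" using Arr_Q by blast
    then have o: "X \<in> H" "Y \<in> H" using Hom_Q by blast+
    obtain C Z c q \<delta> K k r where C: "C \<in> H" "Z \<in> S" "etriangle B Y c C q Z \<delta>"
      "is_cokernel Q F (cls c)" "k \<in> Hom Q K Y" "r \<in> Hom Q X K" "k \<cdot>\<^bsub>Q\<^esub> r = F"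
      "is_kernel Q (cls c) k" "is_epi Q r"
      by (rule heart_morphism_factorization[OF F])
    have c: "cls c \<in> Hom Q Y C" by (rule cls_Hom[OF etriangle_Hom(1)[OF C(3)] o(2) C(1)])
    obtain A g where g: "g \<in> Hom Q A X" "is_cokernel Q g r"
      using S_inflation_up_to_iso_kernel_cokernel(1)[OF _ C(6)] pres C(6,9) by blast
    have "is_kernel Q (cls c) (k \<cdot>\<^bsub>Q\<^esub> r)"
      by (rule preadditive_category.is_kernel_of_mono_factorization[OF preadditive_category_Q _ C(6,5,8) c g(2,1)]) (use mono C(7) in simp)
    then show "\<exists>g. is_kernel Q g F" using C(7) by auto
  next
    fix F assume epi: "is_epi Q F"
    then have "F \<in> Arr Q" unfolding is_epi_def by blast
    then obtain X Y where F: "F \<in> Hom Q X Y" using Arr_Q by blast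
    then show "\<exists>g. is_cokernel Q g F" using S_inflation_up_to_iso_kernel_cokernel(1)[OF _ F] pres epi by blast
  qed
qed

end

theorem theorem1p3:
  fixes B :: "('o, 'm, 'e) extri"
    and S T U V :: "'o set"
  assumes "extriangulated B"
    and "twin_cotorsion_pair B S T U V"
  shows "abelian_category (heart B S T U V) \<longleftrightarrow>
    (\<forall>X Y \<alpha>. \<alpha> \<in> Hom (heart B S T U V) X Y \<and> is_epi (heart B S T U V) \<alpha> \<longrightarrow>
      (\<exists>X' \<in> heart_objects B S T U V. \<exists>Y' \<in> heart_objects B S T U V. \<exists>Z \<in> S.
        \<exists>p' q' \<delta>. etriangle B X' p' Y' q' Z \<delta> \<and>
          (\<exists>\<beta> \<in> Hom (heart B S T U V) X X'. \<exists>\<gamma> \<in> Hom (heart B S T U V) Y Y'.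
            is_isomorphism (heart B S T U V) \<beta> \<and> is_isomorphism (heart B S T U V) \<gamma> \<and>
            heart_class B S T U V p' \<cdot>\<^bsub>heart B S T U V\<^esub> \<beta>
              = \<gamma> \<cdot>\<^bsub>heart B S T U V\<^esub> \<alpha>)))"
proof -
  interpret twin_cotorsion B S T U V
    using assms by (intro twin_cotorsion.intro twin_cotorsion_axioms.intro)
  show ?thesis
    using abelian_heart_iff unfolding S_inflation_up_to_iso_def heart_def heart_class_def .
qed

end
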